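(* Let $\mathsf{C}:\Omega\times\Omega\times\Theta\to\mathbb R^d$ be a collision map for which there exist constants $L_{\mathsf C},C_{\mathsf C}>0$ such that for all $v,v_*,w,w_*\in\Omega$ and $\theta\in\Theta$, $$|\mathsf C(v,v_*,\theta)-\mathsf C(w,w_*,\theta)|\le L_{\mathsf C}(1+|\theta|)\big(|v-w|+|v_*-w_*|\big),\qquad |\mathsf C(v,v_*,\theta)|\le C_{\mathsf C}(1+|\theta|)\big(|v|+|v_*|\big),$$ and let $B\in\mathcal P_\infty(\Theta)$. Let $(f_n)_{n\in\mathbb N}$ be constructed according to the explicit (forward) Euler iteration $f_{n+1}=(1-\Delta t)f_n+\Delta t\,Q^+(f_n,f_n)$ with initial datum $f_0\in\mathcal P_1(\mathbb R^d)$ and step size $\Delta t\in(0,1)$. For a given time horizon $T>0$, consider the interpolation $f^{\Delta t}\in\mathcal C([0,T],\mathcal P_1(\mathbb R^d))$, $$f^{\Delta t}(t)=(1-s)f_n+s f_{n+1},\qquad s=(t-n\Delta t)/\Delta t,\quad t\in[n\Delta t,(n+1)\Delta t].$$ Then, as $\Delta t\to0$, $f^{\Delta t}$ converges to some $f\in\mathrm{Lip}([0,T],\mathcal P_1(\mathbb R^d))$, which is the unique weak measure solution over $[0,T]$ of the Cauchy problem $\partial_t f=Q(f,f)$ with initial datum $f_0$. Moreover, $$\sup_{t\in[0,T]}\|f^{\Delta t}(t)-f(t)\|_{\mathtt{KR}}\le C_{\mathrm{FE}}\,\Delta t$$ for some positive constant $C_{\mathrm{FE}}$ which depends on $T,L_{\mathsf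 C},C_{\mathsf C},M_\infty(B)$.
   Context: Setting: $\Omega\subseteq\mathbb R^d$ is a (possibly unbounded) domain, $\Theta$ is the space of collision parameters, and $B$ is a probability distribution on $\Theta$. Two particles $v,v_*\in\Omega$ with parameters $\theta,\theta_*\in\Theta$ (each distributed according to $B$, possibly dependent on each other) collide to give $v'=\mathsf C(v,v_*,\theta)$, $v_*'=\mathsf C(v_*,v,\theta_* )$, which again lie in $\Omega$. Probability measures describing the particles (in particular the initial datum) are regarded as probability measures on $\mathbb R^d$ describing particles in $\Omega$. Collision operator: for every bounded continuous test function $\phi$, $$\int\phi(v)\,Q(f,f)(dv)=\frac12\iiint B(d\theta)\big(\phi(v')+\phi(v_*')-\phi(v)-\phi(v_* )\big)f(dv)f(dv_* ).$$ Its gain part $Q^+$ is defined by $\int\phi\,dQ^+(g,g)=\frac12\iiint(\phi(v')+\phi(v_*'))B(d\theta)g(dv)g(dv_* )$, equivalently $Q^+(g,g)=\mathsf C_\#(g\otimes g\otimes B)$ (push-forward), and for a probability measure $f$ one has $Q(f,f)=Q^+(f,f)-f$. Weak measure solution over $[0,T]$ with initial datum $f_0\in\mathcal P(\mathbb R^d)$: a curve $f\in\mathcal C([0,T],\mathcal P(\mathbb R^d))$ with $f(0)=f_0$ such that for every $\phi\in\mathcal C_0^\infty(\mathbb R^d)$ (smooth, compactly supported) and almost every $t\in[0,T]$ $$\frac{d}{dt}\int\phi(v)f(t,dv)=\frac12\iiint B(d\theta)\big(\phi(v')+\phi(v_*')-\phi(v)-\phi(v_* )\big)f(t,dv)f(t,dv_*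 ).$$ Spaces and norms: $\mathcal P(\mathbb R^d)$ is the set of Borel probability measures on $\mathbb R^d$; $\mathcal P_1(\mathbb R^d)$ those with finite first moment; $M_\infty(B)=\sup_{\theta\in\mathrm{supp}(B)}|\theta|$ and $\mathcal P_\infty(\Theta)$ denotes the probability measures on $\Theta$ with $M_\infty<\infty$. For a signed Radon measure $\mu$ on $\mathbb R^d$, $\|\mu\|_{\mathtt{KR}}=\sup\{\int\phi\,d\mu:\ \|\phi\|_{\mathrm{Lip}}\le1\}$ (Kantorovich–Rubinstein norm); for $f,g\in\mathcal P_1(\mathbb R^d)$, $\|f-g\|_{\mathtt{KR}}=\mathbb W_1(f,g)$, the Wasserstein-1 distance. $\mathcal P_1(\mathbb R^d)$ is equipped with $\mathbb W_1$, and $\mathrm{Lip}([0,T],\mathcal P_1(\mathbb R^d))$ denotes the $\mathbb W_1$-Lipschitz curves.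
   Formalization: Weak solutions must have absolutely continuous test integrals in time (with mere continuity and the equation a.e., uniqueness fails), and C_FE may also depend on the first moment of the initial datum f_0 (by scaling this is unavoidable). *)

theory Defs
  imports "HOL-Analysis.Analysis" "HOL-Probability.Probability"
begin

definition Prob :: "'a::euclidean_space measure set" where
  "Prob = {\<mu>. prob_space \<mu> \<and> sets \<mu> = sets borel}"

definition Prob1 :: "'a::euclidean_space measure set" where
  "Prob1 = {\<mu> \<in> Prob. integrable \<mu> norm}"

definition first_moment :: "'a::euclidean_space measure \<Rightarrow> real" where
  "first_moment \<mu> = (\<integral>v. norm v \<partial>\<mu>)"

definition couplings ::
    "'a::euclidean_space measure \<Rightarrow> 'a measure \<Rightarrow> ('a \<times> 'a) measure set" where
  "couplings \<mu> \<nu> = {\<pi>. sets \<pi> = sets (borel \<Otimes>\<^sub>M borel) \<and>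
     distr \<pi> borel fst = \<mu> \<and> distr \<pi> borel snd = \<nu>}"

definition W1 :: "'a::euclidean_space measure \<Rightarrow> 'a measure \<Rightarrow> ennreal" where
  "W1 \<mu> \<nu> = (INF \<pi>\<in>couplings \<mu> \<nu>. \<integral>\<^sup>+ (x, y). ennreal (dist x y) \<partial>\<pi>)"

text \<open>The Kantorovich--Rubinstein norm of the signed measure \<open>\<mu> - \<nu>\<close>.  The supremum is taken in
  the extended reals, so that it is meaningful without a boundedness proof.  It is only used for
  \<open>\<mu>\<close> and \<open>\<nu>\<close> with finite first moment, where all the integrals exist.\<close>

definition KR_diff :: "'a::euclidean_space measure \<Rightarrow> 'a measure \<Rightarrow> ereal" where
  "KR_diff \<mu> \<nu> =
     (SUP \<phi>\<in>{\<phi> :: 'a \<Rightarrow> real. 1-lipschitz_on UNIV \<phi>}.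
        ereal ((\<integral>v. \<phi> v \<partial>\<mu>) - (\<integral>v. \<phi> v \<partial>\<nu>)))"

definition mix :: "real \<Rightarrow> 'a::euclidean_space measure \<Rightarrow> 'a measure \<Rightarrow> 'a measure" where
  "mix s \<mu> \<nu> = measure_of UNIV (sets borel)
     (\<lambda>A. ennreal (1 - s) * emeasure \<mu> A + ennreal s * emeasure \<nu> A)"

definition narrow_continuous_on :: "real set \<Rightarrow> (real \<Rightarrow> 'a::euclidean_space measure) \<Rightarrow> bool" where
  "narrow_continuous_on I f \<longleftrightarrow>
     (\<forall>\<phi> :: 'a \<Rightarrow> real. continuous_on UNIV \<phi> \<and> bounded (range \<phi>) \<longrightarrow>
        continuous_on I (\<lambda>t. \<integral>v. \<phi> v \<partial>f t))"

definition W1_continuous_on :: "real set \<Rightarrow> (real \<Rightarrow> 'a::euclidean_space measure) \<Rightarrow> bool" where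
  "W1_continuous_on I f \<longleftrightarrow> (\<forall>t\<in>I. f t \<in> Prob1) \<and>
     (\<forall>t\<in>I. ((\<lambda>s. W1 (f s) (f t)) \<longlongrightarrow> 0) (at t within I))"

definition W1_Lipschitz_on :: "real set \<Rightarrow> (real \<Rightarrow> 'a::euclidean_space measure) \<Rightarrow> bool" where
  "W1_Lipschitz_on I f \<longleftrightarrow> (\<forall>t\<in>I. f t \<in> Prob1) \<and>
     (\<exists>K\<ge>0. \<forall>s\<in>I. \<forall>t\<in>I. W1 (f s) (f t) \<le> ennreal (K * \<bar>s - t\<bar>))"

text \<open>The parameter space \<open>\<Theta>\<close> is a subset of a separable normed space, with the trace of the Borel
  sigma-algebra; the support is relative to \<open>\<Theta> = space B\<close>.\<close>

definition supp :: "'p::real_normed_vector measure \<Rightarrow> 'p set" where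
  "supp B = {\<theta> \<in> space B. \<forall>U. open U \<and> \<theta> \<in> U \<longrightarrow> emeasure B (U \<inter> space B) > 0}"

definition M_inf :: "'p::real_normed_vector measure \<Rightarrow> real" where
  "M_inf B = Sup (norm ` supp B)"

definition Prob_inf :: "'p::real_normed_vector set \<Rightarrow> 'p measure set" where
  "Prob_inf \<Theta> = {B. prob_space B \<and> sets B = sets (restrict_space borel \<Theta>) \<and>
     bdd_above (norm ` supp B)}"

text \<open>\<open>J\<close> is the joint law of the parameters \<open>(\<theta>, \<theta>\<^sub>*)\<close> of the two colliding particles: both
  are distributed according to \<open>B\<close>, but they may depend on each other.\<close>

definition joint_law :: "'p measure \<Rightarrow> ('p \<times> 'p) measure \<Rightarrow> bool" where
  "joint_law B J \<longleftrightarrow> sets J = sets (B \<Otimes>\<^sub>M B) \<and> distr J B fst = B \<and> distr J B snd = B"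

text \<open>The measurability of the collision map is what the push-forward in the definition of the gain
  term needs.  Values of \<open>C\<close> outside \<open>\<Omega> \<times> \<Omega> \<times> \<Theta>\<close> are irrelevant throughout:
  the measures \<open>g\<close>, \<open>f\<close> below live on the whole space, are concentrated on \<open>\<Omega>\<close>, and are restricted
  to \<open>\<Omega>\<close> before they are integrated against expressions involving \<open>C\<close>.\<close>

definition collision_map ::
    "'a::euclidean_space set \<Rightarrow> 'p::real_normed_vector set \<Rightarrow> ('a \<Rightarrow> 'a \<Rightarrow> 'p \<Rightarrow> 'a) \<Rightarrow> bool" where
  "collision_map \<Omega> \<Theta> C \<longleftrightarrow>
     (\<lambda>(v, w, \<theta>). C v w \<theta>) \<in> borel_measurable
        (restrict_space borel \<Omega> \<Otimes>\<^sub>M (restrict_space borel \<Omega> \<Otimes>\<^sub>M restrict_space borel \<Theta>)) \<and>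
     (\<forall>v\<in>\<Omega>. \<forall>w\<in>\<Omega>. \<forall>\<theta>\<in>\<Theta>. C v w \<theta> \<in> \<Omega>)"

definition gain ::
    "'a::euclidean_space set \<Rightarrow> ('a \<Rightarrow> 'a \<Rightarrow> 'p \<Rightarrow> 'a) \<Rightarrow> 'p measure \<Rightarrow> 'a measure \<Rightarrow> 'a measure" where
  "gain \<Omega> C B g =
     distr (restrict_space g \<Omega> \<Otimes>\<^sub>M (restrict_space g \<Omega> \<Otimes>\<^sub>M B)) borel (\<lambda>(v, w, \<theta>). C v w \<theta>)"

text \<open>The pairing of the collision operator \<open>Q(f, f)\<close> with a test function; \<open>w\<close>, \<open>\<eta>\<close> stand for
  \<open>v\<^sub>*\<close>, \<open>\<theta>\<^sub>*\<close>.\<close>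

definition collision_weak ::
    "'a::euclidean_space set \<Rightarrow> ('a \<Rightarrow> 'a \<Rightarrow> 'p \<Rightarrow> 'a) \<Rightarrow> ('p \<times> 'p) measure \<Rightarrow>
     'a measure \<Rightarrow> ('a \<Rightarrow> real) \<Rightarrow> real" where
  "collision_weak \<Omega> C J f \<phi> = 1/2 *
     (\<integral>(v, w, \<theta>, \<eta>). \<phi> (C v w \<theta>) + \<phi> (C w v \<eta>) - \<phi> v - \<phi> w
        \<partial>(restrict_space f \<Omega> \<Otimes>\<^sub>M (restrict_space f \<Omega> \<Otimes>\<^sub>M J)))"

primrec C_times :: "nat \<Rightarrow> ('a::euclidean_space \<Rightarrow> real) \<Rightarrow> bool" where
  "C_times 0 \<phi> \<longleftrightarrow> continuous_on UNIV \<phi>"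
| "C_times (Suc k) \<phi> \<longleftrightarrow> (\<forall>x. \<phi> differentiable (at x)) \<and>
     (\<forall>b\<in>Basis. C_times k (\<lambda>x. frechet_derivative \<phi> (at x) b))"

definition test_function :: "('a::euclidean_space \<Rightarrow> real) \<Rightarrow> bool" where
  "test_function \<phi> \<longleftrightarrow> (\<forall>k. C_times k \<phi>) \<and> compact (closure {x. \<phi> x \<noteq> 0})"

definition abs_continuous_on :: "real set \<Rightarrow> (real \<Rightarrow> real) \<Rightarrow> bool" where
  "abs_continuous_on I F \<longleftrightarrow>
     (\<forall>\<epsilon>>0. \<exists>\<delta>>0. \<forall>(n::nat) a b.
        (\<forall>i<n. a i \<in> I \<and> b i \<in> I \<and> a i \<le> b i) \<and>
        disjoint_family_on (\<lambda>i. {a i<..<b i}) {..<n} \<and> (\<Sum>i<n. b i - a i) < \<delta> \<longrightarrow>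
        (\<Sum>i<n. \<bar>F (b i) - F (a i)\<bar>) < \<epsilon>)"

text \<open>An equation for \<open>d/dt\<close> that holds for almost every \<open>t\<close> is understood, as usual, for functions
  of \<open>t\<close> that are absolutely continuous.  With mere continuity there is no uniqueness: if \<open>C v w \<theta> = v\<close>
  (so that \<open>Q = 0\<close>), \<open>a\<close> and \<open>b\<close> are points of \<open>\<Omega>\<close> and \<open>c\<close> is the Cantor function, then
  \<open>(1 - c(t)) \<delta>\<^sub>a + c(t) \<delta>\<^sub>b\<close> is continuous in \<open>t\<close> and satisfies the equation at almost every \<open>t\<close>.\<close>

definition weak_measure_solution ::
    "'a::euclidean_space set \<Rightarrow> ('a \<Rightarrow> 'a \<Rightarrow> 'p \<Rightarrow> 'a) \<Rightarrow> ('p \<times> 'p) measure \<Rightarrow> real \<Rightarrow>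
     'a measure \<Rightarrow> (real \<Rightarrow> 'a measure) \<Rightarrow> bool" where
  "weak_measure_solution \<Omega> C J T f0 f \<longleftrightarrow>
     (\<forall>t\<in>{0..T}. f t \<in> Prob \<and> emeasure (f t) \<Omega> = 1) \<and>
     narrow_continuous_on {0..T} f \<and>
     f 0 = f0 \<and>
     (\<forall>\<phi>. test_function \<phi> \<longrightarrow>
        abs_continuous_on {0..T} (\<lambda>t. \<integral>v. \<phi> v \<partial>f t) \<and>
        (AE t in lborel. t \<in> {0..T} \<longrightarrow>
           ((\<lambda>s. \<integral>v. \<phi> v \<partial>f s) has_real_derivative collision_weak \<Omega> C J (f t) \<phi>)
             (at t within {0..T})))"

primrec euler ::
    "'a::euclidean_space set \<Rightarrow> ('a \<Rightarrow> 'a \<Rightarrow> 'p \<Rightarrow> 'a) \<Rightarrow> 'p measure \<Rightarrow> 'a measure \<Rightarrow> real \<Rightarrow>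
     nat \<Rightarrow> 'a measure" where
  "euler \<Omega> C B f0 h 0 = f0"
| "euler \<Omega> C B f0 h (Suc n) = mix h (euler \<Omega> C B f0 h n) (gain \<Omega> C B (euler \<Omega> C B f0 h n))"

definition euler_interp ::
    "'a::euclidean_space set \<Rightarrow> ('a \<Rightarrow> 'a \<Rightarrow> 'p \<Rightarrow> 'a) \<Rightarrow> 'p measure \<Rightarrow> 'a measure \<Rightarrow> real \<Rightarrow>
     real \<Rightarrow> 'a measure" where
  "euler_interp \<Omega> C B f0 h t =
     (let n = nat \<lfloor>t / h\<rfloor>; s = (t - real n * h) / h
      in mix s (euler \<Omega> C B f0 h n) (euler \<Omega> C B f0 h (Suc n)))"

end

theory Submission
  imports Defs
begin

text \<open>
  Since \<open>|C(v, w, \<theta>)|\<close> grows at most linearly in \<open>|v| + |w|\<close>, the gain term is a bounded bilinear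
  operation on measures for the total variation norm weighted by \<open>1 + |v|\<close>. In this norm
  \<open>f' = Q\<^sup>+(f, f) - f\<close> is an ordinary differential equation with a locally Lipschitz right-hand side,
  and the first moments of the solution and of the Euler iterates grow at most exponentially
  (\<open>F_moment\<close>, \<open>\<mu>_moment\<close>). The first-order error bound is then the classical one: the local error
  is quadratic in the step (\<open>F_taylor\<close>, \<open>local_error\<close>) and accumulates by a discrete Gronwall
  argument (\<open>interp_error\<close>). It passes to \<open>W\<^sub>1\<close> and to the Kantorovich--Rubinstein norm because both
  are dominated by the weighted total variation (\<open>W1_le_tv\<close>, \<open>KR_diff_le_tv\<close>). The norm occurs
  only in its dual form: \<open>tv_le \<omega> \<mu> \<nu> d\<close> says that no measurable observable bounded by \<open>\<omega>\<close>
  separates \<open>\<mu>\<close> and \<open>\<nu>\<close> by more than \<open>d\<close>. In this way differences of measures are handled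
  without signed measures.

  Existence comes from an explicit formula, the Wild sum
  \<open>f(t) = \<Sum>\<^sub>n e\<^sup>-\<^sup>t (1 - e\<^sup>-\<^sup>t)\<^sup>n Q\<^sub>n\<close> with \<open>Q\<^sub>0 = f\<^sub>0\<close> and
  \<open>(n + 1) Q\<^sub>n\<^sub>+\<^sub>1 = \<Sum>\<^sub>k\<^sub>\<le>\<^sub>n Q\<^sup>+(Q\<^sub>k, Q\<^sub>n\<^sub>-\<^sub>k)\<close>. Integrated against an observable it is \<open>e\<^sup>-\<^sup>t\<close> times a
  power series in \<open>1 - e\<^sup>-\<^sup>t\<close>, which may be differentiated term by term; the derivative series is the
  Cauchy product that expands \<open>Q\<^sup>+(f(t), f(t))\<close> (\<open>bigain_wild_sum\<close>, \<open>wild_sum_derivative\<close>).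

  A competing weak solution need not have a first moment, so uniqueness is proved in the
  unweighted total variation (\<open>weak_solution_unique\<close>). Against a test function the difference of
  two solutions is absolutely continuous, and its derivative is controlled almost everywhere by the
  total variation distance. Integrating this bound (\<open>abs_continuous_increment_le\<close>) and recovering the
  total variation from test functions (\<open>test_functions_determine_tv\<close>) improves a bound
  \<open>2 (6t)\<^sup>n / n!\<close> to the same bound with \<open>n + 1\<close>; hence the distance vanishes.
\<close>

section \<open>Countable mixtures of measures\<close>

text \<open>The weights are nonnegative in all applications but need not sum to one; mixtures of two measures,
averages, and the Wild sum are all instances.\<close>

definition mixture ::
    "(nat \<Rightarrow> real) \<Rightarrow> (nat \<Rightarrow> 'a::topological_space measure) \<Rightarrow> 'a measure" where
  "mixture c Q = measure_of UNIV (sets borel) (\<lambda>A. \<Sum>n. ennreal (c n) * emeasure (Q n) A)"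

lemma sets_mixture [simp, measurable_cong]: "sets (mixture c Q) = sets borel"
  using sets.sigma_sets_eq[of borel] by (simp add: mixture_def)

lemma space_mixture [simp]: "space (mixture c Q) = UNIV"
  by (simp add: mixture_def)

lemma suminf_ennreal_swap:
  fixes f :: "nat \<Rightarrow> nat \<Rightarrow> ennreal"
  shows "(\<Sum>i. \<Sum>j. f i j) = (\<Sum>j. \<Sum>i. f i j)"
  using nn_integral_suminf[of "\<lambda>i j. f i j" "count_space UNIV"]
  by (simp add: nn_integral_count_space_nat)

lemma emeasure_mixture:
  assumes Q: "\<And>n. sets (Q n) = sets borel" and A: "A \<in> sets borel"
  shows "emeasure (mixture c Q) A = (\<Sum>n. ennreal (c n) * emeasure (Q n) A)"
proof (rule emeasure_measure_of[OF mixture_def])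
  show "A \<in> sets (mixture c Q)" using A by simp
  show "countably_additive (sets (mixture c Q)) (\<lambda>A. \<Sum>n. ennreal (c n) * emeasure (Q n) A)"
  proof (rule countably_additiveI)
    fix A :: "nat \<Rightarrow> 'a set"
    assume "range A \<subseteq> sets (mixture c Q)" "disjoint_family A"
    then have "(\<Sum>i. emeasure (Q n) (A i)) = emeasure (Q n) (\<Union>i. A i)" for n
      by (intro suminf_emeasure) (auto simp: Q)
    then show "(\<Sum>i. \<Sum>n. ennreal (c n) * emeasure (Q n) (A i))
        = (\<Sum>n. ennreal (c n) * emeasure (Q n) (\<Union> (range A)))"
      by (subst suminf_ennreal_swap) simp
  qed
qed (auto simp: positive_def)

lemma nn_integral_mixture:
  assumes Q: "\<And>n. sets (Q n) = sets borel" and f: "f \<in> borel_measurable borel"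
  shows "(\<integral>\<^sup>+x. f x \<partial>mixture c Q) = (\<Sum>n. ennreal (c n) * (\<integral>\<^sup>+x. f x \<partial>Q n))"
proof -
  have m: "g \<in> borel_measurable (Q n)" if "g \<in> borel_measurable borel"
    for g :: "'a \<Rightarrow> ennreal" and n
    using that by (simp add: measurable_cong_sets[OF Q refl])
  have m': "g \<in> borel_measurable (mixture c Q)" if "g \<in> borel_measurable borel"
    for g :: "'a \<Rightarrow> ennreal"
    using that by (simp cong: measurable_cong_sets)
  show ?thesis
    using f
  proof (induction rule: borel_measurable_induct)
    case (cong f g)
    then show ?case by (simp cong: nn_integral_cong)
  next
    case (set A)
    then show ?case by (simp add: emeasure_mixture Q)
  next
    case (mult u a)
    then show ?case
      by (simp add: nn_integral_cmult m m' mult.left_commute[of _ a])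
  next
    case (add u v)
    then show ?case
      by (simp add: nn_integral_add m m' distrib_left suminf_add)
  next
    case (seq U)
    have "(\<integral>\<^sup>+x. (SUP i. U i x) \<partial>mixture c Q) = (SUP i. \<integral>\<^sup>+x. U i x \<partial>mixture c Q)"
      using seq by (intro nn_integral_monotone_convergence_SUP) (auto simp: m')
    also have "\<dots> = (SUP i. \<Sum>n. ennreal (c n) * (\<integral>\<^sup>+x. U i x \<partial>Q n))"
      using seq by simp
    also have "\<dots> = (SUP i. \<integral>\<^sup>+n. ennreal (c n) * (\<integral>\<^sup>+x. U i x \<partial>Q n) \<partial>count_space UNIV)"
      by (simp add: nn_integral_count_space_nat)
    also have "\<dots> = (\<integral>\<^sup>+n. (SUP i. ennreal (c n) * (\<integral>\<^sup>+x. U i x \<partial>Q n)) \<partial>count_space UNIV)"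
      using \<open>incseq U\<close>
      by (intro nn_integral_monotone_convergence_SUP[symmetric])
         (auto simp: incseq_def le_fun_def intro!: mult_left_mono nn_integral_mono)
    also have "\<dots> = (\<Sum>n. ennreal (c n) * (\<integral>\<^sup>+x. (SUP i. U i x) \<partial>Q n))"
      using seq
      by (subst nn_integral_monotone_convergence_SUP)
         (auto simp: m nn_integral_count_space_nat SUP_mult_left_ennreal)
    finally show ?case by (simp add: image_comp)
  qed
qed

lemma ennreal_sums_enn2real:
  assumes "(\<Sum>n. a n) \<noteq> (\<top>::ennreal)"
  shows "(\<lambda>n. enn2real (a n)) sums enn2real (\<Sum>n. a n)"
proof -
  have fin: "a n \<noteq> \<top>" for n
    using assms by (metis ennreal_suminf_lessD less_top)
  then have a: "ennreal (enn2real (a n)) = a n" for n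
    by (simp add: less_top)
  have sm: "summable (\<lambda>n. enn2real (a n))"
    using assms by (intro summable_suminf_not_top) (simp_all add: a)
  have "(\<Sum>n. a n) = (\<Sum>n. ennreal (enn2real (a n)))"
    by (simp add: a)
  also have "\<dots> = ennreal (\<Sum>n. enn2real (a n))"
    by (intro suminf_ennreal_eq sm[THEN summable_sums]) simp
  finally show ?thesis
    using sm by (auto simp: summable_sums suminf_nonneg)
qed

text \<open>Integrability with respect to the mixture makes both the positive and the negative part a
convergent series in the extended reals, so that the difference of the two may be taken termwise. A
component with weight zero need not integrate \<open>\<psi>\<close>; its term vanishes on both sides.\<close>

lemma integral_mixture:
  fixes \<psi> :: "'a::topological_space \<Rightarrow> real"
  assumes Q: "\<And>n. sets (Q n) = sets borel" and c: "\<And>n. 0 \<le> c n"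
    and int: "integrable (mixture c Q) \<psi>"
  shows "(\<lambda>n. c n * (\<integral>x. \<psi> x \<partial>Q n)) sums (\<integral>x. \<psi> x \<partial>mixture c Q)"
proof -
  have [measurable]: "\<psi> \<in> borel_measurable borel"
    using borel_measurable_integrable[OF int] by (simp cong: measurable_cong_sets)
  let ?p = "\<lambda>n. \<integral>\<^sup>+x. ennreal (\<psi> x) \<partial>Q n" and ?m = "\<lambda>n. \<integral>\<^sup>+x. ennreal (- \<psi> x) \<partial>Q n"
  have P: "(\<Sum>n. ennreal (c n) * ?p n) = (\<integral>\<^sup>+x. ennreal (\<psi> x) \<partial>mixture c Q)"
    and M: "(\<Sum>n. ennreal (c n) * ?m n) = (\<integral>\<^sup>+x. ennreal (- \<psi> x) \<partial>mixture c Q)"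
    by (simp_all add: nn_integral_mixture Q)
  have fin: "(\<integral>\<^sup>+x. ennreal (\<psi> x) \<partial>mixture c Q) \<noteq> \<top>"
      "(\<integral>\<^sup>+x. ennreal (- \<psi> x) \<partial>mixture c Q) \<noteq> \<top>"
    using int by (auto simp: real_integrable_def)
  have "(\<lambda>n. enn2real (ennreal (c n) * ?p n) - enn2real (ennreal (c n) * ?m n)) sums
      (enn2real (\<integral>\<^sup>+x. ennreal (\<psi> x) \<partial>mixture c Q) - enn2real (\<integral>\<^sup>+x. ennreal (- \<psi> x) \<partial>mixture c Q))"
    using fin by (intro sums_diff) (simp_all flip: P M add: ennreal_sums_enn2real)
  moreover have "enn2real (ennreal (c n) * ?p n) - enn2real (ennreal (c n) * ?m n) =
      c n * (\<integral>x. \<psi> x \<partial>Q n)" for n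
  proof (cases "c n = 0")
    case False
    have "ennreal (c n) * ?p n \<noteq> \<top>" "ennreal (c n) * ?m n \<noteq> \<top>"
      using fin by (metis P M ennreal_suminf_lessD less_top)+
    then have "?p n \<noteq> \<top>" "?m n \<noteq> \<top>"
      using False c[of n] by (auto simp: ennreal_mult_eq_top_iff)
    then have "integrable (Q n) \<psi>"
      by (auto simp: real_integrable_def measurable_cong_sets[OF Q refl])
    then show ?thesis
      by (simp add: real_lebesgue_integral_def enn2real_mult c right_diff_distrib)
  qed simp
  ultimately show ?thesis
    using int by (simp add: real_lebesgue_integral_def)
qed

lemma mix_eq_mixture:
  "mix s \<mu> \<nu> = mixture (\<lambda>n. if n = 0 then 1 - s else if n = 1 then s else 0)
     (\<lambda>n. if n = 0 then \<mu> else \<nu>)"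
proof -
  have "(\<Sum>n::nat. ennreal (if n = 0 then 1 - s else if n = 1 then s else 0)
        * emeasure (if n = 0 then \<mu> else \<nu>) A)
      = ennreal (1 - s) * emeasure \<mu> A + ennreal s * emeasure \<nu> A" for A
    by (subst suminf_finite[of "{0, 1}"]) auto
  then show ?thesis
    unfolding mix_def mixture_def by simp
qed

lemma sets_mix [simp, measurable_cong]: "sets (mix s \<mu> \<nu>) = sets borel"
  by (simp add: mix_eq_mixture)

lemma space_mix [simp]: "space (mix s \<mu> \<nu>) = UNIV"
  by (simp add: mix_eq_mixture)

lemma nn_integral_mix:
  assumes "sets \<mu> = sets borel" "sets \<nu> = sets borel" "f \<in> borel_measurable borel"
  shows "(\<integral>\<^sup>+x. f x \<partial>mix s \<mu> \<nu>) = ennreal (1 - s) * (\<integral>\<^sup>+x. f x \<partial>\<mu>) + ennreal s * (\<integral>\<^sup>+x. f x \<partial>\<nu>)"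
  unfolding mix_eq_mixture using assms
  by (subst nn_integral_mixture, simp_all) (subst suminf_finite[of "{0, 1}"], auto)

lemma emeasure_mix:
  assumes "sets \<mu> = sets borel" "sets \<nu> = sets borel" "A \<in> sets borel"
  shows "emeasure (mix s \<mu> \<nu>) A = ennreal (1 - s) * emeasure \<mu> A + ennreal s * emeasure \<nu> A"
  using nn_integral_mix[OF assms(1,2), of "indicator A" s] assms by simp

lemma integrable_mix:
  fixes \<psi> :: "'a::euclidean_space \<Rightarrow> real"
  assumes "sets \<mu> = sets borel" "sets \<nu> = sets borel" "integrable \<mu> \<psi>" "integrable \<nu> \<psi>"
  shows "integrable (mix s \<mu> \<nu>) \<psi>"
proof (rule integrableI_bounded)
  have b [measurable]: "\<psi> \<in> borel_measurable borel"
    using borel_measurable_integrable[OF assms(3)] by (simp add: measurable_cong_sets[OF assms(1) refl])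
  show "\<psi> \<in> borel_measurable (mix s \<mu> \<nu>)" by simp
  show "(\<integral>\<^sup>+x. ennreal (norm (\<psi> x)) \<partial>mix s \<mu> \<nu>) < \<infinity>"
    using assms(3,4)
    by (subst nn_integral_mix) (auto simp: assms integrable_iff_bounded ennreal_mult_less_top)
qed

lemma integral_mix:
  fixes \<psi> :: "'a::euclidean_space \<Rightarrow> real"
  assumes "sets \<mu> = sets borel" "sets \<nu> = sets borel" "integrable \<mu> \<psi>" "integrable \<nu> \<psi>"
    and s: "0 \<le> s" "s \<le> 1"
  shows "(\<integral>x. \<psi> x \<partial>mix s \<mu> \<nu>) = (1 - s) * (\<integral>x. \<psi> x \<partial>\<mu>) + s * (\<integral>x. \<psi> x \<partial>\<nu>)"
proof -
  let ?c = "\<lambda>n::nat. if n = 0 then 1 - s else if n = 1 then s else 0"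
    and ?Q = "\<lambda>n::nat. if n = 0 then \<mu> else \<nu>"
  have "(\<lambda>n. ?c n * (\<integral>x. \<psi> x \<partial>?Q n)) sums (\<integral>x. \<psi> x \<partial>mixture ?c ?Q)"
    using integrable_mix[OF assms(1-4), of s] s
    by (intro integral_mixture) (auto simp: assms mix_eq_mixture)
  moreover have "(\<lambda>n. ?c n * (\<integral>x. \<psi> x \<partial>?Q n)) sums (\<Sum>n\<in>{0, 1}. ?c n * (\<integral>x. \<psi> x \<partial>?Q n))"
    by (rule sums_finite) auto
  ultimately show ?thesis
    by (auto simp: mix_eq_mixture dest: sums_unique2)
qed

section \<open>Weighted total variation\<close>

definition dominated :: "('a::euclidean_space \<Rightarrow> real) \<Rightarrow> ('a \<Rightarrow> real) set" where
  "dominated \<omega> = {\<psi> \<in> borel_measurable borel. \<forall>v. \<bar>\<psi> v\<bar> \<le> \<omega> v}"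

text \<open>A bound \<open>d\<close> for the total variation norm, weighted by \<open>\<omega>\<close>, of the signed measure \<open>\<mu> - \<nu>\<close>, in
its dual form. For the weight 1 the distance of two probability measures is at most 2.\<close>

definition tv_le ::
    "('a::euclidean_space \<Rightarrow> real) \<Rightarrow> 'a measure \<Rightarrow> 'a measure \<Rightarrow> real \<Rightarrow> bool" where
  "tv_le \<omega> \<mu> \<nu> d \<longleftrightarrow> (\<forall>\<psi>\<in>dominated \<omega>. \<bar>(\<integral>v. \<psi> v \<partial>\<mu>) - (\<integral>v. \<psi> v \<partial>\<nu>)\<bar> \<le> d)"

definition Prob_weighted :: "('a::euclidean_space \<Rightarrow> real) \<Rightarrow> 'a measure set" where
  "Prob_weighted \<omega> = {\<mu> \<in> Prob. integrable \<mu> \<omega>}"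

lemma ProbD:
  assumes "\<mu> \<in> Prob"
  shows "prob_space \<mu>" "sets \<mu> = sets borel" "space \<mu> = UNIV" "emeasure \<mu> UNIV = 1"
proof -
  show *: "prob_space \<mu>" "sets \<mu> = sets borel" using assms by (auto simp: Prob_def)
  show sp: "space \<mu> = UNIV" using sets_eq_imp_space_eq[OF *(2)] by simp
  show "emeasure \<mu> UNIV = 1" using prob_space.emeasure_space_1[OF *(1)] by (simp add: sp)
qed

lemma ProbI: "emeasure \<mu> UNIV = 1 \<Longrightarrow> sets \<mu> = sets borel \<Longrightarrow> \<mu> \<in> Prob"
  using sets_eq_imp_space_eq[of \<mu> borel] by (auto simp: Prob_def intro!: prob_spaceI)

lemma Prob_weightedD:
  assumes "\<mu> \<in> Prob_weighted \<omega>"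
  shows "\<mu> \<in> Prob" "integrable \<mu> \<omega>"
  using assms by (auto simp: Prob_weighted_def)

lemma measurable_Prob: "\<mu> \<in> Prob \<Longrightarrow> borel_measurable \<mu> = borel_measurable borel"
  by (rule measurable_cong_sets) (auto dest: ProbD)

lemma dominated_integrable:
  assumes "\<psi> \<in> dominated \<omega>" "\<mu> \<in> Prob_weighted \<omega>"
  shows "integrable \<mu> \<psi>"
  using assms
  by (auto simp: dominated_def measurable_Prob Prob_weighted_def
      intro!: Bochner_Integration.integrable_bound[of \<mu> \<omega> \<psi>] AE_I2
      order_trans[OF _ abs_ge_self])

lemma dominated_integral_le:
  assumes "\<psi> \<in> dominated \<omega>" "\<mu> \<in> Prob_weighted \<omega>"
  shows "\<bar>\<integral>v. \<psi> v \<partial>\<mu>\<bar> \<le> (\<integral>v. \<omega> v \<partial>\<mu>)"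
proof -
  have "\<bar>\<integral>v. \<psi> v \<partial>\<mu>\<bar> \<le> (\<integral>v. \<bar>\<psi> v\<bar> \<partial>\<mu>)"
    using integral_norm_bound[of \<mu> \<psi>] by simp
  also have "\<dots> \<le> (\<integral>v. \<omega> v \<partial>\<mu>)"
    using assms dominated_integrable[OF assms]
    by (intro integral_mono) (auto simp: dominated_def Prob_weighted_def)
  finally show ?thesis .
qed

lemma tv_leD: "tv_le \<omega> \<mu> \<nu> d \<Longrightarrow> \<psi> \<in> dominated \<omega> \<Longrightarrow> \<bar>(\<integral>v. \<psi> v \<partial>\<mu>) - (\<integral>v. \<psi> v \<partial>\<nu>)\<bar> \<le> d"
  by (auto simp: tv_le_def)

lemma tv_le_scaled:
  assumes "tv_le \<omega> \<mu> \<nu> d" "k \<ge> 0" "\<psi> \<in> dominated (\<lambda>v. k * \<omega> v)"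
  shows "\<bar>(\<integral>v. \<psi> v \<partial>\<mu>) - (\<integral>v. \<psi> v \<partial>\<nu>)\<bar> \<le> k * d"
proof (cases "k = 0")
  case True
  then have "\<psi> = (\<lambda>_. 0)" using assms(3) by (auto simp: dominated_def)
  then show ?thesis using True by simp
next
  case False
  then have k: "k > 0" using assms(2) by simp
  have "(\<lambda>v. \<psi> v / k) \<in> dominated \<omega>"
    using assms(3) k by (auto simp: dominated_def field_simps abs_mult)
  from tv_leD[OF assms(1) this] show ?thesis
    using k by (simp add: diff_divide_distrib[symmetric] abs_divide field_simps)
qed

section \<open>The bilinear gain term\<close>

text \<open>The polarised gain term: the two colliding particles have different laws \<open>\<mu>\<close> and \<open>\<nu>\<close>.\<close>

definition bigain ::
    "('a::euclidean_space \<Rightarrow> 'a \<Rightarrow> 'p \<Rightarrow> 'a) \<Rightarrow> 'p measure \<Rightarrow> 'a measure \<Rightarrow> 'a measure \<Rightarrow> 'a measure" where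
  "bigain c B \<mu> \<nu> = distr (\<mu> \<Otimes>\<^sub>M (\<nu> \<Otimes>\<^sub>M B)) borel (\<lambda>(v, w, \<theta>). c v w \<theta>)"

lemma sets_bigain [simp, measurable_cong]: "sets (bigain c B \<mu> \<nu>) = sets borel"
  by (simp add: bigain_def)

locale collision_kernel = B: prob_space B
  for B :: "'p measure" +
  fixes c :: "'a::euclidean_space \<Rightarrow> 'a \<Rightarrow> 'p \<Rightarrow> 'a"
  assumes meas: "(\<lambda>(v, w, \<theta>). c v w \<theta>) \<in> borel_measurable (borel \<Otimes>\<^sub>M (borel \<Otimes>\<^sub>M B))"
begin

lemma measurable_c [measurable (raw)]:
  assumes "f \<in> borel_measurable M" "g \<in> borel_measurable M" "h \<in> measurable M B"
  shows "(\<lambda>x. c (f x) (g x) (h x)) \<in> borel_measurable M"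
proof -
  have "(\<lambda>x. (f x, g x, h x)) \<in> measurable M (borel \<Otimes>\<^sub>M (borel \<Otimes>\<^sub>M B))"
    using assms by (intro measurable_Pair)
  from measurable_compose[OF this meas] show ?thesis by simp
qed

lemma c_measurable_triple:
  assumes "\<mu> \<in> Prob" "\<nu> \<in> Prob"
  shows "(\<lambda>(v, w, \<theta>). c v w \<theta>) \<in> borel_measurable (\<mu> \<Otimes>\<^sub>M (\<nu> \<Otimes>\<^sub>M B))"
  using meas ProbD(2)[OF assms(1)] ProbD(2)[OF assms(2)]
  by (simp cong: measurable_cong_sets sets_pair_measure_cong)

lemma nn_integral_triple:
  assumes \<mu>: "\<mu> \<in> Prob" and \<nu>: "\<nu> \<in> Prob"
    and f: "(\<lambda>(v, w, \<theta>). f v w \<theta>) \<in> borel_measurable (borel \<Otimes>\<^sub>M (borel \<Otimes>\<^sub>M B))"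
  shows "(\<integral>\<^sup>+(v, w, \<theta>). f v w \<theta> \<partial>(\<mu> \<Otimes>\<^sub>M (\<nu> \<Otimes>\<^sub>M B)))
       = (\<integral>\<^sup>+v. \<integral>\<^sup>+w. \<integral>\<^sup>+\<theta>. f v w \<theta> \<partial>B \<partial>\<nu> \<partial>\<mu>)"
proof -
  interpret M: prob_space \<mu> by (rule ProbD[OF \<mu>])
  interpret N: prob_space \<nu> by (rule ProbD[OF \<nu>])
  interpret NB: pair_prob_space \<nu> B ..
  note [measurable_cong] = ProbD(2)[OF \<mu>] ProbD(2)[OF \<nu>]
  note [measurable] = f
  have [measurable]: "(\<lambda>(w, \<theta>). f v w \<theta>) \<in> borel_measurable (borel \<Otimes>\<^sub>M B)" for v
    using measurable_Pair2[OF f, of v] by simp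
  have "(\<integral>\<^sup>+(v, w, \<theta>). f v w \<theta> \<partial>(\<mu> \<Otimes>\<^sub>M (\<nu> \<Otimes>\<^sub>M B)))
      = (\<integral>\<^sup>+v. \<integral>\<^sup>+x. (case x of (w, \<theta>) \<Rightarrow> f v w \<theta>) \<partial>(\<nu> \<Otimes>\<^sub>M B) \<partial>\<mu>)"
    by (subst NB.nn_integral_fst[symmetric]) simp_all
  also have "\<dots> = (\<integral>\<^sup>+v. \<integral>\<^sup>+w. \<integral>\<^sup>+\<theta>. f v w \<theta> \<partial>B \<partial>\<nu> \<partial>\<mu>)"
    by (subst B.nn_integral_fst[symmetric]) simp_all
  finally show ?thesis .
qed

lemma nn_integral_bigain:
  assumes "\<mu> \<in> Prob" "\<nu> \<in> Prob" and [measurable]: "f \<in> borel_measurable borel"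
  shows "(\<integral>\<^sup>+x. f x \<partial>bigain c B \<mu> \<nu>) = (\<integral>\<^sup>+v. \<integral>\<^sup>+w. \<integral>\<^sup>+\<theta>. f (c v w \<theta>) \<partial>B \<partial>\<nu> \<partial>\<mu>)"
proof -
  have "(\<integral>\<^sup>+x. f x \<partial>bigain c B \<mu> \<nu>) = (\<integral>\<^sup>+(v, w, \<theta>). f (c v w \<theta>) \<partial>(\<mu> \<Otimes>\<^sub>M (\<nu> \<Otimes>\<^sub>M B)))"
    unfolding bigain_def using c_measurable_triple[OF assms(1,2)]
    by (subst nn_integral_distr) (auto simp: case_prod_unfold)
  also have "\<dots> = (\<integral>\<^sup>+v. \<integral>\<^sup>+w. \<integral>\<^sup>+\<theta>. f (c v w \<theta>) \<partial>B \<partial>\<nu> \<partial>\<mu>)"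
    by (rule nn_integral_triple[OF assms(1,2)]) measurable
  finally show ?thesis .
qed

lemma bigain_Prob:
  assumes "\<mu> \<in> Prob" "\<nu> \<in> Prob"
  shows "bigain c B \<mu> \<nu> \<in> Prob"
proof (rule ProbI)
  show "emeasure (bigain c B \<mu> \<nu>) UNIV = 1"
    using nn_integral_bigain[OF assms, of "\<lambda>_. 1"] ProbD[OF assms(1)] ProbD[OF assms(2)]
      B.emeasure_space_1 sets_eq_imp_space_eq[OF sets_bigain[of c B \<mu> \<nu>]]
    by simp
qed simp

end

text \<open>The inequality for \<open>\<omega>\<close> says that the gain term is a bounded bilinear operation, with norm \<open>\<kappa>\<close>, for
the total variation weighted by \<open>\<omega>\<close>. It holds for \<open>\<omega> = 1\<close> with \<open>\<kappa> = 1\<close>, which serves uniqueness,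
and for \<open>\<omega> = 1 + |v|\<close>, which serves existence and the error bound.\<close>

locale weighted_kernel = collision_kernel B c
  for B :: "'p measure" and c :: "'a::euclidean_space \<Rightarrow> 'a \<Rightarrow> 'p \<Rightarrow> 'a" +
  fixes \<omega> :: "'a \<Rightarrow> real" and \<kappa> :: real
  assumes \<omega>_meas [measurable]: "\<omega> \<in> borel_measurable borel"
    and \<omega>_nonneg: "0 \<le> \<omega> v" and \<kappa>_nonneg: "0 \<le> \<kappa>"
    and \<omega>_collision: "\<theta> \<in> space B \<Longrightarrow> \<omega> (c v w \<theta>) \<le> \<kappa> * \<omega> v * \<omega> w"
begin

text \<open>The adjoint of the gain term: the expected value of \<open>\<psi>\<close> after a collision of two given
particles.\<close>

definition collide :: "('a \<Rightarrow> real) \<Rightarrow> 'a \<Rightarrow> 'a \<Rightarrow> real" where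
  "collide \<psi> v w = (\<integral>\<theta>. \<psi> (c v w \<theta>) \<partial>B)"

lemma collide_bound_ptw:
  assumes "\<psi> \<in> dominated \<omega>" "\<theta> \<in> space B"
  shows "\<bar>\<psi> (c v w \<theta>)\<bar> \<le> \<kappa> * \<omega> v * \<omega> w"
  using assms \<omega>_collision[of \<theta> v w] order_trans by (fastforce simp: dominated_def)

lemma dominated_meas: "\<psi> \<in> dominated \<omega> \<Longrightarrow> \<psi> \<in> borel_measurable borel"
  by (simp add: dominated_def)

lemma collide_bound:
  assumes "\<psi> \<in> dominated \<omega>"
  shows "\<bar>collide \<psi> v w\<bar> \<le> \<kappa> * \<omega> v * \<omega> w"
proof -
  note [measurable] = dominated_meas[OF assms]
  have "integrable B (\<lambda>\<theta>. \<psi> (c v w \<theta>))"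
    using collide_bound_ptw[OF assms]
    by (intro B.integrable_const_bound[of _ "\<kappa> * \<omega> v * \<omega> w"]) auto
  then have "\<bar>collide \<psi> v w\<bar> \<le> (\<integral>\<theta>. \<bar>\<psi> (c v w \<theta>)\<bar> \<partial>B)"
    unfolding collide_def using integral_norm_bound[of B "\<lambda>\<theta>. \<psi> (c v w \<theta>)"] by simp
  also have "\<dots> \<le> (\<integral>\<theta>. \<kappa> * \<omega> v * \<omega> w \<partial>B)"
    using collide_bound_ptw[OF assms] \<open>integrable B _\<close> by (intro integral_mono) auto
  finally show ?thesis by (simp add: B.prob_space)
qed

lemma collide_measurable:
  assumes "\<psi> \<in> dominated \<omega>"
  shows "(\<lambda>(v, w). collide \<psi> v w) \<in> borel_measurable (borel \<Otimes>\<^sub>M borel)"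
proof -
  note [measurable] = dominated_meas[OF assms]
  show ?thesis unfolding collide_def by measurable
qed

lemma collide_dominated:
  assumes "\<psi> \<in> dominated \<omega>"
  shows "collide \<psi> v \<in> dominated (\<lambda>w. (\<kappa> * \<omega> v) * \<omega> w)"
  using collide_bound[OF assms] measurable_Pair2[OF collide_measurable[OF assms], of v]
  by (auto simp: dominated_def)

lemma integrable_triple:
  assumes \<mu>: "\<mu> \<in> Prob_weighted \<omega>" and \<nu>: "\<nu> \<in> Prob_weighted \<omega>" and \<psi>: "\<psi> \<in> dominated \<omega>"
  shows "integrable (\<mu> \<Otimes>\<^sub>M (\<nu> \<Otimes>\<^sub>M B)) (\<lambda>(v, w, \<theta>). \<psi> (c v w \<theta>))"
proof (rule integrableI_bounded)
  note [measurable] = dominated_meas[OF \<psi>]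
  note P = Prob_weightedD(1)[OF \<mu>] Prob_weightedD(1)[OF \<nu>]
  note [measurable_cong] = ProbD(2)[OF P(1)] ProbD(2)[OF P(2)]
  show "(\<lambda>(v, w, \<theta>). \<psi> (c v w \<theta>)) \<in> borel_measurable (\<mu> \<Otimes>\<^sub>M (\<nu> \<Otimes>\<^sub>M B))"
    by measurable
  have "(\<integral>\<^sup>+x. ennreal (norm (case x of (v, w, \<theta>) \<Rightarrow> \<psi> (c v w \<theta>))) \<partial>(\<mu> \<Otimes>\<^sub>M (\<nu> \<Otimes>\<^sub>M B)))
      = (\<integral>\<^sup>+(v, w, \<theta>). ennreal (norm (\<psi> (c v w \<theta>))) \<partial>(\<mu> \<Otimes>\<^sub>M (\<nu> \<Otimes>\<^sub>M B)))"
    by (simp add: case_prod_unfold)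
  also have "\<dots> = (\<integral>\<^sup>+v. \<integral>\<^sup>+w. \<integral>\<^sup>+\<theta>. ennreal (norm (\<psi> (c v w \<theta>))) \<partial>B \<partial>\<nu> \<partial>\<mu>)"
    by (rule nn_integral_triple[OF P]) measurable
  also have "\<dots> \<le> (\<integral>\<^sup>+v. \<integral>\<^sup>+w. \<integral>\<^sup>+\<theta>. ennreal (\<kappa> * \<omega> v * \<omega> w) \<partial>B \<partial>\<nu> \<partial>\<mu>)"
    using collide_bound_ptw[OF \<psi>] by (intro nn_integral_mono ennreal_leI) auto
  also have "\<dots> = (\<integral>\<^sup>+v. \<integral>\<^sup>+w. ennreal (\<kappa> * \<omega> v) * ennreal (\<omega> w) \<partial>\<nu> \<partial>\<mu>)"
    by (simp add: B.emeasure_space_1 ennreal_mult \<omega>_nonneg \<kappa>_nonneg)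
  also have "\<dots> = ennreal \<kappa> * (\<integral>\<^sup>+v. ennreal (\<omega> v) \<partial>\<mu>) * (\<integral>\<^sup>+w. ennreal (\<omega> w) \<partial>\<nu>)"
    by (simp add: nn_integral_cmult nn_integral_multc ennreal_mult \<omega>_nonneg \<kappa>_nonneg)
  also have "\<dots> < \<infinity>"
    using Prob_weightedD(2)[OF \<mu>] Prob_weightedD(2)[OF \<nu>] \<omega>_nonneg
    by (simp add: integrable_iff_bounded ennreal_mult_less_top)
  finally show "(\<integral>\<^sup>+x. ennreal (norm (case x of (v, w, \<theta>) \<Rightarrow> \<psi> (c v w \<theta>))) \<partial>(\<mu> \<Otimes>\<^sub>M (\<nu> \<Otimes>\<^sub>M B))) < \<infinity>" .
qed

lemma bigain_integrable:
  assumes \<mu>: "\<mu> \<in> Prob_weighted \<omega>" and \<nu>: "\<nu> \<in> Prob_weighted \<omega>" and \<psi>: "\<psi> \<in> dominated \<omega>"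
  shows "integrable (bigain c B \<mu> \<nu>) \<psi>"
  unfolding bigain_def
  using integrable_triple[OF assms] dominated_meas[OF \<psi>]
    c_measurable_triple[OF Prob_weightedD(1)[OF \<mu>] Prob_weightedD(1)[OF \<nu>]]
  by (subst integrable_distr_eq) (auto simp: case_prod_unfold)

lemma \<omega>_dominated: "\<omega> \<in> dominated \<omega>"
  by (simp add: dominated_def \<omega>_nonneg)

lemma bigain_weighted:
  assumes "\<mu> \<in> Prob_weighted \<omega>" "\<nu> \<in> Prob_weighted \<omega>"
  shows "bigain c B \<mu> \<nu> \<in> Prob_weighted \<omega>"
  using bigain_integrable[OF assms \<omega>_dominated] bigain_Prob assms
  by (auto simp: Prob_weighted_def)

lemma collide_integral_dominated:
  assumes \<nu>: "\<nu> \<in> Prob_weighted \<omega>" and \<psi>: "\<psi> \<in> dominated \<omega>"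
  shows "(\<lambda>v. \<integral>w. collide \<psi> v w \<partial>\<nu>) \<in> dominated (\<lambda>v. (\<kappa> * (\<integral>w. \<omega> w \<partial>\<nu>)) * \<omega> v)"
proof -
  note P = Prob_weightedD(1)[OF \<nu>]
  interpret N: prob_space \<nu> by (rule ProbD[OF P])
  note [measurable_cong] = ProbD(2)[OF P]
  note [measurable] = collide_measurable[OF \<psi>]
  have "\<bar>\<integral>w. collide \<psi> v w \<partial>\<nu>\<bar> \<le> (\<integral>w. (\<kappa> * \<omega> v) * \<omega> w \<partial>\<nu>)" for v
    using Prob_weightedD[OF \<nu>]
    by (intro dominated_integral_le collide_dominated \<psi>) (simp add: Prob_weighted_def)
  then have "\<bar>\<integral>w. collide \<psi> v w \<partial>\<nu>\<bar> \<le> (\<kappa> * (\<integral>w. \<omega> w \<partial>\<nu>)) * \<omega> v" for v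
    by (simp add: mult_ac)
  moreover have "(\<lambda>v. \<integral>w. collide \<psi> v w \<partial>\<nu>) \<in> borel_measurable borel"
    by measurable
  ultimately show ?thesis by (simp add: dominated_def)
qed

lemma integral_bigain:
  assumes \<mu>: "\<mu> \<in> Prob_weighted \<omega>" and \<nu>: "\<nu> \<in> Prob_weighted \<omega>" and \<psi>: "\<psi> \<in> dominated \<omega>"
  shows "(\<integral>x. \<psi> x \<partial>bigain c B \<mu> \<nu>) = (\<integral>v. \<integral>w. collide \<psi> v w \<partial>\<nu> \<partial>\<mu>)"
proof -
  note P = Prob_weightedD(1)[OF \<mu>] Prob_weightedD(1)[OF \<nu>]
  interpret M: prob_space \<mu> by (rule ProbD[OF P(1)])
  interpret N: prob_space \<nu> by (rule ProbD[OF P(2)])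
  interpret NB: pair_prob_space \<nu> B ..
  interpret MNB: pair_prob_space \<mu> "\<nu> \<Otimes>\<^sub>M B" ..
  note [measurable] = dominated_meas[OF \<psi>]
  note [measurable_cong] = ProbD(2)[OF P(1)] ProbD(2)[OF P(2)]
  have bnd: "integrable (\<nu> \<Otimes>\<^sub>M B) (\<lambda>(w, \<theta>). \<psi> (c v w \<theta>))" for v
  proof (rule Bochner_Integration.integrable_bound)
    show "integrable (\<nu> \<Otimes>\<^sub>M B) (\<lambda>x. \<kappa> * \<omega> v * \<omega> (fst x))"
      using Prob_weightedD[OF \<nu>] integrable_distr_eq[of fst "\<nu> \<Otimes>\<^sub>M B" \<nu> \<omega>]
      by (auto simp: B.distr_pair_fst)
    show "AE x in \<nu> \<Otimes>\<^sub>M B. norm (case x of (w, \<theta>) \<Rightarrow> \<psi> (c v w \<theta>)) \<le> norm (\<kappa> * \<omega> v * \<omega> (fst x))"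
      using collide_bound_ptw[OF \<psi>] \<omega>_nonneg \<kappa>_nonneg
      by (intro AE_I2) (auto simp: space_pair_measure)
  qed measurable
  have "(\<integral>x. \<psi> x \<partial>bigain c B \<mu> \<nu>) = (\<integral>(v, w, \<theta>). \<psi> (c v w \<theta>) \<partial>(\<mu> \<Otimes>\<^sub>M (\<nu> \<Otimes>\<^sub>M B)))"
    unfolding bigain_def using c_measurable_triple[OF P]
    by (subst integral_distr) (auto simp: case_prod_unfold)
  also have "\<dots> = (\<integral>v. \<integral>x. (case x of (w, \<theta>) \<Rightarrow> \<psi> (c v w \<theta>)) \<partial>(\<nu> \<Otimes>\<^sub>M B) \<partial>\<mu>)"
    using integrable_triple[OF assms] by (subst MNB.integral_fst'[symmetric]) simp_all
  also have "\<dots> = (\<integral>v. \<integral>w. collide \<psi> v w \<partial>\<nu> \<partial>\<mu>)"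
    unfolding collide_def using bnd
    by (subst NB.integral_fst'[symmetric]) (simp_all)
  finally show ?thesis .
qed

text \<open>By bilinearity the measures are exchanged one at a time. In each step \<open>d\<close> is applied to
\<open>collide \<psi>\<close> with one argument frozen or integrated out, which is dominated by a multiple of \<open>\<omega>\<close>.\<close>

lemma bigain_stability:
  assumes \<mu>: "\<mu> \<in> Prob_weighted \<omega>" and \<nu>: "\<nu> \<in> Prob_weighted \<omega>"
    and A: "(\<integral>v. \<omega> v \<partial>\<mu>) \<le> A" "(\<integral>v. \<omega> v \<partial>\<nu>) \<le> A" and d: "tv_le \<omega> \<mu> \<nu> d"
  shows "tv_le \<omega> (bigain c B \<mu> \<mu>) (bigain c B \<nu> \<nu>) (2 * \<kappa> * A * d)"
  unfolding tv_le_def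
proof
  fix \<psi> assume \<psi>: "\<psi> \<in> dominated \<omega>"
  have "(\<lambda>_. 0) \<in> dominated \<omega>" by (simp add: dominated_def \<omega>_nonneg)
  from tv_leD[OF d this] have d0: "0 \<le> d" by simp
  have A0: "0 \<le> A" "0 \<le> (\<integral>v. \<omega> v \<partial>\<nu>)" using A(1) \<omega>_nonneg
    by (auto intro: order_trans[OF Bochner_Integration.integral_nonneg])
  let ?h = "\<lambda>\<rho> v. \<integral>w. collide \<psi> v w \<partial>\<rho>"
  have scal: "integrable \<mu> (?h \<rho>)" if "\<rho> \<in> Prob_weighted \<omega>" for \<rho>
    using Prob_weightedD[OF \<mu>]
    by (intro dominated_integrable[OF collide_integral_dominated[OF that \<psi>]])
       (auto simp: Prob_weighted_def)
  have "\<bar>(\<integral>v. ?h \<mu> v \<partial>\<mu>) - (\<integral>v. ?h \<nu> v \<partial>\<mu>)\<bar> = \<bar>\<integral>v. ?h \<mu> v - ?h \<nu> v \<partial>\<mu>\<bar>"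
    using scal[OF \<mu>] scal[OF \<nu>] by simp
  also have "\<dots> \<le> (\<integral>v. (\<kappa> * d) * \<omega> v \<partial>\<mu>)"
  proof (rule dominated_integral_le)
    have "\<bar>?h \<mu> v - ?h \<nu> v\<bar> \<le> \<kappa> * \<omega> v * d" for v
      using \<omega>_nonneg \<kappa>_nonneg by (intro tv_le_scaled[OF d]) (auto simp: collide_dominated \<psi>)
    moreover have "(\<lambda>v. ?h \<mu> v - ?h \<nu> v) \<in> borel_measurable borel"
      using collide_integral_dominated[OF \<mu> \<psi>] collide_integral_dominated[OF \<nu> \<psi>]
      by (auto simp: dominated_def)
    ultimately show "(\<lambda>v. ?h \<mu> v - ?h \<nu> v) \<in> dominated (\<lambda>v. (\<kappa> * d) * \<omega> v)"
      by (simp add: dominated_def mult_ac)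
    show "\<mu> \<in> Prob_weighted (\<lambda>v. \<kappa> * d * \<omega> v)"
      using Prob_weightedD[OF \<mu>] by (auto simp: Prob_weighted_def)
  qed
  also have "\<dots> \<le> \<kappa> * d * A"
    using A(1) \<kappa>_nonneg d0 by (auto intro: mult_left_mono)
  finally have 1: "\<bar>(\<integral>v. ?h \<mu> v \<partial>\<mu>) - (\<integral>v. ?h \<nu> v \<partial>\<mu>)\<bar> \<le> \<kappa> * d * A" .
  have "\<bar>(\<integral>v. ?h \<nu> v \<partial>\<mu>) - (\<integral>v. ?h \<nu> v \<partial>\<nu>)\<bar> \<le> (\<kappa> * (\<integral>w. \<omega> w \<partial>\<nu>)) * d"
    using \<kappa>_nonneg A0 by (intro tv_le_scaled[OF d] collide_integral_dominated \<nu> \<psi>) auto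
  also have "\<dots> \<le> \<kappa> * A * d"
    using A(2) \<kappa>_nonneg d0 by (intro mult_right_mono mult_left_mono) auto
  finally have 2: "\<bar>(\<integral>v. ?h \<nu> v \<partial>\<mu>) - (\<integral>v. ?h \<nu> v \<partial>\<nu>)\<bar> \<le> \<kappa> * A * d" .
  show "\<bar>(\<integral>x. \<psi> x \<partial>bigain c B \<mu> \<mu>) - (\<integral>x. \<psi> x \<partial>bigain c B \<nu> \<nu>)\<bar> \<le> 2 * \<kappa> * A * d"
    using 1 2 by (simp add: integral_bigain \<mu> \<nu> \<psi> mult_ac)
qed

end

section \<open>Weighted total variation controls the transport distance\<close>

text \<open>The reference measure \<open>(\<mu> + \<nu>) / 2\<close> turns statements about \<open>\<mu> - \<nu>\<close> into statements about the
real function \<open>m - n\<close>; this plays the part of the Hahn decomposition.\<close>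

lemma common_density:
  assumes \<mu>: "\<mu> \<in> Prob" and \<nu>: "\<nu> \<in> Prob"
  obtains \<rho> m n where "\<rho> \<in> Prob"
    "m \<in> borel_measurable borel" "n \<in> borel_measurable borel" "\<And>x. 0 \<le> m x" "\<And>x. 0 \<le> n x"
    "\<mu> = density \<rho> (\<lambda>x. ennreal (m x))" "\<nu> = density \<rho> (\<lambda>x. ennreal (n x))"
proof -
  let ?\<rho> = "mix (1/2) \<mu> \<nu>"
  note sets = ProbD(2)[OF \<mu>] ProbD(2)[OF \<nu>]
  have "ennreal (1 - 1/2) + ennreal (1/2) = ennreal ((1 - 1/2) + 1/2)"
    by (rule ennreal_plus[symmetric]) auto
  then have \<rho>: "?\<rho> \<in> Prob"
    using ProbD(4)[OF \<mu>] ProbD(4)[OF \<nu>] by (intro ProbI) (simp_all add: emeasure_mix sets)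
  interpret R: prob_space ?\<rho> by (rule ProbD[OF \<rho>])
  have dens: "\<exists>m. m \<in> borel_measurable borel \<and> (\<forall>x. 0 \<le> m x) \<and> \<sigma> = density ?\<rho> (\<lambda>x. ennreal (m x))"
    if \<sigma>: "\<sigma> \<in> Prob" "\<sigma> = \<mu> \<or> \<sigma> = \<nu>" for \<sigma>
  proof -
    interpret S: prob_space \<sigma> by (rule ProbD[OF \<sigma>(1)])
    have ac: "absolutely_continuous ?\<rho> \<sigma>"
      using \<sigma>(2) by (auto simp: absolutely_continuous_def null_sets_def emeasure_mix sets)
    obtain D where D: "D \<in> borel_measurable ?\<rho>" "AE x in ?\<rho>. RN_deriv ?\<rho> \<sigma> x = ennreal (D x)"
        "\<And>x. 0 \<le> D x"
      using R.real_RN_deriv[OF S.finite_measure_axioms ac] ProbD(2)[OF \<sigma>(1)] by (metis sets_mix)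
    have "\<sigma> = density ?\<rho> (RN_deriv ?\<rho> \<sigma>)"
      using R.density_RN_deriv[OF ac] ProbD(2)[OF \<sigma>(1)] by simp
    also have "\<dots> = density ?\<rho> (\<lambda>x. ennreal (D x))"
      using D by (intro density_cong) auto
    finally show ?thesis
      using D by (auto simp: measurable_Prob[OF \<rho>])
  qed
  show thesis
    using dens[OF \<mu>] dens[OF \<nu>] that[OF \<rho>] by blast
qed

text \<open>The coupling leaves the common part \<open>min(m, n)\<close> of the two densities where it is and transports the
excess \<open>\<alpha> = m - min(m, n)\<close> to the deficit \<open>\<beta> = n - min(m, n)\<close> by the normalised product measure.
As \<open>dist x y \<le> |x| + |y|\<close>, its cost is at most \<open>\<integral>|x| |m - n| d\<rho>\<close>, which is the
difference of the integrals of \<open>\<psi>(x) = |x| sgn(m(x) - n(x))\<close>.\<close>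

lemma W1_le_tv:
  fixes \<mu> \<nu> :: "'a::euclidean_space measure"
  assumes \<mu>: "\<mu> \<in> Prob_weighted (\<lambda>v. 1 + norm v)" and \<nu>: "\<nu> \<in> Prob_weighted (\<lambda>v. 1 + norm v)"
    and d: "tv_le (\<lambda>v. 1 + norm v) \<mu> \<nu> d"
  shows "W1 \<mu> \<nu> \<le> ennreal d"
proof -
  obtain \<rho> m n where \<rho>: "\<rho> \<in> Prob"
    and mn [measurable]: "m \<in> borel_measurable borel" "n \<in> borel_measurable borel"
    and nonneg: "\<And>x. 0 \<le> m x" "\<And>x. 0 \<le> n x"
    and dens: "\<mu> = density \<rho> (\<lambda>x. ennreal (m x))" "\<nu> = density \<rho> (\<lambda>x. ennreal (n x))"
    using common_density[OF Prob_weightedD(1)[OF \<mu>] Prob_weightedD(1)[OF \<nu>]] by blast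
  interpret R: prob_space \<rho> by (rule ProbD[OF \<rho>])
  interpret RR: pair_prob_space \<rho> \<rho> ..
  note sets\<rho> [measurable_cong] = ProbD(2)[OF \<rho>]
  have [measurable]: "m \<in> borel_measurable \<rho>" "n \<in> borel_measurable \<rho>"
    by (simp_all add: measurable_Prob \<rho>)
  have mass: "(\<integral>\<^sup>+x. ennreal (m x) \<partial>\<rho>) = 1" "(\<integral>\<^sup>+x. ennreal (n x) \<partial>\<rho>) = 1"
    using ProbD(4)[OF Prob_weightedD(1)[OF \<mu>]] ProbD(4)[OF Prob_weightedD(1)[OF \<nu>]] ProbD(2,3)[OF \<rho>]
    by (simp_all add: dens emeasure_density)
  define p where "p x = min (m x) (n x)" for x
  define \<alpha> where "\<alpha> x = m x - p x" for x
  define \<beta> where "\<beta> x = n x - p x" for x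
  have [measurable]: "p \<in> borel_measurable borel" "\<alpha> \<in> borel_measurable borel" "\<beta> \<in> borel_measurable borel"
    unfolding p_def \<alpha>_def \<beta>_def by measurable
  have pos: "0 \<le> p x" "0 \<le> \<alpha> x" "0 \<le> \<beta> x" for x
    using nonneg by (auto simp: p_def \<alpha>_def \<beta>_def)
  have split: "ennreal (p x) + ennreal (\<alpha> x) = ennreal (m x)"
      "ennreal (p x) + ennreal (\<beta> x) = ennreal (n x)" for x
    using pos by (simp_all add: \<alpha>_def \<beta>_def ennreal_plus[symmetric] del: ennreal_plus)
  have sum1: "(\<integral>\<^sup>+x. ennreal (p x) \<partial>\<rho>) + (\<integral>\<^sup>+x. ennreal (\<alpha> x) \<partial>\<rho>) = 1"
    by (subst nn_integral_add[symmetric]) (simp_all add: split mass)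
  have sum2: "(\<integral>\<^sup>+x. ennreal (p x) \<partial>\<rho>) + (\<integral>\<^sup>+x. ennreal (\<beta> x) \<partial>\<rho>) = 1"
    by (subst nn_integral_add[symmetric]) (simp_all add: split mass)
  let ?p = "\<integral>\<^sup>+x. ennreal (p x) \<partial>\<rho>" and ?a = "\<integral>\<^sup>+x. ennreal (\<alpha> x) \<partial>\<rho>"
    and ?b = "\<integral>\<^sup>+x. ennreal (\<beta> x) \<partial>\<rho>"
  have "?p \<le> 1" "?a \<le> 1"
    unfolding sum1[symmetric] by (rule le_iff_add[THEN iffD2], blast, rule le_iff_add[THEN iffD2], rule exI, rule add.commute)
  then have fin: "?p \<noteq> \<top>" "?a \<noteq> \<top>"
    by (auto simp: top_unique)
  have \<alpha>\<beta>: "?b = ?a"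
    using trans[OF sum2 sum1[symmetric]] fin(1) unfolding ennreal_add_left_cancel by simp
  define \<delta> where "\<delta> = enn2real (\<integral>\<^sup>+x. ennreal (\<alpha> x) \<partial>\<rho>)"
  have \<delta>: "\<delta> \<ge> 0" "(\<integral>\<^sup>+x. ennreal (\<alpha> x) \<partial>\<rho>) = ennreal \<delta>" "(\<integral>\<^sup>+x. ennreal (\<beta> x) \<partial>\<rho>) = ennreal \<delta>"
    using fin(2) by (simp_all add: \<delta>_def \<alpha>\<beta> less_top)
  \<comment> \<open>If the defect \<delta> vanishes, then so do \<alpha> and \<beta> almost everywhere; hence the factor
     \<delta>/\<delta>, which is 0 in that case, may be cancelled throughout.\<close>
  define r where "r = ennreal (\<delta> * inverse \<delta>)"
  have cancel: "(\<integral>\<^sup>+x. g x * ennreal (k x) \<partial>\<rho>) * r = (\<integral>\<^sup>+x. g x * ennreal (k x) \<partial>\<rho>)"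
    if [measurable]: "k \<in> borel_measurable borel"
      and k: "(\<integral>\<^sup>+x. ennreal (k x) \<partial>\<rho>) = ennreal \<delta>" for k g
  proof (cases "\<delta> = 0")
    case True
    then have "AE x in \<rho>. ennreal (k x) = 0"
      using k by (subst nn_integral_0_iff_AE[symmetric]) auto
    then have "(\<integral>\<^sup>+x. g x * ennreal (k x) \<partial>\<rho>) = (\<integral>\<^sup>+x. 0 \<partial>\<rho>)"
      by (intro nn_integral_cong_AE) auto
    then show ?thesis by simp
  qed (simp add: r_def)
  \<comment> \<open>The densities are doubled because the coupling is assembled as a mixture with weights one half.\<close>
  define D where "D = distr (density \<rho> (\<lambda>x. ennreal (2 * p x))) borel (\<lambda>x. (x, x))"
  define E where "E = density (\<rho> \<Otimes>\<^sub>M \<rho>) (\<lambda>(x, y). ennreal (2 * (\<alpha> x * (\<beta> y / \<delta>))))"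
  define \<pi> where "\<pi> = mix (1/2) D E"
  have setsD: "sets D = sets borel" by (simp add: D_def)
  have setsE: "sets E = sets borel"
    unfolding E_def sets_density sets_pair_measure_cong[OF sets\<rho> sets\<rho>] borel_prod ..
  have nn\<pi>: "(\<integral>\<^sup>+z. f z \<partial>\<pi>) = (\<integral>\<^sup>+x. ennreal (p x) * f (x, x) \<partial>\<rho>) +
      (\<integral>\<^sup>+x. \<integral>\<^sup>+y. ennreal (\<alpha> x * (\<beta> y / \<delta>)) * f (x, y) \<partial>\<rho> \<partial>\<rho>)"
    if f: "f \<in> borel_measurable borel" for f
  proof -
    have [measurable]: "f \<in> borel_measurable (borel \<Otimes>\<^sub>M borel)"
      using f by (simp add: borel_prod)
    have half: "ennreal (1/2) * ennreal (2 * u) = ennreal u" for u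
    proof (cases "u \<ge> 0")
      case True
      have "ennreal (1/2) * ennreal (2 * u) = ennreal (1/2 * (2 * u))"
        by (rule ennreal_mult[symmetric]) (use True in auto)
      also have "\<dots> = ennreal u" by simp
      finally show ?thesis .
    qed (simp add: ennreal_neg)
    have "ennreal (1/2) * (\<integral>\<^sup>+z. f z \<partial>D) = ennreal (1/2) * (\<integral>\<^sup>+x. ennreal (2 * p x) * f (x, x) \<partial>\<rho>)"
      unfolding D_def by (subst nn_integral_distr, use f in \<open>simp_all\<close>) (subst nn_integral_density, simp_all)
    also have "\<dots> = (\<integral>\<^sup>+x. (ennreal (1/2) * ennreal (2 * p x)) * f (x, x) \<partial>\<rho>)"
      by (subst nn_integral_cmult[symmetric]) (simp_all add: mult.assoc)
    finally have 1: "ennreal (1/2) * (\<integral>\<^sup>+z. f z \<partial>D) = (\<integral>\<^sup>+x. ennreal (p x) * f (x, x) \<partial>\<rho>)"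
      unfolding half .
    have "ennreal (1/2) * (\<integral>\<^sup>+z. f z \<partial>E)
        = ennreal (1/2) * (\<integral>\<^sup>+z. (case z of (x, y) \<Rightarrow> ennreal (2 * (\<alpha> x * (\<beta> y / \<delta>)))) * f z \<partial>(\<rho> \<Otimes>\<^sub>M \<rho>))"
      unfolding E_def by (subst nn_integral_density) simp_all
    also have "\<dots> = ennreal (1/2) * (\<integral>\<^sup>+x. \<integral>\<^sup>+y. ennreal (2 * (\<alpha> x * (\<beta> y / \<delta>))) * f (x, y) \<partial>\<rho> \<partial>\<rho>)"
      by (subst R.nn_integral_fst[symmetric]) simp_all
    also have "\<dots> = (\<integral>\<^sup>+x. \<integral>\<^sup>+y. (ennreal (1/2) * ennreal (2 * (\<alpha> x * (\<beta> y / \<delta>)))) * f (x, y) \<partial>\<rho> \<partial>\<rho>)"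
      by (simp add: nn_integral_cmult mult.assoc)
    finally have 2: "ennreal (1/2) * (\<integral>\<^sup>+z. f z \<partial>E)
        = (\<integral>\<^sup>+x. \<integral>\<^sup>+y. ennreal (\<alpha> x * (\<beta> y / \<delta>)) * f (x, y) \<partial>\<rho> \<partial>\<rho>)"
      unfolding half .
    show ?thesis
      unfolding \<pi>_def nn_integral_mix[OF setsD setsE f] 1[symmetric] 2[symmetric] by simp
  qed
  have weight: "ennreal (\<alpha> x * (\<beta> y / \<delta>)) * u = ennreal (\<alpha> x) * ennreal (inverse \<delta>) * (u * ennreal (\<beta> y))"
    for x y u
  proof -
    have "ennreal (\<alpha> x * (\<beta> y / \<delta>)) = ennreal (\<alpha> x) * (ennreal (\<beta> y) * ennreal (inverse \<delta>))"
      using pos \<delta>(1) by (simp only: ennreal_mult[symmetric] divide_inverse mult_nonneg_nonneg inverse_nonnegative_iff_nonnegative)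
    then show ?thesis by (simp only: mult_ac)
  qed
  have r: "r = ennreal \<delta> * ennreal (inverse \<delta>)"
    using \<delta>(1) by (simp only: r_def ennreal_mult inverse_nonnegative_iff_nonnegative)
  have in\<alpha>: "(\<integral>\<^sup>+y. ennreal (\<alpha> x * (\<beta> y / \<delta>)) * f x \<partial>\<rho>) = f x * ennreal (\<alpha> x) * r"
    for f :: "'a \<Rightarrow> ennreal" and x
  proof -
    have "(\<integral>\<^sup>+y. ennreal (\<alpha> x) * ennreal (inverse \<delta>) * (f x * ennreal (\<beta> y)) \<partial>\<rho>)
        = ennreal (\<alpha> x) * ennreal (inverse \<delta>) * (f x * ennreal \<delta>)"
      by (subst nn_integral_cmult, measurable, subst nn_integral_cmult, measurable, simp only: \<delta>(3))
    then show ?thesis unfolding weight r by (simp only: mult_ac)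
  qed
  have out\<beta>: "(\<integral>\<^sup>+x. \<integral>\<^sup>+y. ennreal (\<alpha> x * (\<beta> y / \<delta>)) * f y \<partial>\<rho> \<partial>\<rho>)
      = (\<integral>\<^sup>+y. f y * ennreal (\<beta> y) \<partial>\<rho>) * r"
    if [measurable]: "f \<in> borel_measurable borel" for f
  proof -
    have "(\<integral>\<^sup>+y. ennreal (\<alpha> x) * ennreal (inverse \<delta>) * (f y * ennreal (\<beta> y)) \<partial>\<rho>)
        = ennreal (\<alpha> x) * (ennreal (inverse \<delta>) * (\<integral>\<^sup>+y. f y * ennreal (\<beta> y) \<partial>\<rho>))" for x
      by (subst nn_integral_cmult) (measurable, simp only: mult.assoc)
    then have "(\<integral>\<^sup>+x. \<integral>\<^sup>+y. ennreal (\<alpha> x * (\<beta> y / \<delta>)) * f y \<partial>\<rho> \<partial>\<rho>)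
        = (\<integral>\<^sup>+x. ennreal (\<alpha> x) * (ennreal (inverse \<delta>) * (\<integral>\<^sup>+y. f y * ennreal (\<beta> y) \<partial>\<rho>)) \<partial>\<rho>)"
      unfolding weight by simp
    also have "\<dots> = ennreal \<delta> * (ennreal (inverse \<delta>) * (\<integral>\<^sup>+y. f y * ennreal (\<beta> y) \<partial>\<rho>))"
      by (subst nn_integral_multc) (measurable, simp only: \<delta>(2))
    finally show ?thesis unfolding r by (simp only: mult_ac)
  qed
  have marg1: "(\<integral>\<^sup>+z. f (fst z) \<partial>\<pi>) = (\<integral>\<^sup>+x. f x \<partial>\<mu>)"
    if [measurable]: "f \<in> borel_measurable borel" for f
  proof -
    have "(\<integral>\<^sup>+z. f (fst z) \<partial>\<pi>) = (\<integral>\<^sup>+x. ennreal (p x) * f x \<partial>\<rho>) +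
        (\<integral>\<^sup>+x. f x * ennreal (\<alpha> x) * r \<partial>\<rho>)"
      using nn\<pi>[of "\<lambda>z. f (fst z)"] unfolding fst_conv in\<alpha> by (simp flip: borel_prod)
    also have "\<dots> = (\<integral>\<^sup>+x. ennreal (p x) * f x \<partial>\<rho>) + (\<integral>\<^sup>+x. f x * ennreal (\<alpha> x) \<partial>\<rho>)"
      by (simp add: nn_integral_multc cancel \<delta>)
    also have "\<dots> = (\<integral>\<^sup>+x. f x * (ennreal (p x) + ennreal (\<alpha> x)) \<partial>\<rho>)"
      by (subst nn_integral_add[symmetric]) (simp_all add: distrib_left mult_ac)
    also have "\<dots> = (\<integral>\<^sup>+x. f x \<partial>\<mu>)"
      unfolding split dens by (subst nn_integral_density) (simp_all add: mult_ac)
    finally show ?thesis .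
  qed
  have marg2: "(\<integral>\<^sup>+z. f (snd z) \<partial>\<pi>) = (\<integral>\<^sup>+x. f x \<partial>\<nu>)"
    if [measurable]: "f \<in> borel_measurable borel" for f
  proof -
    have "(\<integral>\<^sup>+z. f (snd z) \<partial>\<pi>) = (\<integral>\<^sup>+x. ennreal (p x) * f x \<partial>\<rho>) + (\<integral>\<^sup>+x. f x * ennreal (\<beta> x) \<partial>\<rho>)"
      using nn\<pi>[of "\<lambda>z. f (snd z)"] unfolding snd_conv out\<beta>[OF that]
      by (simp add: cancel \<delta> flip: borel_prod)
    also have "\<dots> = (\<integral>\<^sup>+x. f x * (ennreal (p x) + ennreal (\<beta> x)) \<partial>\<rho>)"
      by (subst nn_integral_add[symmetric]) (simp_all add: distrib_left mult_ac)
    also have "\<dots> = (\<integral>\<^sup>+x. f x \<partial>\<nu>)"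
      unfolding split dens by (subst nn_integral_density) (simp_all add: mult_ac)
    finally show ?thesis .
  qed
  have sets\<pi>: "sets \<pi> = sets (borel \<Otimes>\<^sub>M borel)"
    unfolding \<pi>_def sets_mix borel_prod ..
  note [measurable_cong] = sets\<pi>
  have marginal: "distr \<pi> borel q = \<sigma>"
    if [measurable]: "q \<in> borel_measurable \<pi>" and \<sigma>: "sets \<sigma> = sets borel"
      and int: "\<And>f. f \<in> borel_measurable borel \<Longrightarrow> (\<integral>\<^sup>+z. f (q z) \<partial>\<pi>) = (\<integral>\<^sup>+x. f x \<partial>\<sigma>)" for q \<sigma>
  proof (rule measure_eqI)
    fix A assume "A \<in> sets (distr \<pi> borel q)"
    then have [measurable]: "A \<in> sets borel" by simp
    have "emeasure (distr \<pi> borel q) A = (\<integral>\<^sup>+z. indicator A z \<partial>distr \<pi> borel q)"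
      by simp
    also have "\<dots> = (\<integral>\<^sup>+z. indicator A (q z) \<partial>\<pi>)"
      by (subst nn_integral_distr) simp_all
    also have "\<dots> = emeasure \<sigma> A"
      using int[of "indicator A"] by (simp add: \<sigma>)
    finally show "emeasure (distr \<pi> borel q) A = emeasure \<sigma> A" .
  qed (simp add: \<sigma>)
  have "distr \<pi> borel fst = \<mu>" "distr \<pi> borel snd = \<nu>"
    by (rule marginal; simp add: dens sets\<rho> marg1[unfolded dens] marg2[unfolded dens])+
  then have "\<pi> \<in> couplings \<mu> \<nu>"
    using sets\<pi> by (simp add: couplings_def)
  then have "W1 \<mu> \<nu> \<le> (\<integral>\<^sup>+(x, y). ennreal (dist x y) \<partial>\<pi>)"
    unfolding W1_def by (rule INF_lower)
  also have "\<dots> = (\<integral>\<^sup>+x. \<integral>\<^sup>+y. ennreal (\<alpha> x * (\<beta> y / \<delta>)) * ennreal (dist x y) \<partial>\<rho> \<partial>\<rho>)"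
    using nn\<pi>[of "\<lambda>z. ennreal (dist (fst z) (snd z))"]
    by (simp add: case_prod_unfold flip: borel_prod)
  also have "\<dots> \<le> (\<integral>\<^sup>+x. \<integral>\<^sup>+y. ennreal (\<alpha> x * (\<beta> y / \<delta>)) * ennreal (norm x)
      + ennreal (\<alpha> x * (\<beta> y / \<delta>)) * ennreal (norm y) \<partial>\<rho> \<partial>\<rho>)"
    unfolding distrib_left[symmetric]
    by (intro nn_integral_mono mult_left_mono)
       (auto simp: dist_norm ennreal_plus[symmetric] norm_triangle_ineq4 simp del: ennreal_plus)
  also have "\<dots> = (\<integral>\<^sup>+x. \<integral>\<^sup>+y. ennreal (\<alpha> x * (\<beta> y / \<delta>)) * ennreal (norm x) \<partial>\<rho> \<partial>\<rho>)
      + (\<integral>\<^sup>+x. \<integral>\<^sup>+y. ennreal (\<alpha> x * (\<beta> y / \<delta>)) * ennreal (norm y) \<partial>\<rho> \<partial>\<rho>)"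
    by (simp add: nn_integral_add)
  also have "\<dots> = (\<integral>\<^sup>+x. ennreal (norm x) * ennreal (\<alpha> x) \<partial>\<rho>) + (\<integral>\<^sup>+x. ennreal (norm x) * ennreal (\<beta> x) \<partial>\<rho>)"
    unfolding in\<alpha>[of _ "\<lambda>x. ennreal (norm x)"]
    by (subst out\<beta>) (simp_all add: nn_integral_multc cancel \<delta>)
  also have "\<dots> = (\<integral>\<^sup>+x. ennreal (norm x * \<bar>m x - n x\<bar>) \<partial>\<rho>)"
  proof (subst nn_integral_add[symmetric])
    have "norm x * \<alpha> x + norm x * \<beta> x = norm x * \<bar>m x - n x\<bar>" for x
      by (simp add: \<alpha>_def \<beta>_def p_def min_def algebra_simps)
    then show "(\<integral>\<^sup>+x. ennreal (norm x) * ennreal (\<alpha> x) + ennreal (norm x) * ennreal (\<beta> x) \<partial>\<rho>) =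
        (\<integral>\<^sup>+x. ennreal (norm x * \<bar>m x - n x\<bar>) \<partial>\<rho>)"
      using pos by (simp add: ennreal_mult[symmetric] ennreal_plus[symmetric] del: ennreal_plus)
  qed simp_all
  also have "\<dots> \<le> ennreal d"
  proof -
    define \<psi> where "\<psi> x = norm x * sgn (m x - n x)" for x
    have [measurable]: "\<psi> \<in> borel_measurable borel"
      unfolding \<psi>_def by measurable
    have \<psi>: "\<psi> \<in> dominated (\<lambda>v. 1 + norm v)"
      by (auto simp: dominated_def \<psi>_def abs_mult abs_sgn_eq)
    have i: "integrable \<rho> (\<lambda>x. m x * \<psi> x)" "integrable \<rho> (\<lambda>x. n x * \<psi> x)"
      using dominated_integrable[OF \<psi> \<mu>] dominated_integrable[OF \<psi> \<nu>] nonneg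
      by (simp_all add: dens integrable_real_density measurable_Prob \<rho>)
    have e: "m x * \<psi> x - n x * \<psi> x = norm x * \<bar>m x - n x\<bar>" for x
      by (auto simp: \<psi>_def sgn_if algebra_simps)
    have "(\<integral>v. \<psi> v \<partial>\<mu>) - (\<integral>v. \<psi> v \<partial>\<nu>) = (\<integral>x. m x * \<psi> x \<partial>\<rho>) - (\<integral>x. n x * \<psi> x \<partial>\<rho>)"
      using nonneg by (simp add: dens integral_real_density measurable_Prob \<rho>)
    also have "\<dots> = (\<integral>x. norm x * \<bar>m x - n x\<bar> \<partial>\<rho>)"
      using i by (simp add: e flip: Bochner_Integration.integral_diff)
    finally have "(\<integral>x. norm x * \<bar>m x - n x\<bar> \<partial>\<rho>) \<le> d"
      using tv_leD[OF d \<psi>] by simp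
    moreover have "integrable \<rho> (\<lambda>x. norm x * \<bar>m x - n x\<bar>)"
      using Bochner_Integration.integrable_diff[OF i] by (simp add: e)
    ultimately show ?thesis
      by (subst nn_integral_eq_integral) (auto intro: ennreal_leI)
  qed
  finally show ?thesis .
qed

text \<open>For probability measures a 1-Lipschitz function may be shifted to vanish at 0, and is then
dominated by the weight.\<close>

lemma KR_diff_le_tv:
  fixes \<mu> \<nu> :: "'a::euclidean_space measure"
  assumes \<mu>: "\<mu> \<in> Prob_weighted (\<lambda>v. 1 + norm v)" and \<nu>: "\<nu> \<in> Prob_weighted (\<lambda>v. 1 + norm v)"
    and d: "tv_le (\<lambda>v. 1 + norm v) \<mu> \<nu> d"
  shows "KR_diff \<mu> \<nu> \<le> ereal d"
  unfolding KR_diff_def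
proof (rule SUP_least)
  fix \<phi> :: "'a \<Rightarrow> real" assume "\<phi> \<in> {\<phi>. 1-lipschitz_on UNIV \<phi>}"
  then have L: "1-lipschitz_on UNIV \<phi>" by simp
  interpret M: prob_space \<mu> by (rule ProbD[OF Prob_weightedD(1)[OF \<mu>]])
  interpret N: prob_space \<nu> by (rule ProbD[OF Prob_weightedD(1)[OF \<nu>]])
  let ?\<psi> = "\<lambda>v. \<phi> v - \<phi> 0"
  have "\<phi> \<in> borel_measurable borel"
    using lipschitz_on_continuous_on[OF L] by (rule borel_measurable_continuous_onI)
  moreover have "\<bar>\<phi> v - \<phi> 0\<bar> \<le> 1 + norm v" for v
    using lipschitz_onD[OF L, of v 0] by (simp add: dist_norm)
  ultimately have \<psi>: "?\<psi> \<in> dominated (\<lambda>v. 1 + norm v)"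
    by (simp add: dominated_def)
  have int: "(\<integral>v. \<phi> v \<partial>\<sigma>) = (\<integral>v. ?\<psi> v \<partial>\<sigma>) + \<phi> 0"
    if \<sigma>: "\<sigma> \<in> Prob_weighted (\<lambda>v. 1 + norm v)" for \<sigma>
  proof -
    interpret S: prob_space \<sigma> by (rule ProbD[OF Prob_weightedD(1)[OF \<sigma>]])
    have "(\<integral>v. ?\<psi> v + \<phi> 0 \<partial>\<sigma>) = (\<integral>v. ?\<psi> v \<partial>\<sigma>) + \<phi> 0"
      using dominated_integrable[OF \<psi> \<sigma>]
      by (subst Bochner_Integration.integral_add) (simp_all add: S.prob_space)
    then show ?thesis by simp
  qed
  show "ereal ((\<integral>v. \<phi> v \<partial>\<mu>) - (\<integral>v. \<phi> v \<partial>\<nu>)) \<le> ereal d"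
    using tv_leD[OF d \<psi>] by (simp add: int[OF \<mu>] int[OF \<nu>])
qed

text \<open>The extremal observable is the sign of \<open>m - n\<close>, that is, \<open>2 \<cdot> 1\<^sub>P - 1\<close> for the set
\<open>P = {n \<le> m}\<close>.\<close>

lemma tv_le_one_of_sets:
  assumes \<mu>: "\<mu> \<in> Prob" and \<nu>: "\<nu> \<in> Prob"
    and c: "\<And>A. A \<in> sets borel \<Longrightarrow> \<bar>measure \<mu> A - measure \<nu> A\<bar> \<le> c"
  shows "tv_le (\<lambda>_. 1) \<mu> \<nu> (2 * c)"
proof -
  obtain \<rho> m n where \<rho>: "\<rho> \<in> Prob"
    and mn [measurable]: "m \<in> borel_measurable borel" "n \<in> borel_measurable borel"
    and nonneg: "\<And>x. 0 \<le> m x" "\<And>x. 0 \<le> n x"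
    and dens: "\<mu> = density \<rho> (\<lambda>x. ennreal (m x))" "\<nu> = density \<rho> (\<lambda>x. ennreal (n x))"
    using common_density[OF \<mu> \<nu>] by blast
  have mn\<rho>: "m \<in> borel_measurable \<rho>" "n \<in> borel_measurable \<rho>"
    by (simp_all add: measurable_Prob \<rho>)
  have W: "\<mu> \<in> Prob_weighted (\<lambda>_. 1)" "\<nu> \<in> Prob_weighted (\<lambda>_. 1)"
    using \<mu> \<nu> ProbD[OF \<mu>] ProbD[OF \<nu>] by (auto simp: Prob_weighted_def prob_space_def finite_measure.integrable_const)
  have diff: "integrable \<rho> (\<lambda>x. (m x - n x) * \<psi> x)"
      "(\<integral>v. \<psi> v \<partial>\<mu>) - (\<integral>v. \<psi> v \<partial>\<nu>) = (\<integral>x. (m x - n x) * \<psi> x \<partial>\<rho>)"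
    if \<psi>: "\<psi> \<in> dominated (\<lambda>_. 1)" for \<psi>
  proof -
    have [measurable]: "\<psi> \<in> borel_measurable borel" using \<psi> by (simp add: dominated_def)
    have i: "integrable \<rho> (\<lambda>x. m x * \<psi> x)" "integrable \<rho> (\<lambda>x. n x * \<psi> x)"
      using dominated_integrable[OF \<psi> W(1)] dominated_integrable[OF \<psi> W(2)] nonneg
      by (simp_all add: dens integrable_real_density measurable_Prob \<rho>)
    then show "integrable \<rho> (\<lambda>x. (m x - n x) * \<psi> x)"
      by (simp add: left_diff_distrib)
    show "(\<integral>v. \<psi> v \<partial>\<mu>) - (\<integral>v. \<psi> v \<partial>\<nu>) = (\<integral>x. (m x - n x) * \<psi> x \<partial>\<rho>)"
      using i nonneg by (simp add: dens integral_real_density measurable_Prob \<rho> left_diff_distrib)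
  qed
  let ?P = "{x. n x \<le> m x}" and ?s = "\<lambda>x. if n x \<le> m x then 1 else - 1 :: real"
  have s: "?s \<in> dominated (\<lambda>_. 1)" by (auto simp: dominated_def)
  have P [measurable]: "?P \<in> sets borel" by measurable
  have int_s: "(\<integral>v. ?s v \<partial>\<sigma>) = 2 * measure \<sigma> ?P - 1" if \<sigma>: "\<sigma> \<in> Prob" for \<sigma>
  proof -
    interpret S: prob_space \<sigma> by (rule ProbD[OF \<sigma>])
    note [simp] = ProbD(2,3)[OF \<sigma>]
    have "(\<integral>v. ?s v \<partial>\<sigma>) = (\<integral>v. 2 * indicator ?P v - 1 \<partial>\<sigma>)"
      by (intro Bochner_Integration.integral_cong) (auto split: split_indicator)
    also have "\<dots> = 2 * measure \<sigma> ?P - 1"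
      using S.prob_space by (subst Bochner_Integration.integral_diff) (auto simp: S.emeasure_eq_measure)
    finally show ?thesis .
  qed
  show ?thesis
    unfolding tv_le_def
  proof
    fix \<psi> :: "'a \<Rightarrow> real" assume \<psi>: "\<psi> \<in> dominated (\<lambda>_. 1)"
    have "\<bar>(\<integral>v. \<psi> v \<partial>\<mu>) - (\<integral>v. \<psi> v \<partial>\<nu>)\<bar> \<le> (\<integral>x. \<bar>(m x - n x) * \<psi> x\<bar> \<partial>\<rho>)"
      unfolding diff[OF \<psi>] using integral_norm_bound[of \<rho> "\<lambda>x. (m x - n x) * \<psi> x"] by simp
    also have "\<dots> \<le> (\<integral>x. (m x - n x) * ?s x \<partial>\<rho>)"
    proof (rule integral_mono)
      show "integrable \<rho> (\<lambda>x. \<bar>(m x - n x) * \<psi> x\<bar>)" using diff(1)[OF \<psi>] by simp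
      show "integrable \<rho> (\<lambda>x. (m x - n x) * ?s x)" by (rule diff(1)[OF s])
      fix x
      have "\<bar>m x - n x\<bar> * \<bar>\<psi> x\<bar> \<le> \<bar>m x - n x\<bar> * 1"
        using \<psi> by (intro mult_left_mono) (auto simp: dominated_def)
      then show "\<bar>(m x - n x) * \<psi> x\<bar> \<le> (m x - n x) * ?s x"
        by (auto simp: abs_mult)
    qed
    also have "\<dots> = 2 * (measure \<mu> ?P - measure \<nu> ?P)"
      by (simp add: diff(2)[OF s, symmetric] int_s \<mu> \<nu>)
    also have "\<dots> \<le> 2 * c"
      using c[OF P] by simp
    finally show "\<bar>(\<integral>v. \<psi> v \<partial>\<mu>) - (\<integral>v. \<psi> v \<partial>\<nu>)\<bar> \<le> 2 * c" .
  qed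
qed

lemma Prob_eqI_tv:
  assumes \<mu>: "\<mu> \<in> Prob" and \<nu>: "\<nu> \<in> Prob" and "tv_le (\<lambda>_. 1) \<mu> \<nu> 0"
  shows "\<mu> = \<nu>"
proof (rule measure_eqI)
  interpret M: prob_space \<mu> by (rule ProbD[OF \<mu>])
  interpret N: prob_space \<nu> by (rule ProbD[OF \<nu>])
  note [simp] = ProbD(2,3)[OF \<mu>] ProbD(2,3)[OF \<nu>]
  show "sets \<mu> = sets \<nu>" by simp
  fix A assume "A \<in> sets \<mu>"
  then have "indicator A \<in> dominated (\<lambda>_. 1)"
    by (auto simp: dominated_def split: split_indicator)
  from tv_leD[OF assms(3) this] \<open>A \<in> sets \<mu>\<close> have "measure \<mu> A = measure \<nu> A" by simp
  then show "emeasure \<mu> A = emeasure \<nu> A"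
    by (simp add: M.emeasure_eq_measure N.emeasure_eq_measure)
qed

section \<open>Absolutely continuous functions with nonpositive derivative\<close>

text \<open>The families of intervals that the definition of absolute continuity quantifies over.\<close>

definition short_family :: "real set \<Rightarrow> real \<Rightarrow> nat \<Rightarrow> (nat \<Rightarrow> real) \<Rightarrow> (nat \<Rightarrow> real) \<Rightarrow> bool" where
  "short_family I \<delta> n a b \<longleftrightarrow> (\<forall>i<n. a i \<in> I \<and> b i \<in> I \<and> a i \<le> b i) \<and>
     disjoint_family_on (\<lambda>i. {a i<..<b i}) {..<n} \<and> (\<Sum>i<n. b i - a i) < \<delta>"

lemma abs_continuous_on_iff:
  "abs_continuous_on I F \<longleftrightarrow> (\<forall>\<epsilon>>0. \<exists>\<delta>>0. \<forall>n a b. short_family I \<delta> n a b \<longrightarrow>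
     (\<Sum>i<n. \<bar>F (b i) - F (a i)\<bar>) < \<epsilon>)"
  by (simp add: abs_continuous_on_def short_family_def)

lemma abs_continuous_onE:
  assumes "abs_continuous_on I F" "\<epsilon> > 0"
  obtains \<delta> where "\<delta> > 0" "\<And>n a b. short_family I \<delta> n a b \<Longrightarrow> (\<Sum>i<n. \<bar>F (b i) - F (a i)\<bar>) < \<epsilon>"
  using assms unfolding abs_continuous_on_iff by meson

lemma short_family_mono:
  "short_family I \<delta> n a b \<Longrightarrow> I \<subseteq> J \<Longrightarrow> \<delta> \<le> \<eta> \<Longrightarrow> short_family J \<eta> n a b"
  by (auto simp: short_family_def)

lemma abs_continuous_on_subset:
  "abs_continuous_on I F \<Longrightarrow> J \<subseteq> I \<Longrightarrow> abs_continuous_on J F"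
  unfolding abs_continuous_on_iff by (meson short_family_mono order_refl)

lemma abs_continuous_on_uminus:
  "abs_continuous_on I F \<Longrightarrow> abs_continuous_on I (\<lambda>t. - F t)"
  unfolding abs_continuous_on_def by (simp add: abs_minus_commute)

lemma lipschitz_abs_continuous:
  fixes G :: "real \<Rightarrow> real"
  assumes "L-lipschitz_on I G"
  shows "abs_continuous_on I G"
  unfolding abs_continuous_on_iff
proof (intro allI impI)
  fix e :: real assume e: "e > 0"
  have L: "L \<ge> 0" by (rule lipschitz_on_nonneg[OF assms])
  have "(\<Sum>i<n. \<bar>G (b i) - G (a i)\<bar>) < e" if *: "short_family I (e / (L + 1)) n a b" for n a b
  proof -
    have "(\<Sum>i<n. \<bar>G (b i) - G (a i)\<bar>) \<le> (\<Sum>i<n. (L + 1) * (b i - a i))"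
    proof (rule sum_mono)
      fix i assume "i \<in> {..<n}"
      then have "dist (G (b i)) (G (a i)) \<le> L * dist (b i) (a i)" "a i \<le> b i"
        using * by (auto simp: short_family_def intro!: lipschitz_onD[OF assms])
      then show "\<bar>G (b i) - G (a i)\<bar> \<le> (L + 1) * (b i - a i)"
        by (simp add: dist_real_def algebra_simps)
    qed
    also have "\<dots> < e"
      unfolding sum_distrib_left[symmetric]
      using * L by (simp add: short_family_def pos_less_divide_eq mult.commute)
    finally show ?thesis .
  qed
  moreover have "e / (L + 1) > 0" using e L by simp
  ultimately show "\<exists>\<delta>>0. \<forall>n a b. short_family I \<delta> n a b \<longrightarrow> (\<Sum>i<n. \<bar>G (b i) - G (a i)\<bar>) < e"
    by blast
qed

lemma abs_continuous_on_add:
  assumes "abs_continuous_on I F" "abs_continuous_on I G"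
  shows "abs_continuous_on I (\<lambda>t. F t + G t)"
  unfolding abs_continuous_on_iff
proof (intro allI impI)
  fix e :: real assume "e > 0"
  then have e: "e / 2 > 0" by simp
  obtain d1 where d1: "d1 > 0" "\<And>n a b. short_family I d1 n a b \<Longrightarrow> (\<Sum>i<n. \<bar>F (b i) - F (a i)\<bar>) < e / 2"
    using abs_continuous_onE[OF assms(1) e] by blast
  obtain d2 where d2: "d2 > 0" "\<And>n a b. short_family I d2 n a b \<Longrightarrow> (\<Sum>i<n. \<bar>G (b i) - G (a i)\<bar>) < e / 2"
    using abs_continuous_onE[OF assms(2) e] by blast
  have "(\<Sum>i<n. \<bar>F (b i) + G (b i) - (F (a i) + G (a i))\<bar>) < e"
    if "short_family I (min d1 d2) n a b" for n a b
  proof -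
    have s: "short_family I d1 n a b" "short_family I d2 n a b"
      using that by (auto intro: short_family_mono)
    have "(\<Sum>i<n. \<bar>F (b i) + G (b i) - (F (a i) + G (a i))\<bar>)
        \<le> (\<Sum>i<n. \<bar>F (b i) - F (a i)\<bar> + \<bar>G (b i) - G (a i)\<bar>)"
      by (intro sum_mono) linarith
    also have "\<dots> < e"
      using d1(2)[OF s(1)] d2(2)[OF s(2)] by (simp add: sum.distrib)
    finally show ?thesis .
  qed
  moreover have "min d1 d2 > 0" using d1(1) d2(1) by simp
  ultimately show "\<exists>\<delta>>0. \<forall>n a b. short_family I \<delta> n a b \<longrightarrow>
      (\<Sum>i<n. \<bar>F (b i) + G (b i) - (F (a i) + G (a i))\<bar>) < e"
    by blast
qed

text \<open>This replaces the fundamental theorem of calculus for absolutely continuous functions and does not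
require the derivative to be integrable. A tagged division is chosen fine enough that on a cell
whose tag is not in the exceptional null set \<open>N\<close>, the increment is at most \<open>e\<close> times the length,
while the cells with tags in \<open>N\<close> lie in an open set \<open>U\<close> of measure less than \<open>\<delta>\<close>; absolute
continuity bounds the sum of the increments over the latter by \<open>e\<close>.\<close>

lemma abs_continuous_nonincreasing:
  fixes H :: "real \<Rightarrow> real"
  assumes ac: "abs_continuous_on {a..b} H" and ab: "a \<le> b"
    and der: "AE t in lborel. t \<in> {a..b} \<longrightarrow>
      (\<exists>D\<le>0. (H has_real_derivative D) (at t within {a..b}))"
  shows "H b \<le> H a"
proof -
  obtain N where N: "N \<in> null_sets lborel"
    and sub: "{t \<in> space lborel. \<not> (t \<in> {a..b} \<longrightarrow> (\<exists>D\<le>0. (H has_real_derivative D) (at t within {a..b})))} \<subseteq> N"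
    using der unfolding eventually_ae_filter by blast
  have der: "\<And>t. t \<notin> N \<Longrightarrow> t \<in> {a..b} \<Longrightarrow> \<exists>D\<le>0. (H has_real_derivative D) (at t within {a..b})"
    using sub by auto
  have step: "H b - H a \<le> e * (1 + (b - a))" if e: "e > 0" for e
  proof -
    obtain \<delta> where \<delta>: "\<delta> > 0"
      and small: "\<And>n u v. short_family {a..b} \<delta> n u v \<Longrightarrow> (\<Sum>i<n. \<bar>H (v i) - H (u i)\<bar>) < e"
      using abs_continuous_onE[OF ac e] by blast
    have [measurable]: "N \<in> sets borel" using N by (auto simp: null_sets_def)
    obtain U where U: "open U" "N \<subseteq> U" "emeasure lborel (U - N) < \<delta>"
      using outer_regular_lborel[OF _ \<delta>, of N] by auto
    have [measurable]: "U \<in> sets borel" using U(1) by simp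
    have "emeasure lborel U = emeasure lborel (U - N)"
      using N by (intro emeasure_Diff_null_set[symmetric]) auto
    then have U\<delta>: "emeasure lborel U < \<delta>" using U(3) by simp
    define fine_at where "fine_at x r \<longleftrightarrow> r > 0 \<and> (x \<in> N \<longrightarrow> ball x r \<subseteq> U) \<and>
      (x \<notin> N \<and> x \<in> {a..b} \<longrightarrow> (\<forall>y\<in>{a..b}. dist y x < r \<longrightarrow>
        (x \<le> y \<longrightarrow> H y - H x \<le> e * (y - x)) \<and> (y \<le> x \<longrightarrow> H x - H y \<le> e * (x - y))))" for x r
    have "\<exists>r. fine_at x r" for x
    proof (cases "x \<in> N")
      case True
      then obtain r where "r > 0" "ball x r \<subseteq> U"
        using U(1,2) unfolding open_contains_ball by blast
      then show ?thesis using True by (auto simp: fine_at_def)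
    next
      case False
      show ?thesis
      proof (cases "x \<in> {a..b}")
        case True
        obtain D where D: "D \<le> 0" "(H has_real_derivative D) (at x within {a..b})"
          using der[OF False True] by auto
        then have "(H has_derivative (\<lambda>h. D * h)) (at x within {a..b})"
          by (simp add: has_field_derivative_def)
        then obtain r where r: "r > 0" and
          H: "\<And>y. y \<in> {a..b} \<Longrightarrow> \<bar>y - x\<bar> < r \<Longrightarrow> \<bar>H y - H x - D * (y - x)\<bar> \<le> e * \<bar>y - x\<bar>"
          using e unfolding has_derivative_within_alt real_norm_def by blast
        have "(x \<le> y \<longrightarrow> H y - H x \<le> e * (y - x)) \<and> (y \<le> x \<longrightarrow> H x - H y \<le> e * (x - y))"
          if y: "y \<in> {a..b}" "dist y x < r" for y
        proof -
          have *: "\<bar>H y - H x - D * (y - x)\<bar> \<le> e * \<bar>y - x\<bar>"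
            using H y by (simp add: dist_real_def)
          have "x \<le> y \<Longrightarrow> D * (y - x) \<le> 0" "y \<le> x \<Longrightarrow> D * (y - x) \<ge> 0"
            using D(1) by (auto simp: mult_nonpos_nonneg mult_nonpos_nonpos)
          moreover have "x \<le> y \<Longrightarrow> \<bar>y - x\<bar> = y - x" "y \<le> x \<Longrightarrow> \<bar>y - x\<bar> = x - y" by auto
          ultimately show ?thesis using * by (auto simp: abs_le_iff)
        qed
        then show ?thesis using r False unfolding fine_at_def by blast
      qed (use False in \<open>auto simp: fine_at_def intro: exI[of _ 1]\<close>)
    qed
    then obtain r where fine_r: "\<And>x. fine_at x (r x)" by metis
    then have r: "r x > 0" "x \<in> N \<Longrightarrow> ball x (r x) \<subseteq> U" for x
      by (auto simp: fine_at_def)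
    have good: "(x \<le> y \<longrightarrow> H y - H x \<le> e * (y - x)) \<and> (y \<le> x \<longrightarrow> H x - H y \<le> e * (x - y))"
      if "x \<notin> N" "x \<in> {a..b}" "y \<in> {a..b}" "dist y x < r x" for x y
      using fine_r[of x] that unfolding fine_at_def by blast
    have "gauge (\<lambda>x. ball x (r x))"
      using r(1) gauge_ball_dependent by blast
    then obtain p where p: "p tagged_division_of {a..b}" and fine: "(\<lambda>x. ball x (r x)) fine p"
      by (rule fine_division_exists_real)
    have fin: "finite p" using p by (rule tagged_division_of_finite)
    have cell: "\<exists>u v. K = {u..v} \<and> u \<le> x \<and> x \<le> v \<and> Inf K = u \<and> Sup K = v \<and> u \<in> {a..b} \<and> v \<in> {a..b}
        \<and> K \<subseteq> ball x (r x) \<and> x \<in> {a..b}"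
      if xK: "(x, K) \<in> p" for x K
    proof -
      have "x \<in> K" "K \<subseteq> {a..b}" "\<exists>u v. K = cbox u v"
        using p xK by (auto simp: tagged_division_of)
      then obtain u v where uv: "K = {u..v}" by auto
      then have "u \<le> x" "x \<le> v" using \<open>x \<in> K\<close> by auto
      then show ?thesis
        using uv \<open>K \<subseteq> {a..b}\<close> fine xK by (intro exI[of _ u] exI[of _ v]) (auto simp: fine_def)
    qed
    let ?len = "\<lambda>(x::real, K::real set). Sup K - Inf K" and ?inc = "\<lambda>(x::real, K::real set). H (Sup K) - H (Inf K)"
    let ?bad = "{z \<in> p. fst z \<in> N}" and ?good = "{z \<in> p. fst z \<notin> N}"
    have len0: "0 \<le> ?len z" if "z \<in> p" for z
      using cell[of "fst z" "snd z"] that by (auto simp: case_prod_unfold)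
    have "sum ?inc ?good \<le> (\<Sum>z\<in>?good. e * ?len z)"
    proof (rule sum_mono)
      fix z assume z: "z \<in> ?good"
      obtain x K where [simp]: "z = (x, K)" by (cases z)
      obtain u v where uv: "K = {u..v}" "u \<le> x" "x \<le> v" "Inf K = u" "Sup K = v" "u \<in> {a..b}" "v \<in> {a..b}"
        "K \<subseteq> ball x (r x)" "x \<in> {a..b}"
        using cell[of x K] z by auto
      have "u \<in> K" "v \<in> K" using uv(1-3) by auto
      then have "u \<in> ball x (r x)" "v \<in> ball x (r x)" using uv(8) by blast+
      then have "H v - H x \<le> e * (v - x)" "H x - H u \<le> e * (x - u)"
        using good[of x v] good[of x u] z uv by (auto simp: dist_commute)
      then have "H v - H u \<le> e * (v - u)" by (simp add: algebra_simps)
      then show "?inc z \<le> e * ?len z" using uv by simp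
    qed
    also have "\<dots> \<le> (\<Sum>z\<in>p. e * ?len z)"
      using fin e len0 by (intro sum_mono2) auto
    also have "\<dots> = e * (b - a)"
      using additive_tagged_division_1[OF ab p, of "\<lambda>x. x"] by (simp flip: sum_distrib_left)
    finally have G: "sum ?inc ?good \<le> e * (b - a)" .
    have B: "sum ?inc ?bad \<le> e"
    proof -
      obtain h where h: "bij_betw h {..<card ?bad} ?bad"
        using ex_bij_betw_nat_finite[of ?bad] fin by (auto simp: atLeast0LessThan)
      let ?n = "card ?bad"
      define u v where "u i = Inf (snd (h i))" and "v i = Sup (snd (h i))" for i
      have hp: "h i \<in> p" "fst (h i) \<in> N" if "i < ?n" for i
        using h that by (auto simp: bij_betw_def)
      have c: "u i \<in> {a..b} \<and> v i \<in> {a..b} \<and> u i \<le> v i \<and> snd (h i) = {u i..v i} \<and> snd (h i) \<subseteq> ball (fst (h i)) (r (fst (h i)))"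
        if "i < ?n" for i
        using cell[of "fst (h i)" "snd (h i)"] hp[OF that] by (auto simp: u_def v_def)
      have disj: "disjoint_family_on (\<lambda>i. {u i<..<v i}) {..<?n}"
        unfolding disjoint_family_on_def
      proof (intro ballI impI)
        fix i j assume ij: "i \<in> {..<?n}" "j \<in> {..<?n}" "i \<noteq> j"
        then have "h i \<noteq> h j" using h by (auto simp: bij_betw_def inj_on_def)
        then have "interior (snd (h i)) \<inter> interior (snd (h j)) = {}"
          using tagged_division_ofD(5)[OF p, of "fst (h i)" "snd (h i)" "fst (h j)" "snd (h j)"] hp(1) ij by simp
        then show "{u i<..<v i} \<inter> {u j<..<v j} = {}"
          using c[of i] c[of j] ij by (auto simp: interior_atLeastAtMost_real)
      qed
      have "ennreal (\<Sum>i<?n. v i - u i) = (\<Sum>i<?n. ennreal (v i - u i))"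
        using c by (subst sum_ennreal) auto
      also have "\<dots> = (\<Sum>i<?n. emeasure lborel {u i<..<v i})"
        using c by (intro sum.cong) auto
      also have "\<dots> = emeasure lborel (\<Union>i<?n. {u i<..<v i})"
        using disj by (intro sum_emeasure) auto
      also have "\<dots> \<le> emeasure lborel U"
      proof (rule emeasure_mono)
        show "(\<Union>i<?n. {u i<..<v i}) \<subseteq> U"
        proof
          fix y assume "y \<in> (\<Union>i<?n. {u i<..<v i})"
          then obtain i where i: "i < ?n" "y \<in> {u i<..<v i}" by auto
          then have "y \<in> snd (h i)" using c[of i] by auto
          then show "y \<in> U" using c[of i] r(2)[OF hp(2)] i by blast
        qed
      qed simp
      also have "\<dots> < ennreal \<delta>" by (rule U\<delta>)
      finally have "ennreal (\<Sum>i<?n. v i - u i) < ennreal \<delta>" .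
      moreover have "0 \<le> (\<Sum>i<?n. v i - u i)"
        by (rule sum_nonneg) (use c in auto)
      ultimately have "(\<Sum>i<?n. v i - u i) < \<delta>"
        using ennreal_less_iff by blast
      then have "(\<Sum>i<?n. \<bar>H (v i) - H (u i)\<bar>) < e"
        using c disj by (intro small) (auto simp: short_family_def)
      moreover have "sum ?inc ?bad = (\<Sum>i<?n. H (v i) - H (u i))"
        unfolding sum.reindex_bij_betw[OF h, symmetric] by (simp add: u_def v_def case_prod_unfold)
      moreover have "(\<Sum>i<?n. H (v i) - H (u i)) \<le> (\<Sum>i<?n. \<bar>H (v i) - H (u i)\<bar>)"
        by (intro sum_mono) auto
      ultimately show ?thesis by linarith
    qed
    have "H b - H a = sum ?inc p"
      using additive_tagged_division_1[OF ab p, of H] by simp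
    also have "\<dots> = sum ?inc ?bad + sum ?inc ?good"
      using fin by (subst sum.union_disjoint[symmetric]) (auto intro!: sum.cong)
    also have "\<dots> \<le> e * (1 + (b - a))"
      using G B by (simp add: algebra_simps)
    finally show ?thesis .
  qed
  have "H b - H a \<le> 0"
  proof (rule field_le_epsilon)
    fix e :: real assume "e > 0"
    then show "H b - H a \<le> 0 + e"
      using step[of "e / (1 + (b - a))"] ab by simp
  qed
  then show ?thesis by simp
qed

lemma abs_continuous_increment_le:
  fixes X Y :: "real \<Rightarrow> real"
  assumes X: "abs_continuous_on {a..b} X" and Y: "abs_continuous_on {a..b} Y" and ab: "a \<le> b"
    and der: "AE t in lborel. t \<in> {a..b} \<longrightarrow> (\<exists>D E. (X has_real_derivative D) (at t within {a..b}) \<and>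
      (Y has_real_derivative E) (at t within {a..b}) \<and> \<bar>D\<bar> \<le> E)"
  shows "\<bar>X b - X a\<bar> \<le> Y b - Y a"
proof -
  have step: "Z b + - Y b \<le> Z a + - Y a" if Z: "abs_continuous_on {a..b} Z"
    and dZ: "\<And>t D. (X has_real_derivative D) (at t within {a..b}) \<Longrightarrow>
      \<exists>D'\<le>\<bar>D\<bar>. (Z has_real_derivative D') (at t within {a..b})" for Z
  proof (rule abs_continuous_nonincreasing[OF _ ab])
    show "abs_continuous_on {a..b} (\<lambda>t. Z t + - Y t)"
      by (intro abs_continuous_on_add abs_continuous_on_uminus Z Y)
    show "AE t in lborel. t \<in> {a..b} \<longrightarrow>
        (\<exists>D\<le>0. ((\<lambda>t. Z t + - Y t) has_real_derivative D) (at t within {a..b}))"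
      using der
    proof eventually_elim
      case (elim t)
      show ?case
      proof
        assume "t \<in> {a..b}"
        then obtain D E where D: "(X has_real_derivative D) (at t within {a..b})"
          and E: "(Y has_real_derivative E) (at t within {a..b})" "\<bar>D\<bar> \<le> E"
          using elim by blast
        obtain D' where D': "D' \<le> \<bar>D\<bar>" "(Z has_real_derivative D') (at t within {a..b})"
          using dZ[OF D] by blast
        have "((\<lambda>t. Z t + - Y t) has_real_derivative D' + - E) (at t within {a..b})"
          by (intro DERIV_add DERIV_minus D'(2) E(1))
        moreover have "D' + - E \<le> 0" using D'(1) E(2) by linarith
        ultimately show "\<exists>D\<le>0. ((\<lambda>t. Z t + - Y t) has_real_derivative D) (at t within {a..b})"
          by blast
      qed
    qed
  qed
  have "X b + - Y b \<le> X a + - Y a"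
    by (rule step[OF X]) (auto intro: abs_ge_self)
  moreover have "- X b + - Y b \<le> - X a + - Y a"
    by (rule step[OF abs_continuous_on_uminus[OF X]]) (auto intro: DERIV_minus abs_ge_minus_self)
  ultimately show ?thesis by linarith
qed

section \<open>Smooth compactly supported functions determine the total variation\<close>

lemma C_times_SucI:
  assumes "\<And>x. (f has_derivative D x) (at x)" "\<And>b. b \<in> Basis \<Longrightarrow> C_times k (\<lambda>x. D x b)"
  shows "C_times (Suc k) f"
proof -
  have "frechet_derivative f (at x) = D x" for x
    by (rule frechet_derivative_at[OF assms(1), symmetric])
  moreover have "f differentiable (at x)" for x
    using assms(1) by (rule differentiableI)
  ultimately show ?thesis using assms(2) by simp
qed

lemma C_times_SucD:
  assumes "C_times (Suc k) f"
  shows "(f has_derivative frechet_derivative f (at x)) (at x)"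
    "b \<in> Basis \<Longrightarrow> C_times k (\<lambda>x. frechet_derivative f (at x) b)"
  using assms by (simp_all add: frechet_derivative_works[symmetric])

text \<open>Needed for products: the derivative of \<open>f \<cdot> g\<close> involves \<open>f\<close> and \<open>g\<close> themselves.\<close>

lemma C_times_decrease: "C_times (Suc k) f \<Longrightarrow> C_times k f"
proof (induction k arbitrary: f)
  case 0
  then show ?case
    by (auto simp: continuous_on_eq_continuous_at differentiable_imp_continuous_within)
next
  case (Suc k)
  show ?case
    by (rule C_times_SucI[OF C_times_SucD(1)[OF Suc.prems] Suc.IH[OF C_times_SucD(2)[OF Suc.prems]]])
qed

lemma C_times_const: "C_times k (\<lambda>_. c)"
proof (induction k arbitrary: c)
  case (Suc k)
  show ?case by (rule C_times_SucI[OF has_derivative_const Suc])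
qed simp

lemma C_times_inner: "C_times k (\<lambda>x. (x - c) \<bullet> b)"
proof (cases k)
  case (Suc j)
  show ?thesis unfolding Suc
    by (rule C_times_SucI[where D = "\<lambda>_ h. h \<bullet> b"]) (auto intro!: derivative_eq_intros C_times_const)
qed (auto intro!: continuous_intros)

lemma C_times_add: "C_times k f \<Longrightarrow> C_times k g \<Longrightarrow> C_times k (\<lambda>x. f x + g x)"
proof (induction k arbitrary: f g)
  case (Suc k)
  show ?case
    using C_times_SucD[OF Suc.prems(1)] C_times_SucD[OF Suc.prems(2)]
    by (intro C_times_SucI[where D = "\<lambda>x h. frechet_derivative f (at x) h + frechet_derivative g (at x) h"]
        has_derivative_add Suc.IH) auto
qed (auto intro: continuous_intros)

lemma C_times_mult: "C_times k f \<Longrightarrow> C_times k g \<Longrightarrow> C_times k (\<lambda>x. f x * g x)"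
proof (induction k arbitrary: f g)
  case (Suc k)
  show ?case
    using C_times_SucD[OF Suc.prems(1)] C_times_SucD[OF Suc.prems(2)]
      C_times_decrease[OF Suc.prems(1)] C_times_decrease[OF Suc.prems(2)]
    by (intro C_times_SucI[where D = "\<lambda>x h. f x * frechet_derivative g (at x) h + frechet_derivative f (at x) h * g x"]
        has_derivative_mult C_times_add Suc.IH) auto
qed (auto intro: continuous_intros)

lemma C_times_diff:
  assumes "C_times k f" "C_times k g" shows "C_times k (\<lambda>x. f x - g x)"
  using C_times_add[OF assms(1) C_times_mult[OF C_times_const assms(2)], of "- 1"] by simp

lemma C_times_power: "C_times k f \<Longrightarrow> C_times k (\<lambda>x. f x ^ n)"
  by (induction n) (auto intro: C_times_const C_times_mult)

lemma C_times_prod: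
  assumes "\<And>i. i \<in> I \<Longrightarrow> C_times k (f i)" shows "C_times k (\<lambda>x. \<Prod>i\<in>I. f i x)"
  using assms by (induction I rule: infinite_finite_induct) (auto intro: C_times_const C_times_mult)

text \<open>The functions \<open>e\<^sup>-\<^sup>1\<^sup>/\<^sup>s p(1/s)\<close>, extended by 0 to \<open>s \<le> 0\<close>. The family is closed under
differentiation, so the standard smooth function \<open>flat 1\<close> needs no separate treatment of its
higher derivatives.\<close>

definition flat :: "real poly \<Rightarrow> real \<Rightarrow> real" where
  "flat p s = (if s > 0 then exp (- (1 / s)) * poly p (1 / s) else 0)"

lemma poly_div_exp_tendsto_0: "((\<lambda>y. poly p y / exp y) \<longlongrightarrow> (0::real)) at_top"
proof -
  have "((\<lambda>y. \<Sum>i\<le>degree p. coeff p i * (y ^ i / exp y)) \<longlongrightarrow> (\<Sum>i\<le>degree p. coeff p i * 0)) at_top"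
    by (intro tendsto_sum tendsto_mult tendsto_const tendsto_power_div_exp_0)
  then show ?thesis by (simp add: poly_altdef sum_divide_distrib)
qed

lemma flat_has_derivative:
  "(flat p has_real_derivative flat ([:0, 0, 1:] * (p - pderiv p)) s) (at s)"
proof (cases s "0::real" rule: linorder_cases)
  case less
  have "((\<lambda>_. 0) has_real_derivative 0) (at s)" by simp
  then have "(flat p has_real_derivative 0) (at s)"
    by (rule has_field_derivative_transform_within_open[of _ _ _ "{..<0}"]) (use less in \<open>auto simp: flat_def\<close>)
  then show ?thesis using less by (simp add: flat_def)
next
  case greater
  have "((\<lambda>s. exp (- (1 / s)) * poly p (1 / s)) has_real_derivative
      exp (- (1 / s)) * (1 / s)\<^sup>2 * (poly p (1 / s) - poly (pderiv p) (1 / s))) (at s)"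
    using greater
    by (auto intro!: derivative_eq_intros DERIV_chain'[OF _ poly_DERIV]
        simp: field_simps power2_eq_square)
  then have "(flat p has_real_derivative
      exp (- (1 / s)) * (1 / s)\<^sup>2 * (poly p (1 / s) - poly (pderiv p) (1 / s))) (at s)"
    by (rule has_field_derivative_transform_within_open[of _ _ _ "{0<..}"]) (use greater in \<open>auto simp: flat_def\<close>)
  then show ?thesis using greater by (simp add: flat_def power2_eq_square mult_ac)
next
  case equal
  have "((\<lambda>h. flat p h / h) \<longlongrightarrow> 0) (at_right 0)"
  proof -
    have "((\<lambda>h. poly ([:0, 1:] * p) (inverse h) / exp (inverse h)) \<longlongrightarrow> (0::real)) (at_right 0)"
      by (rule filterlim_compose[OF poly_div_exp_tendsto_0 filterlim_inverse_at_top_right])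
    moreover have "\<forall>\<^sub>F h in at_right 0. poly ([:0, 1:] * p) (inverse h) / exp (inverse h) = flat p h / h"
      by (auto simp: eventually_at_right_less flat_def exp_minus field_simps eventually_at_filter)
    ultimately show ?thesis by (rule Lim_transform_eventually)
  qed
  moreover have "((\<lambda>h. flat p h / h) \<longlongrightarrow> 0) (at_left 0)"
  proof (rule Lim_transform_eventually[OF tendsto_const])
    show "\<forall>\<^sub>F h in at_left 0. 0 = flat p h / h"
      by (auto simp: eventually_at_filter flat_def)
  qed
  ultimately have "((\<lambda>h. flat p h / h) \<longlongrightarrow> 0) (at 0)"
    by (simp add: filterlim_split_at)
  then have "(flat p has_real_derivative 0) (at 0)"
    by (simp add: DERIV_def) (simp add: flat_def)
  then show ?thesis using equal by (simp add: flat_def)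
qed

text \<open>For \<open>p = 1\<close> this is a smooth function that is positive exactly on the open ball of radius \<open>r\<close>
about \<open>c\<close> (if \<open>r > 0\<close>); other \<open>p\<close> arise from its derivatives.\<close>

definition bump :: "'a::euclidean_space \<Rightarrow> real \<Rightarrow> real poly \<Rightarrow> 'a \<Rightarrow> real" where
  "bump c r p x = flat p (r\<^sup>2 - (x - c) \<bullet> (x - c))"

lemma bump_has_derivative:
  "(bump c r p has_derivative
     (\<lambda>h. bump c r ([:0, 0, 1:] * (p - pderiv p)) x * (- 2 * ((x - c) \<bullet> h)))) (at x)"
proof -
  have "((\<lambda>x. r\<^sup>2 - (x - c) \<bullet> (x - c)) has_derivative (\<lambda>h. - 2 * ((x - c) \<bullet> h))) (at x)"
    by (auto intro!: derivative_eq_intros simp: inner_commute)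
  from has_derivative_compose[OF this flat_has_derivative[unfolded has_field_derivative_def]]
  show ?thesis unfolding bump_def .
qed

lemma C_times_bump: "C_times k (bump c r p)"
proof (induction k arbitrary: p)
  case 0
  then show ?case
    using bump_has_derivative[of c r p]
    by (auto simp: continuous_on_eq_continuous_at intro: has_derivative_continuous)
next
  case (Suc k)
  show ?case
  proof (rule C_times_SucI[OF bump_has_derivative])
    fix b :: 'a
    show "C_times k (\<lambda>x. bump c r ([:0, 0, 1:] * (p - pderiv p)) x * (- 2 * ((x - c) \<bullet> b)))"
      by (intro C_times_mult Suc.IH C_times_const C_times_inner)
  qed
qed

lemma bump_1:
  assumes "r > 0"
  shows "0 \<le> bump c r 1 x" "bump c r 1 x \<le> 1" "x \<in> ball c r \<Longrightarrow> 0 < bump c r 1 x"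
    "x \<notin> ball c r \<Longrightarrow> bump c r 1 x = 0"
proof -
  have *: "x \<in> ball c r \<longleftrightarrow> 0 < r\<^sup>2 - (x - c) \<bullet> (x - c)"
  proof -
    have "norm (x - c) < r \<longleftrightarrow> (norm (x - c))\<^sup>2 < r\<^sup>2"
      using power_mono_iff[of r "norm (x - c)" 2] assms
      by (metis norm_ge_zero less_imp_le not_le zero_less_numeral)
    then show ?thesis
      by (simp only: power2_norm_eq_inner mem_ball dist_norm norm_minus_commute[of c x] diff_gt_0_iff_gt)
  qed
  show "0 \<le> bump c r 1 x" "bump c r 1 x \<le> 1" by (auto simp: bump_def flat_def)
  show "x \<in> ball c r \<Longrightarrow> 0 < bump c r 1 x" "x \<notin> ball c r \<Longrightarrow> bump c r 1 x = 0"
    unfolding * by (auto simp: bump_def flat_def)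
qed

text \<open>The open set is a countable union of balls, with bumps \<open>\<psi>\<^sub>i\<close>. The function
\<open>1 - \<Prod>\<^sub>i\<^sub><\<^sub>n (1 - \<psi>\<^sub>i)\<^sup>n\<close> takes values in \<open>[0, 1]\<close> and vanishes off the first \<open>n\<close> balls; on the
\<open>j\<close>th ball it tends to 1, because the factor \<open>(1 - \<psi>\<^sub>j)\<^sup>n\<close> tends to 0.\<close>

lemma open_approx_test_functions:
  fixes U :: "'a::euclidean_space set"
  assumes U: "open U"
  obtains \<phi> :: "nat \<Rightarrow> 'a \<Rightarrow> real"
  where "\<And>n. test_function (\<phi> n)" "\<And>n x. 0 \<le> \<phi> n x" "\<And>n x. \<phi> n x \<le> 1"
    "\<And>x. (\<lambda>n. \<phi> n x) \<longlonglongrightarrow> indicator U x"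
proof (cases "U = {}")
  case True
  show thesis
    by (rule that[of "\<lambda>_ _. 0"]) (auto simp: test_function_def C_times_const True)
next
  case False
  let ?F = "{ball c r | c r. r > 0 \<and> ball c r \<subseteq> U}"
  obtain F' where F': "F' \<subseteq> ?F" "countable F'" "\<Union>F' = \<Union>?F"
  proof (rule Lindelof[of ?F])
    show "open S" if "S \<in> ?F" for S using that by auto
  qed
  have "\<Union>?F = U"
  proof
    show "U \<subseteq> \<Union>?F"
    proof
      fix x assume "x \<in> U"
      then obtain r where "r > 0" "ball x r \<subseteq> U"
        using U by (auto simp: open_contains_ball)
      then have "ball x r \<in> ?F" "x \<in> ball x r" by auto
      then show "x \<in> \<Union>?F" by blast
    qed
  qed auto
  then have F'U: "\<Union>F' = U" using F'(3) by simp
  then have "F' \<noteq> {}" using False by auto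
  then have rng: "range (from_nat_into F') = F'"
    using F'(2) by (rule range_from_nat_into)
  have "\<exists>c r. r > 0 \<and> from_nat_into F' i = ball c r" for i
  proof -
    have "from_nat_into F' i \<in> ?F"
      using F'(1) from_nat_into[OF \<open>F' \<noteq> {}\<close>] by (rule subsetD)
    then show ?thesis by (auto simp only: mem_Collect_eq)
  qed
  then obtain c r where cr: "\<And>i. r i > 0" "\<And>i. from_nat_into F' i = ball (c i) (r i)"
    by metis
  have UN: "U = (\<Union>i. ball (c i) (r i))"
    unfolding cr(2)[symmetric] rng F'U ..
  define \<psi> where "\<psi> i = bump (c i) (r i) 1" for i
  have \<psi>: "0 \<le> \<psi> i x" "\<psi> i x \<le> 1" "x \<in> ball (c i) (r i) \<Longrightarrow> 0 < \<psi> i x" "x \<notin> ball (c i) (r i) \<Longrightarrow> \<psi> i x = 0" for i x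
    using bump_1[OF cr(1)] by (auto simp: \<psi>_def)
  define \<phi> where "\<phi> n x = 1 - (\<Prod>i<n. (1 - \<psi> i x) ^ n)" for n x
  have prod01: "0 \<le> (\<Prod>i<n. (1 - \<psi> i x) ^ n)" "(\<Prod>i<n. (1 - \<psi> i x) ^ n) \<le> 1" for n x
    using \<psi> by (auto intro!: prod_nonneg prod_le_1 power_le_one)
  show thesis
  proof (rule that[of \<phi>])
    show "0 \<le> \<phi> n x" "\<phi> n x \<le> 1" for n x
      using prod01[of x n] by (auto simp: \<phi>_def)
    show "test_function (\<phi> n)" for n
      unfolding test_function_def
    proof
      show "\<forall>k. C_times k (\<phi> n)"
        unfolding \<phi>_def \<psi>_def
        by (intro allI C_times_diff C_times_const C_times_prod C_times_power C_times_bump)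
      have "{x. \<phi> n x \<noteq> 0} \<subseteq> (\<Union>i<n. ball (c i) (r i))"
      proof
        fix x assume x: "x \<in> {x. \<phi> n x \<noteq> 0}"
        show "x \<in> (\<Union>i<n. ball (c i) (r i))"
        proof (rule ccontr)
          assume "x \<notin> (\<Union>i<n. ball (c i) (r i))"
          then have "\<phi> n x = 0" using \<psi>(4) by (auto simp: \<phi>_def)
          then show False using x by simp
        qed
      qed
      moreover have "bounded (\<Union>i<n. ball (c i) (r i))" by auto
      ultimately have "bounded {x. \<phi> n x \<noteq> 0}" by (rule bounded_subset[rotated])
      then show "compact (closure {x. \<phi> n x \<noteq> 0})" by simp
    qed
    fix x
    show "(\<lambda>n. \<phi> n x) \<longlonglongrightarrow> indicator U x"
    proof (cases "x \<in> U")
      case True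
      then obtain j where j: "x \<in> ball (c j) (r j)" using UN by auto
      have lim: "(\<lambda>n. (1 - \<psi> j x) ^ n) \<longlonglongrightarrow> 0"
        using \<psi>(1,2)[of j x] \<psi>(3)[OF j] by (intro LIMSEQ_realpow_zero) auto
      have upper: "\<forall>\<^sub>F n in sequentially. (\<Prod>i<n. (1 - \<psi> i x) ^ n) \<le> (1 - \<psi> j x) ^ n"
        using eventually_gt_at_top[of j]
      proof eventually_elim
        case (elim n)
        have "(\<Prod>i<n. (1 - \<psi> i x) ^ n) = (1 - \<psi> j x) ^ n * (\<Prod>i\<in>{..<n} - {j}. (1 - \<psi> i x) ^ n)"
          using elim by (intro prod.remove) auto
        also have "\<dots> \<le> (1 - \<psi> j x) ^ n * 1"
          using \<psi> by (intro mult_left_mono prod_le_1) (auto intro: power_le_one)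
        finally show ?case by simp
      qed
      have lower: "\<forall>\<^sub>F n in sequentially. 0 \<le> (\<Prod>i<n. (1 - \<psi> i x) ^ n)"
        by (intro always_eventually allI prod01)
      have "(\<lambda>n. \<Prod>i<n. (1 - \<psi> i x) ^ n) \<longlonglongrightarrow> 0"
        by (rule tendsto_sandwich[OF lower upper tendsto_const lim])
      then have "(\<lambda>n. 1 - (\<Prod>i<n. (1 - \<psi> i x) ^ n)) \<longlonglongrightarrow> 1 - 0"
        by (intro tendsto_diff tendsto_const)
      then show ?thesis using True by (simp add: \<phi>_def)
    next
      case False
      then have "\<psi> i x = 0" for i using UN \<psi>(4) by auto
      then show ?thesis using False by (simp add: \<phi>_def)
    qed
  qed
qed

lemma test_function_continuous: "test_function \<phi> \<Longrightarrow> continuous_on UNIV \<phi>"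
  unfolding test_function_def by (metis C_times.simps(1))

text \<open>Dominated convergence passes from test functions to open sets, and outer regularity from open sets
to Borel sets. The factor 2 is the price for testing only with functions between 0 and 1.\<close>

lemma test_functions_determine_tv:
  fixes \<mu> \<nu> :: "'a::euclidean_space measure"
  assumes \<mu>: "\<mu> \<in> Prob" and \<nu>: "\<nu> \<in> Prob"
    and c: "\<And>\<phi>. test_function \<phi> \<Longrightarrow> (\<And>x. 0 \<le> \<phi> x) \<Longrightarrow> (\<And>x. \<phi> x \<le> 1) \<Longrightarrow>
      \<bar>(\<integral>v. \<phi> v \<partial>\<mu>) - (\<integral>v. \<phi> v \<partial>\<nu>)\<bar> \<le> c"
  shows "tv_le (\<lambda>_. 1) \<mu> \<nu> (2 * c)"
proof (rule tv_le_one_of_sets[OF \<mu> \<nu>])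
  interpret M: prob_space \<mu> by (rule ProbD[OF \<mu>])
  interpret N: prob_space \<nu> by (rule ProbD[OF \<nu>])
  note [simp] = ProbD(2,3)[OF \<mu>] ProbD(2,3)[OF \<nu>]
  have opn: "\<bar>measure \<mu> U - measure \<nu> U\<bar> \<le> c" if U: "open U" for U
  proof -
    obtain \<phi> :: "nat \<Rightarrow> 'a \<Rightarrow> real" where \<phi>: "\<And>n. test_function (\<phi> n)" "\<And>n x. 0 \<le> \<phi> n x" "\<And>n x. \<phi> n x \<le> 1"
      "\<And>x. (\<lambda>n. \<phi> n x) \<longlonglongrightarrow> indicator U x"
      using open_approx_test_functions[OF U] by blast
    have lim: "(\<lambda>n. \<integral>v. \<phi> n v \<partial>\<sigma>) \<longlonglongrightarrow> measure \<sigma> U" if \<sigma>: "\<sigma> \<in> Prob" for \<sigma>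
    proof -
      interpret S: prob_space \<sigma> by (rule ProbD[OF \<sigma>])
      have "(\<lambda>n. \<integral>v. \<phi> n v \<partial>\<sigma>) \<longlonglongrightarrow> (\<integral>v. indicator U v \<partial>\<sigma>)"
      proof (rule integral_dominated_convergence[where w = "\<lambda>_. 1"])
        show "\<phi> n \<in> borel_measurable \<sigma>" for n
          using test_function_continuous[OF \<phi>(1)] by (simp add: measurable_Prob[OF \<sigma>] borel_measurable_continuous_onI)
        show "indicator U \<in> borel_measurable \<sigma>"
          using U by (simp add: measurable_Prob[OF \<sigma>])
        show "AE x in \<sigma>. norm (\<phi> n x) \<le> 1" for n
          using \<phi>(2,3) by auto
      qed (use \<phi>(4) in auto)
      then show ?thesis using ProbD(3)[OF \<sigma>] by simp
    qed
    have "(\<lambda>n. \<bar>(\<integral>v. \<phi> n v \<partial>\<mu>) - (\<integral>v. \<phi> n v \<partial>\<nu>)\<bar>) \<longlonglongrightarrow> \<bar>measure \<mu> U - measure \<nu> U\<bar>"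
      by (intro tendsto_intros lim \<mu> \<nu>)
    then show ?thesis
      by (rule LIMSEQ_le_const2) (use c[OF \<phi>(1-3)] in auto)
  qed
  fix A :: "'a set" assume A: "A \<in> sets borel"
  show "\<bar>measure \<mu> A - measure \<nu> A\<bar> \<le> c"
  proof (rule field_le_epsilon)
    fix e :: real assume e: "e > 0"
    have outer: "\<exists>U. A \<subseteq> U \<and> open U \<and> measure \<sigma> U < measure \<sigma> A + e / 2" if \<sigma>: "\<sigma> \<in> Prob" for \<sigma>
    proof -
      interpret S: prob_space \<sigma> by (rule ProbD[OF \<sigma>])
      have "emeasure \<sigma> A = (INF U\<in>{U. A \<subseteq> U \<and> open U}. emeasure \<sigma> U)"
        using A ProbD(2)[OF \<sigma>] by (intro outer_regular) auto
      moreover have "emeasure \<sigma> A < ennreal (measure \<sigma> A + e / 2)"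
        using e by (simp add: S.emeasure_eq_measure ennreal_lessI)
      ultimately obtain U where "A \<subseteq> U" "open U" "emeasure \<sigma> U < ennreal (measure \<sigma> A + e / 2)"
        by (auto simp: INF_less_iff)
      then show ?thesis
        by (auto simp: S.emeasure_eq_measure ennreal_less_iff)
    qed
    obtain U V where UV: "A \<subseteq> U" "open U" "measure \<mu> U < measure \<mu> A + e / 2"
        "A \<subseteq> V" "open V" "measure \<nu> V < measure \<nu> A + e / 2"
      using outer[OF \<mu>] outer[OF \<nu>] by blast
    let ?W = "U \<inter> V"
    have "measure \<mu> A \<le> measure \<mu> ?W" "measure \<nu> A \<le> measure \<nu> ?W"
      using UV by (auto intro!: M.finite_measure_mono N.finite_measure_mono)
    moreover have "measure \<mu> ?W \<le> measure \<mu> U" "measure \<nu> ?W \<le> measure \<nu> V"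
      using UV by (auto intro!: M.finite_measure_mono N.finite_measure_mono)
    moreover have "\<bar>measure \<mu> ?W - measure \<nu> ?W\<bar> \<le> c"
      using UV by (intro opn) auto
    ultimately show "\<bar>measure \<mu> A - measure \<nu> A\<bar> \<le> c + e"
      using UV(3,6) e by linarith
  qed
qed

section \<open>The Wild sum\<close>

locale bounded_kernel = collision_kernel B c
  for B :: "'p measure" and c :: "'a::euclidean_space \<Rightarrow> 'a \<Rightarrow> 'p \<Rightarrow> 'a" +
  fixes a :: real
  assumes a_nonneg: "0 \<le> a"
    and c_bound: "\<theta> \<in> space B \<Longrightarrow> norm (c v w \<theta>) \<le> a * (norm v + norm w)"

sublocale bounded_kernel \<subseteq> W: weighted_kernel B c "\<lambda>v. 1 + norm v" "1 + a"
proof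
  fix \<theta> v w assume "\<theta> \<in> space B"
  then have "1 + norm (c v w \<theta>) \<le> 1 + a * (norm v + norm w)"
    using c_bound by simp
  also have "\<dots> \<le> (1 + a) * (1 + norm v) * (1 + norm w)"
    using a_nonneg by (simp add: algebra_simps add_increasing)
  finally show "1 + norm (c v w \<theta>) \<le> (1 + a) * (1 + norm v) * (1 + norm w)" .
qed (use a_nonneg in auto)

sublocale collision_kernel \<subseteq> U: weighted_kernel B c "\<lambda>_. 1" 1
  by unfold_locales auto

lemma Prob_weighted_one: "Prob_weighted (\<lambda>_. 1) = Prob"
proof -
  have "integrable \<mu> (\<lambda>_. 1::real)" if "\<mu> \<in> Prob" for \<mu> :: "'a measure"
    using prob_space.finite_measure[OF ProbD(1)[OF that]] by (rule finite_measure.integrable_const)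
  then show ?thesis by (auto simp: Prob_weighted_def)
qed

lemma Prob1_eq: "Prob1 = Prob_weighted (\<lambda>v. 1 + norm v)"
proof -
  have "integrable \<mu> norm \<longleftrightarrow> integrable \<mu> (\<lambda>v. 1 + norm v)" if \<mu>: "\<mu> \<in> Prob" for \<mu> :: "'a measure"
  proof -
    interpret prob_space \<mu> by (rule ProbD[OF \<mu>])
    show ?thesis
    proof
      show "integrable \<mu> (\<lambda>v. 1 + norm v)" if "integrable \<mu> norm"
        using that by simp
      show "integrable \<mu> norm" if "integrable \<mu> (\<lambda>v. 1 + norm v)"
        using Bochner_Integration.integrable_diff[OF that integrable_const[of 1]] by simp
    qed
  qed
  then show ?thesis by (auto simp: Prob1_def Prob_weighted_def)
qed

lemma integral_weight:
  assumes "\<mu> \<in> Prob1"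
  shows "(\<integral>v. 1 + norm v \<partial>\<mu>) = 1 + first_moment \<mu>"
proof -
  have \<mu>: "\<mu> \<in> Prob" "integrable \<mu> norm" using assms by (auto simp: Prob1_def)
  interpret prob_space \<mu> by (rule ProbD[OF \<mu>(1)])
  show ?thesis using \<mu>(2) by (simp add: first_moment_def prob_space)
qed

lemma first_moment_nonneg: "0 \<le> first_moment \<mu>"
  by (simp add: first_moment_def)

lemma norm_dominated: "norm \<in> dominated (\<lambda>v. 1 + norm v)"
  by (simp add: dominated_def)

lemma one_dominated_weight: "\<psi> \<in> dominated (\<lambda>_. 1) \<Longrightarrow> \<psi> \<in> dominated (\<lambda>v. 1 + norm v)"
  by (auto simp: dominated_def intro: add_increasing2)

text \<open>
\<open>wild n\<close> is the law of a particle whose collision history is a random binary tree with \<open>n\<close>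
collisions. The last collision splits the remaining \<open>n - 1\<close> into \<open>k\<close> and \<open>n - 1 - k\<close>, where all
\<open>k\<close> are equally likely. The component \<open>f0\<close> with an index beyond the remaining collisions
is a placeholder of weight zero.\<close>

fun wild ::
    "('a::euclidean_space \<Rightarrow> 'a \<Rightarrow> 'p \<Rightarrow> 'a) \<Rightarrow> 'p measure \<Rightarrow> 'a measure \<Rightarrow> nat \<Rightarrow> 'a measure" where
  "wild c B f0 0 = f0"
| "wild c B f0 (Suc n) = mixture (\<lambda>k. if k \<le> n then 1 / real (Suc n) else 0)
     (\<lambda>k. if k \<le> n then bigain c B (wild c B f0 k) (wild c B f0 (n - k)) else f0)"

text \<open>For \<open>t \<ge> 0\<close> the weights are those of the geometric distribution with parameter \<open>e\<^sup>-\<^sup>t\<close>.\<close>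

definition wild_sum ::
    "('a::euclidean_space \<Rightarrow> 'a \<Rightarrow> 'p \<Rightarrow> 'a) \<Rightarrow> 'p measure \<Rightarrow> 'a measure \<Rightarrow> real \<Rightarrow> 'a measure" where
  "wild_sum c B f0 t = mixture (\<lambda>n. exp (- t) * (1 - exp (- t)) ^ n) (wild c B f0)"

context bounded_kernel
begin

lemma first_moment_bigain:
  assumes \<mu>: "\<mu> \<in> Prob1" and \<nu>: "\<nu> \<in> Prob1"
  shows "first_moment (bigain c B \<mu> \<nu>) \<le> a * (first_moment \<mu> + first_moment \<nu>)"
proof -
  note W = \<mu>[unfolded Prob1_eq] \<nu>[unfolded Prob1_eq]
  interpret M: prob_space \<mu> by (rule ProbD[OF Prob_weightedD(1)[OF W(1)]])
  interpret N: prob_space \<nu> by (rule ProbD[OF Prob_weightedD(1)[OF W(2)]])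
  have int: "integrable \<mu> norm" "integrable \<nu> norm" using \<mu> \<nu> by (auto simp: Prob1_def)
  have cn: "W.collide norm v w \<le> a * (norm v + norm w)" for v w
  proof -
    have "W.collide norm v w \<le> (\<integral>\<theta>. a * (norm v + norm w) \<partial>B)"
      unfolding W.collide_def
    proof (rule integral_mono)
      show "integrable B (\<lambda>\<theta>. norm (c v w \<theta>))"
        using c_bound by (intro B.integrable_const_bound[of _ "a * (norm v + norm w)"]) auto
    qed (use c_bound in auto)
    then show ?thesis by (simp add: B.prob_space)
  qed
  have W2: "\<sigma> \<in> Prob_weighted (\<lambda>w. k * (1 + norm w))" if "\<sigma> \<in> Prob_weighted (\<lambda>v. 1 + norm v)"
    for k and \<sigma> :: "'a measure"
    using Prob_weightedD[OF that] unfolding Prob_weighted_def by simp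
  have inner: "(\<integral>w. W.collide norm v w \<partial>\<nu>) \<le> a * (norm v + first_moment \<nu>)" for v
  proof -
    have "(\<integral>w. W.collide norm v w \<partial>\<nu>) \<le> (\<integral>w. a * (norm v + norm w) \<partial>\<nu>)"
      using int dominated_integrable[OF W.collide_dominated[OF norm_dominated] W2[OF W(2)]]
      by (intro integral_mono cn) auto
    also have "\<dots> = a * (norm v + first_moment \<nu>)"
      using int by (simp add: first_moment_def N.prob_space)
    finally show ?thesis .
  qed
  have "first_moment (bigain c B \<mu> \<nu>) = (\<integral>v. \<integral>w. W.collide norm v w \<partial>\<nu> \<partial>\<mu>)"
    unfolding first_moment_def by (rule W.integral_bigain[OF W norm_dominated])
  also have "\<dots> \<le> (\<integral>v. a * (norm v + first_moment \<nu>) \<partial>\<mu>)"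
    using int dominated_integrable[OF W.collide_integral_dominated[OF W(2) norm_dominated] W2[OF W(1)]]
    by (intro integral_mono inner) auto
  also have "\<dots> = a * (first_moment \<mu> + first_moment \<nu>)"
    using int by (simp add: first_moment_def M.prob_space)
  finally show ?thesis .
qed

lemma bigain_Prob1: "\<mu> \<in> Prob1 \<Longrightarrow> \<nu> \<in> Prob1 \<Longrightarrow> bigain c B \<mu> \<nu> \<in> Prob1"
  unfolding Prob1_eq by (rule W.bigain_weighted)

end

text \<open>
The partial sums satisfy \<open>S\<^sub>n\<^sub>+\<^sub>1 \<le> (1 + b/(n + 1)) S\<^sub>n\<close> and hence grow subexponentially; the ratio test
applies to them. With \<open>m\<close> the first moments of the Wild terms, this makes the Wild sum a measure with
finite first moment at every time.\<close>

lemma summable_of_averaged_recursion: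
  fixes m :: "nat \<Rightarrow> real"
  assumes nonneg: "\<And>n. 0 \<le> m n" and b: "0 \<le> b"
    and rec: "\<And>n. m (Suc n) \<le> b / real (Suc n) * (\<Sum>k\<le>n. m k)"
    and z: "0 \<le> z" "z < 1"
  shows "summable (\<lambda>n. m n * z ^ n)"
proof (rule summable_comparison_test')
  define S where "S n = (\<Sum>k\<le>n. m k)" for n
  have S0: "0 \<le> S n" for n by (simp add: S_def sum_nonneg nonneg)
  obtain N :: nat where N: "2 * b / (1 - z) < real N"
    using reals_Archimedean2 by blast
  show "summable (\<lambda>n. S n * z ^ n)"
  proof (rule summable_ratio_test)
    show "(1 + z) / 2 < 1" using z by simp
    fix n assume "N \<le> n"
    then have "2 * b / (1 - z) < real (Suc n)" using N by linarith
    then have "2 * b < real (Suc n) * (1 - z)"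
      using z by (simp add: pos_divide_less_eq)
    then have "b / real (Suc n) \<le> (1 - z) / 2"
      by (simp add: field_simps)
    then have "b / real (Suc n) * z \<le> (1 - z) / 2 * 1"
      using z b by (intro mult_mono) auto
    then have "z + b / real (Suc n) * z \<le> z + (1 - z) / 2 * 1"
      by (rule add_left_mono)
    also have "\<dots> = (1 + z) / 2"
      by (simp add: field_simps)
    finally have fac: "(1 + b / real (Suc n)) * z \<le> (1 + z) / 2"
      by (simp only: distrib_right mult_1_left)
    have "S (Suc n) \<le> (1 + b / real (Suc n)) * S n"
      using rec[of n] by (simp add: S_def algebra_simps)
    then have "S (Suc n) * z ^ Suc n \<le> (1 + b / real (Suc n)) * S n * z ^ Suc n"
      using z by (intro mult_right_mono) auto
    also have "\<dots> = ((1 + b / real (Suc n)) * z) * (S n * z ^ n)"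
      by (simp add: mult_ac)
    also have "\<dots> \<le> (1 + z) / 2 * (S n * z ^ n)"
      using S0 z by (intro mult_right_mono fac) auto
    finally show "norm (S (Suc n) * z ^ Suc n) \<le> (1 + z) / 2 * norm (S n * z ^ n)"
      using S0 z by (simp add: abs_mult)
  qed
  fix n
  have "m n \<le> S n"
    unfolding S_def by (rule member_le_sum) (auto intro: nonneg)
  then show "norm (m n * z ^ n) \<le> S n * z ^ n"
    using nonneg z by (simp add: abs_mult mult_right_mono)
qed

locale wild_kernel = bounded_kernel B c a
  for B :: "'p measure" and c :: "'a::euclidean_space \<Rightarrow> 'a \<Rightarrow> 'p \<Rightarrow> 'a" and a +
  fixes f0 :: "'a measure"
  assumes f0: "f0 \<in> Prob1"
begin

abbreviation "Q \<equiv> wild c B f0"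
abbreviation "F \<equiv> wild_sum c B f0"
abbreviation "m \<equiv> \<lambda>n. first_moment (Q n)"

lemma f0_Prob: "f0 \<in> Prob"
  using f0 by (simp add: Prob1_def)

lemma nn_integral_wild_Suc:
  assumes Q: "\<And>k. k \<le> n \<Longrightarrow> Q k \<in> Prob" and f: "f \<in> borel_measurable borel"
  shows "(\<integral>\<^sup>+x. f x \<partial>Q (Suc n)) =
    (\<Sum>k\<le>n. ennreal (1 / real (Suc n)) * (\<integral>\<^sup>+x. f x \<partial>bigain c B (Q k) (Q (n - k))))"
proof -
  have "(\<integral>\<^sup>+x. f x \<partial>Q (Suc n)) = (\<Sum>k. ennreal (if k \<le> n then 1 / real (Suc n) else 0) *
      (\<integral>\<^sup>+x. f x \<partial>(if k \<le> n then bigain c B (Q k) (Q (n - k)) else f0)))"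
    unfolding wild.simps using f ProbD(2)[OF f0_Prob] by (intro nn_integral_mixture) auto
  also have "\<dots> = (\<Sum>k\<le>n. ennreal (1 / real (Suc n)) * (\<integral>\<^sup>+x. f x \<partial>bigain c B (Q k) (Q (n - k))))"
    by (subst suminf_finite[of "{..n}"]) auto
  finally show ?thesis .
qed

lemma wild_Prob: "Q n \<in> Prob"
proof (induction n rule: less_induct)
  case (less n)
  show ?case
  proof (cases n)
    case 0
    then show ?thesis by (simp add: f0_Prob)
  next
    case (Suc j)
    have IH: "Q k \<in> Prob" if "k \<le> j" for k using less[of k] that Suc by simp
    show ?thesis unfolding Suc
    proof (rule ProbI)
      have "emeasure (Q (Suc j)) UNIV = (\<integral>\<^sup>+x. 1 \<partial>Q (Suc j))" by simp
      also have "\<dots> = (\<Sum>k\<le>j. ennreal (1 / real (Suc j)) * emeasure (bigain c B (Q k) (Q (j - k))) UNIV)"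
        using nn_integral_wild_Suc[OF IH, where f = "\<lambda>_. 1"] ProbD(3)[OF bigain_Prob[OF IH IH]] by simp
      also have "\<dots> = (\<Sum>k\<le>j. ennreal (1 / real (Suc j)))"
        using ProbD(4)[OF bigain_Prob[OF IH IH]] by (intro sum.cong) auto
      also have "\<dots> = ennreal (\<Sum>k\<le>j. 1 / real (Suc j))"
        by (rule sum_ennreal) simp
      also have "\<dots> = 1" by simp
      finally show "emeasure (Q (Suc j)) UNIV = 1" .
    qed simp
  qed
qed

lemma sets_wild: "sets (Q n) = sets borel"
  by (rule ProbD(2)[OF wild_Prob])

lemma wild_Prob1: "Q n \<in> Prob1"
proof (induction n rule: less_induct)
  case (less n)
  show ?case
  proof (cases n)
    case 0
    then show ?thesis by (simp add: f0)
  next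
    case (Suc j)
    have IH: "bigain c B (Q k) (Q (j - k)) \<in> Prob1" if "k \<le> j" for k
      using less[of k] less[of "j - k"] that Suc by (intro bigain_Prob1) auto
    have "integrable (Q (Suc j)) norm"
    proof (rule integrableI_bounded)
      show "norm \<in> borel_measurable (Q (Suc j))" by (simp add: measurable_Prob[OF wild_Prob] del: wild.simps)
      have "(\<integral>\<^sup>+x. ennreal (norm x) \<partial>bigain c B (Q k) (Q (j - k))) < \<top>" if "k \<le> j" for k
        using IH[OF that] by (auto simp: Prob1_def integrable_iff_bounded)
      then show "(\<integral>\<^sup>+x. ennreal (norm (norm x)) \<partial>Q (Suc j)) < \<infinity>"
        by (subst nn_integral_wild_Suc) (auto simp: wild_Prob ennreal_mult_less_top)
    qed
    then show ?thesis unfolding Suc using wild_Prob[of "Suc j"] by (simp add: Prob1_def del: wild.simps)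
  qed
qed

lemma wild_weighted: "Q n \<in> Prob_weighted (\<lambda>v. 1 + norm v)"
  using wild_Prob1 by (simp add: Prob1_eq)

lemma integral_wild_Suc:
  assumes \<psi>: "\<psi> \<in> dominated (\<lambda>v. 1 + norm v)"
  shows "real (Suc n) * (\<integral>x. \<psi> x \<partial>Q (Suc n)) = (\<Sum>k\<le>n. \<integral>x. \<psi> x \<partial>bigain c B (Q k) (Q (n - k)))"
proof -
  let ?c = "\<lambda>k. if k \<le> n then 1 / real (Suc n) else 0"
  let ?R = "\<lambda>k. if k \<le> n then bigain c B (Q k) (Q (n - k)) else f0"
  have "integrable (mixture ?c ?R) \<psi>"
    using dominated_integrable[OF \<psi> wild_weighted[of "Suc n"]] by simp
  then have "(\<lambda>k. ?c k * (\<integral>x. \<psi> x \<partial>?R k)) sums (\<integral>x. \<psi> x \<partial>mixture ?c ?R)"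
    using ProbD(2)[OF f0_Prob] by (intro integral_mixture) auto
  moreover have "(\<lambda>k. ?c k * (\<integral>x. \<psi> x \<partial>?R k)) sums (\<Sum>k\<le>n. ?c k * (\<integral>x. \<psi> x \<partial>?R k))"
    by (rule sums_finite) auto
  ultimately have "(\<integral>x. \<psi> x \<partial>Q (Suc n)) = (\<Sum>k\<le>n. ?c k * (\<integral>x. \<psi> x \<partial>?R k))"
    unfolding wild.simps by (rule sums_unique2)
  also have "\<dots> = (\<Sum>k\<le>n. 1 / real (Suc n) * (\<integral>x. \<psi> x \<partial>bigain c B (Q k) (Q (n - k))))"
    by (intro sum.cong) auto
  also have "\<dots> = 1 / real (Suc n) * (\<Sum>k\<le>n. (\<integral>x. \<psi> x \<partial>bigain c B (Q k) (Q (n - k))))"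
    by (rule sum_distrib_left[symmetric])
  finally show ?thesis by (simp del: wild.simps)
qed

lemma first_moment_wild_Suc: "m (Suc n) \<le> 2 * a / real (Suc n) * (\<Sum>k\<le>n. m k)"
proof -
  have "real (Suc n) * m (Suc n) = (\<Sum>k\<le>n. first_moment (bigain c B (Q k) (Q (n - k))))"
    unfolding first_moment_def by (rule integral_wild_Suc[OF norm_dominated])
  also have "\<dots> \<le> (\<Sum>k\<le>n. a * (m k + m (n - k)))"
    by (intro sum_mono first_moment_bigain wild_Prob1)
  also have "\<dots> = a * ((\<Sum>k\<le>n. m k) + (\<Sum>k\<le>n. m (n - k)))"
    by (simp add: sum_distrib_left sum.distrib distrib_left)
  also have "(\<Sum>k\<le>n. m (n - k)) = (\<Sum>k\<le>n. m k)"
    by (rule sum.nat_diff_reindex[of m "Suc n", simplified lessThan_Suc_atMost diff_Suc_Suc])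
  finally show ?thesis by (simp add: field_simps del: wild.simps)
qed

lemma summable_weights:
  assumes "0 \<le> z" "z < 1"
  shows "summable (\<lambda>n. (1 + m n) * z ^ n)"
proof -
  have "summable (\<lambda>n. m n * z ^ n)"
    using a_nonneg assms
    by (intro summable_of_averaged_recursion[of m "2 * a"] first_moment_wild_Suc first_moment_nonneg) auto
  then show ?thesis
    using assms by (simp add: distrib_right summable_add summable_geometric)
qed

lemma wild_integral_bound:
  assumes "\<psi> \<in> dominated (\<lambda>v. 1 + norm v)"
  shows "\<bar>\<integral>x. \<psi> x \<partial>Q n\<bar> \<le> 1 + m n"
  using dominated_integral_le[OF assms wild_weighted, of n] integral_weight[OF wild_Prob1, of n] by simp

lemma summable_wild:
  assumes \<psi>: "\<psi> \<in> dominated (\<lambda>v. 1 + norm v)" and z: "\<bar>z\<bar> < 1"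
  shows "summable (\<lambda>n. (\<integral>x. \<psi> x \<partial>Q n) * z ^ n)"
proof (rule summable_comparison_test')
  show "summable (\<lambda>n. (1 + m n) * \<bar>z\<bar> ^ n)" using z by (intro summable_weights) auto
  show "norm ((\<integral>x. \<psi> x \<partial>Q n) * z ^ n) \<le> (1 + m n) * \<bar>z\<bar> ^ n" for n
    using wild_integral_bound[OF \<psi>] by (simp add: abs_mult power_abs mult_right_mono)
qed

lemma wild_sum_Prob:
  assumes t: "0 \<le> t" shows "F t \<in> Prob"
proof (rule ProbI)
  let ?z = "1 - exp (- t)"
  have z: "0 \<le> ?z" "?z < 1" using t by auto
  have "(\<lambda>n. exp (- t) * ?z ^ n) sums (exp (- t) * (1 / (1 - ?z)))"
    using z by (intro sums_mult geometric_sums) auto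
  then have "(\<lambda>n. exp (- t) * ?z ^ n) sums 1" by simp
  then have "(\<Sum>n. ennreal (exp (- t) * ?z ^ n)) = ennreal 1"
    using z by (intro suminf_ennreal_eq) auto
  then show "emeasure (F t) UNIV = 1"
    unfolding wild_sum_def using ProbD(4)[OF wild_Prob] by (subst emeasure_mixture) (auto simp: sets_wild)
qed (simp add: wild_sum_def)

lemma wild_sum_Prob1:
  assumes t: "0 \<le> t" shows "F t \<in> Prob1"
proof -
  let ?z = "1 - exp (- t)"
  have z: "0 \<le> ?z" "?z < 1" using t by auto
  have "integrable (F t) (\<lambda>v. 1 + norm v)"
  proof (rule integrableI_bounded)
    show "(\<lambda>v. 1 + norm v) \<in> borel_measurable (F t)"
      by (simp add: measurable_Prob[OF wild_sum_Prob[OF t]])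
    have nn: "(\<integral>\<^sup>+x. ennreal (1 + norm x) \<partial>Q n) = ennreal (1 + m n)" for n
      using Prob_weightedD(2)[OF wild_weighted[of n]] integral_weight[OF wild_Prob1, of n]
      by (subst nn_integral_eq_integral) auto
    have "(\<integral>\<^sup>+x. ennreal (norm (1 + norm x)) \<partial>F t) = (\<integral>\<^sup>+x. ennreal (1 + norm x) \<partial>F t)"
      by simp
    also have "\<dots> = (\<Sum>n. ennreal (exp (- t) * ?z ^ n) * ennreal (1 + m n))"
      unfolding wild_sum_def nn[symmetric] by (rule nn_integral_mixture) (auto simp: sets_wild)
    also have "\<dots> = (\<Sum>n. ennreal (exp (- t) * ((1 + m n) * ?z ^ n)))"
    proof (rule suminf_cong)
      fix n
      have "ennreal (exp (- t) * ?z ^ n) * ennreal (1 + m n) = ennreal (exp (- t) * ?z ^ n * (1 + m n))"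
        using z first_moment_nonneg[of "Q n"] by (intro ennreal_mult[symmetric] mult_nonneg_nonneg) auto
      then show "ennreal (exp (- t) * ?z ^ n) * ennreal (1 + m n) = ennreal (exp (- t) * ((1 + m n) * ?z ^ n))"
        by (simp only: mult_ac)
    qed
    also have "\<dots> = ennreal (\<Sum>n. exp (- t) * ((1 + m n) * ?z ^ n))"
    proof (rule suminf_ennreal2)
      show "0 \<le> exp (- t) * ((1 + m n) * ?z ^ n)" for n
        using z first_moment_nonneg[of "Q n"] by (intro mult_nonneg_nonneg) auto
      show "summable (\<lambda>n. exp (- t) * ((1 + m n) * ?z ^ n))"
        by (rule summable_mult[OF summable_weights[OF z]])
    qed
    also have "\<dots> < \<top>" by simp
    finally show "(\<integral>\<^sup>+x. ennreal (norm (1 + norm x)) \<partial>F t) < \<infinity>" by simp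
  qed
  then show ?thesis using wild_sum_Prob[OF t] by (simp add: Prob1_eq Prob_weighted_def)
qed

lemma integral_wild_sum:
  assumes \<psi>: "\<psi> \<in> dominated (\<lambda>v. 1 + norm v)" and t: "0 \<le> t"
  shows "(\<integral>x. \<psi> x \<partial>F t) = exp (- t) * (\<Sum>n. (\<integral>x. \<psi> x \<partial>Q n) * (1 - exp (- t)) ^ n)"
proof -
  let ?z = "1 - exp (- t)"
  have z: "0 \<le> ?z" "?z < 1" using t by auto
  have "integrable (F t) \<psi>"
    using dominated_integrable[OF \<psi>] wild_sum_Prob1[OF t] by (simp add: Prob1_eq)
  then have "(\<lambda>n. exp (- t) * ?z ^ n * (\<integral>x. \<psi> x \<partial>Q n)) sums (\<integral>x. \<psi> x \<partial>F t)"
    unfolding wild_sum_def using z by (intro integral_mixture sets_wild) auto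
  moreover have "(\<lambda>n. exp (- t) * ((\<integral>x. \<psi> x \<partial>Q n) * ?z ^ n)) sums (exp (- t) * (\<Sum>n. (\<integral>x. \<psi> x \<partial>Q n) * ?z ^ n))"
    using z by (intro sums_mult summable_sums summable_wild \<psi>) auto
  ultimately show ?thesis
    by (simp add: mult_ac sums_unique2)
qed

lemma nn_integral_bigain_mixture:
  assumes R: "\<And>n. R n \<in> Prob" and M: "mixture d R \<in> Prob" and f: "f \<in> borel_measurable borel"
  shows "(\<integral>\<^sup>+x. f x \<partial>bigain c B (mixture d R) (mixture d R)) =
    (\<Sum>j. \<Sum>k. ennreal (d j) * ennreal (d k) * (\<integral>\<^sup>+x. f x \<partial>bigain c B (R j) (R k)))"
proof -
  note [measurable] = f
  have sets: "sets (R n) = sets borel" for n by (rule ProbD(2)[OF R])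
  let ?\<Phi> = "\<lambda>v w. \<integral>\<^sup>+\<theta>. f (c v w \<theta>) \<partial>B"
  have m1 [measurable]: "(\<lambda>(v, w). ?\<Phi> v w) \<in> borel_measurable (borel \<Otimes>\<^sub>M borel)"
    by measurable
  have m2: "(\<lambda>w. ?\<Phi> v w) \<in> borel_measurable borel" for v
    by measurable
  have m3: "(\<lambda>v. \<integral>\<^sup>+w. ?\<Phi> v w \<partial>R k) \<in> borel_measurable borel" for k
  proof -
    interpret prob_space "R k" by (rule ProbD[OF R])
    note [measurable_cong] = sets[of k]
    show ?thesis by measurable
  qed
  have "(\<integral>\<^sup>+x. f x \<partial>bigain c B (mixture d R) (mixture d R))
      = (\<integral>\<^sup>+v. \<integral>\<^sup>+w. ?\<Phi> v w \<partial>mixture d R \<partial>mixture d R)"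
    by (rule nn_integral_bigain[OF M M f])
  also have "\<dots> = (\<integral>\<^sup>+v. (\<Sum>k. ennreal (d k) * (\<integral>\<^sup>+w. ?\<Phi> v w \<partial>R k)) \<partial>mixture d R)"
    by (simp only: nn_integral_mixture[OF sets m2])
  also have "\<dots> = (\<Sum>j. ennreal (d j) * (\<integral>\<^sup>+v. (\<Sum>k. ennreal (d k) * (\<integral>\<^sup>+w. ?\<Phi> v w \<partial>R k)) \<partial>R j))"
    using m3 by (intro nn_integral_mixture sets) auto
  also have "\<dots> = (\<Sum>j. \<Sum>k. ennreal (d j) * ennreal (d k) * (\<integral>\<^sup>+v. \<integral>\<^sup>+w. ?\<Phi> v w \<partial>R k \<partial>R j))"
    using m3
    by (simp add: nn_integral_suminf nn_integral_cmult measurable_cong_sets[OF sets refl]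
        mult.assoc flip: ennreal_suminf_cmult)
  also have "\<dots> = (\<Sum>j. \<Sum>k. ennreal (d j) * ennreal (d k) * (\<integral>\<^sup>+x. f x \<partial>bigain c B (R j) (R k)))"
    by (simp only: nn_integral_bigain[OF R R f])
  finally show ?thesis .
qed

lemma suminf_triangle:
  fixes h :: "nat \<Rightarrow> nat \<Rightarrow> ennreal"
  shows "(\<Sum>j. \<Sum>k. h j k) = (\<Sum>n. \<Sum>j\<le>n. h j (n - j))"
proof -
  have "(\<Sum>k. h j k) = (\<Sum>n. if j \<le> n then h j (n - j) else 0)" for j
    using suminf_offset[of "\<lambda>n. if j \<le> n then h j (n - j) else 0" j] by simp
  then have "(\<Sum>j. \<Sum>k. h j k) = (\<Sum>n. \<Sum>j. if j \<le> n then h j (n - j) else 0)"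
    by (simp add: suminf_ennreal_swap[of "\<lambda>j n. if j \<le> n then h j (n - j) else 0"])
  also have "\<dots> = (\<Sum>n. \<Sum>j\<le>n. h j (n - j))"
  proof (rule suminf_cong)
    show "(\<Sum>j. if j \<le> n then h j (n - j) else 0) = (\<Sum>j\<le>n. h j (n - j))" for n
      by (subst suminf_finite[of "{..n}"]) auto
  qed
  finally show ?thesis .
qed

text \<open>Expanding both arguments gives the weights \<open>e\<^sup>-\<^sup>2\<^sup>t z\<^sup>j\<^sup>+\<^sup>k\<close> with \<open>z = 1 - e\<^sup>-\<^sup>t\<close>, which are constant
along the antidiagonals; the sum over the \<open>n\<close>th antidiagonal is \<open>(n + 1) Q\<^sub>n\<^sub>+\<^sub>1\<close> by the recursion
for the Wild terms.\<close>

lemma bigain_wild_sum: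
  assumes t: "0 \<le> t"
  shows "bigain c B (F t) (F t) =
    mixture (\<lambda>n. exp (- t) * exp (- t) * (1 - exp (- t)) ^ n * real (Suc n)) (\<lambda>n. Q (Suc n))"
    (is "?L = ?R")
proof (rule measure_eqI)
  let ?z = "1 - exp (- t)"
  let ?d = "\<lambda>n. exp (- t) * ?z ^ n"
  have z: "0 \<le> ?z" using t by auto
  fix A assume "A \<in> sets ?L"
  then have A: "A \<in> sets borel" by simp
  let ?G = "\<lambda>j k. emeasure (bigain c B (Q j) (Q k)) A"
  have one: "ennreal (real (Suc n)) * emeasure (Q (Suc n)) A = (\<Sum>j\<le>n. ?G j (n - j))" for n
  proof -
    have "emeasure (Q (Suc n)) A = ennreal (1 / real (Suc n)) * (\<Sum>j\<le>n. ?G j (n - j))"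
      using nn_integral_wild_Suc[OF wild_Prob, of "indicator A" n] A
      by (simp add: sets_wild sum_distrib_left del: wild.simps)
    then have "ennreal (real (Suc n)) * emeasure (Q (Suc n)) A
        = (ennreal (real (Suc n)) * ennreal (1 / real (Suc n))) * (\<Sum>j\<le>n. ?G j (n - j))"
      by (simp only: mult.assoc)
    also have "ennreal (real (Suc n)) * ennreal (1 / real (Suc n)) = 1"
      by (subst ennreal_mult[symmetric]) auto
    finally show ?thesis by simp
  qed
  have "emeasure ?L A = (\<Sum>j. \<Sum>k. ennreal (?d j) * ennreal (?d k) * ?G j k)"
    using nn_integral_bigain_mixture[OF wild_Prob wild_sum_Prob[OF t, unfolded wild_sum_def], of "indicator A"] A
    by (simp add: wild_sum_def)
  also have "\<dots> = (\<Sum>n. \<Sum>j\<le>n. ennreal (?d j) * ennreal (?d (n - j)) * ?G j (n - j))"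
    by (rule suminf_triangle)
  also have "\<dots> = (\<Sum>n. ennreal (exp (- t) * exp (- t) * ?z ^ n) * (\<Sum>j\<le>n. ?G j (n - j)))"
  proof (intro suminf_cong)
    fix n
    have "ennreal (?d j) * ennreal (?d (n - j)) = ennreal (exp (- t) * exp (- t) * ?z ^ n)" if "j \<le> n" for j
    proof -
      have "?z ^ n = ?z ^ j * ?z ^ (n - j)" using that by (simp flip: power_add)
      then show ?thesis
        using z by (simp add: ennreal_mult[symmetric] mult_ac)
    qed
    then show "(\<Sum>j\<le>n. ennreal (?d j) * ennreal (?d (n - j)) * ?G j (n - j))
        = ennreal (exp (- t) * exp (- t) * ?z ^ n) * (\<Sum>j\<le>n. ?G j (n - j))"
      by (simp add: sum_distrib_left)
  qed
  also have "\<dots> = (\<Sum>n. ennreal (exp (- t) * exp (- t) * ?z ^ n * real (Suc n)) * emeasure (Q (Suc n)) A)"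
    unfolding one[symmetric] mult.assoc[symmetric]
    using z by (subst ennreal_mult[symmetric]) (auto simp del: wild.simps)
  also have "\<dots> = emeasure ?R A"
    using A by (subst emeasure_mixture) (auto simp: sets_wild simp del: wild.simps)
  finally show "emeasure ?L A = emeasure ?R A" .
qed simp

text \<open>With \<open>H(z) = \<Sum>\<^sub>n z\<^sup>n \<integral>\<psi> dQ\<^sub>n\<close> the integral is \<open>e\<^sup>-\<^sup>t H(1 - e\<^sup>-\<^sup>t)\<close>. Its derivative
\<open>e\<^sup>-\<^sup>2\<^sup>t H'(1 - e\<^sup>-\<^sup>t) - e\<^sup>-\<^sup>t H(1 - e\<^sup>-\<^sup>t)\<close> is the gain minus the loss, since the coefficients of
\<open>H'\<close> are the weights in \<open>bigain_wild_sum\<close>.\<close>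

theorem wild_sum_derivative:
  assumes \<psi>: "\<psi> \<in> dominated (\<lambda>v. 1 + norm v)" and t: "0 \<le> t"
  shows "((\<lambda>s. \<integral>x. \<psi> x \<partial>F s) has_real_derivative
     (\<integral>x. \<psi> x \<partial>bigain c B (F t) (F t)) - (\<integral>x. \<psi> x \<partial>F t)) (at t within {0..})"
proof -
  let ?q = "\<lambda>n. \<integral>x. \<psi> x \<partial>Q n" and ?z = "1 - exp (- t)"
  have z: "0 \<le> ?z" "?z < 1" "\<bar>?z\<bar> < 1" using t by auto
  let ?H = "\<lambda>z. \<Sum>n. ?q n * z ^ n" and ?H' = "\<Sum>n. diffs ?q n * ?z ^ n"
  have H: "(?H has_real_derivative ?H') (at ?z)"
    using z by (intro termdiffs_strong'[of 1]) (auto intro: summable_wild \<psi>)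
  have "((\<lambda>s. exp (- s) * ?H (1 - exp (- s))) has_real_derivative
      (- exp (- t)) * ?H ?z + (?H' * exp (- t)) * exp (- t)) (at t)"
    by (rule DERIV_mult[OF _ DERIV_chain2[where f = ?H and g = "\<lambda>s. 1 - exp (- s)", OF H]])
       (auto intro!: derivative_eq_intros)
  then have "((\<lambda>s. exp (- s) * ?H (1 - exp (- s))) has_real_derivative
      exp (- t) * exp (- t) * ?H' - exp (- t) * ?H ?z) (at t within {0..})"
    by (simp add: has_field_derivative_at_within mult_ac)
  then have *: "((\<lambda>s. \<integral>x. \<psi> x \<partial>F s) has_real_derivative
      exp (- t) * exp (- t) * ?H' - exp (- t) * ?H ?z) (at t within {0..})"
    by (rule has_field_derivative_transform_within[where d = 1])
       (use t in \<open>auto simp: integral_wild_sum[OF \<psi>]\<close>)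
  have "integrable (bigain c B (F t) (F t)) \<psi>"
    using W.bigain_integrable[OF _ _ \<psi>] wild_sum_Prob1[OF t] by (simp add: Prob1_eq)
  then have "(\<lambda>n. exp (- t) * exp (- t) * ?z ^ n * real (Suc n) * ?q (Suc n))
      sums (\<integral>x. \<psi> x \<partial>bigain c B (F t) (F t))"
    unfolding bigain_wild_sum[OF t] using z by (intro integral_mixture sets_wild) auto
  moreover have "(\<lambda>n. exp (- t) * exp (- t) * (diffs ?q n * ?z ^ n)) sums (exp (- t) * exp (- t) * ?H')"
  proof (intro sums_mult summable_sums)
    show "summable (\<lambda>n. diffs ?q n * ?z ^ n)"
      using z by (intro termdiff_converges[of _ 1]) (auto intro: summable_wild \<psi>)
  qed
  ultimately have "(\<integral>x. \<psi> x \<partial>bigain c B (F t) (F t)) = exp (- t) * exp (- t) * ?H'"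
    by (intro sums_unique2) (auto simp: diffs_def mult_ac simp del: wild.simps)
  then show ?thesis using * integral_wild_sum[OF \<psi> t] by simp
qed

lemma wild_sum_0: "F 0 = f0"
proof (rule measure_eqI)
  fix A assume "A \<in> sets (F 0)"
  then have "A \<in> sets borel" by (simp add: wild_sum_def)
  then have "emeasure (F 0) A = (\<Sum>n. ennreal (0 ^ n) * emeasure (Q n) A)"
    unfolding wild_sum_def by (subst emeasure_mixture) (auto simp: sets_wild)
  also have "\<dots> = emeasure f0 A"
    by (subst suminf_finite[of "{0}"]) auto
  finally show "emeasure (F 0) A = emeasure f0 A" .
qed (simp add: wild_sum_def ProbD(2)[OF f0_Prob])

end

section \<open>Error of the explicit Euler scheme\<close>

context bounded_kernel
begin

text \<open>The right-hand side \<open>\<integral>\<psi> dQ(\<nu>, \<nu>)\<close> of the equation, tested with \<open>\<psi>\<close>.\<close>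

definition rate :: "('a \<Rightarrow> real) \<Rightarrow> 'a measure \<Rightarrow> real" where
  "rate \<psi> \<nu> = (\<integral>x. \<psi> x \<partial>bigain c B \<nu> \<nu>) - (\<integral>x. \<psi> x \<partial>\<nu>)"

lemma rate_bound:
  assumes \<psi>: "\<psi> \<in> dominated (\<lambda>v. 1 + norm v)" and \<nu>: "\<nu> \<in> Prob1" and A: "1 + first_moment \<nu> \<le> A"
  shows "\<bar>rate \<psi> \<nu>\<bar> \<le> 2 * (1 + a) * A + 1"
proof -
  have "\<bar>\<integral>x. \<psi> x \<partial>bigain c B \<nu> \<nu>\<bar> \<le> 1 + first_moment (bigain c B \<nu> \<nu>)"
    using dominated_integral_le[OF \<psi>] integral_weight bigain_Prob1[OF \<nu> \<nu>] by (metis Prob1_eq)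
  also have "\<dots> \<le> 1 + a * (first_moment \<nu> + first_moment \<nu>)"
    using first_moment_bigain[OF \<nu> \<nu>] by simp
  finally have 1: "\<bar>\<integral>x. \<psi> x \<partial>bigain c B \<nu> \<nu>\<bar> \<le> 1 + 2 * (a * first_moment \<nu>)"
    by (simp add: algebra_simps)
  have 2: "\<bar>\<integral>x. \<psi> x \<partial>\<nu>\<bar> \<le> 1 + first_moment \<nu>"
    using dominated_integral_le[OF \<psi>] integral_weight[OF \<nu>] \<nu> by (metis Prob1_eq)
  have "1 + 2 * (a * first_moment \<nu>) + (1 + first_moment \<nu>) \<le> 2 * (1 + a) * (1 + first_moment \<nu>) + 1"
    using a_nonneg first_moment_nonneg[of \<nu>] by (simp add: algebra_simps)
  also have "\<dots> \<le> 2 * (1 + a) * A + 1"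
    using A a_nonneg by (intro add_right_mono mult_left_mono) auto
  finally show ?thesis using 1 2 by (simp add: rate_def)
qed

lemma rate_stability:
  assumes \<psi>: "\<psi> \<in> dominated (\<lambda>v. 1 + norm v)" and \<mu>: "\<mu> \<in> Prob1" and \<nu>: "\<nu> \<in> Prob1"
    and A: "1 + first_moment \<mu> \<le> A" "1 + first_moment \<nu> \<le> A" and d: "tv_le (\<lambda>v. 1 + norm v) \<mu> \<nu> d"
  shows "\<bar>rate \<psi> \<mu> - rate \<psi> \<nu>\<bar> \<le> (2 * (1 + a) * A + 1) * d"
proof -
  have "tv_le (\<lambda>v. 1 + norm v) (bigain c B \<mu> \<mu>) (bigain c B \<nu> \<nu>) (2 * (1 + a) * A * d)"
    using \<mu> \<nu> A d by (intro W.bigain_stability) (simp_all add: Prob1_eq[symmetric] integral_weight)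
  from tv_leD[OF this \<psi>] tv_leD[OF d \<psi>] show ?thesis
    by (simp add: rate_def distrib_right)
qed

end

lemma first_moment_mix:
  assumes "\<mu> \<in> Prob1" "\<nu> \<in> Prob1" "0 \<le> s" "s \<le> 1"
  shows "first_moment (mix s \<mu> \<nu>) = (1 - s) * first_moment \<mu> + s * first_moment \<nu>"
  unfolding first_moment_def using assms by (intro integral_mix) (auto simp: Prob1_def dest: ProbD)

lemma mix_Prob:
  assumes "\<mu> \<in> Prob" "\<nu> \<in> Prob" "0 \<le> s" "s \<le> 1"
  shows "mix s \<mu> \<nu> \<in> Prob"
proof (rule ProbI)
  have "emeasure (mix s \<mu> \<nu>) UNIV = ennreal (1 - s) + ennreal s"
    using ProbD[OF assms(1)] ProbD[OF assms(2)] by (subst emeasure_mix) auto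
  also have "\<dots> = ennreal (1 - s + s)"
    using assms by (intro ennreal_plus[symmetric]) auto
  finally show "emeasure (mix s \<mu> \<nu>) UNIV = 1" by simp
qed simp

lemma mix_Prob1:
  assumes "\<mu> \<in> Prob1" "\<nu> \<in> Prob1" "0 \<le> s" "s \<le> 1"
  shows "mix s \<mu> \<nu> \<in> Prob1"
  using assms mix_Prob[of \<mu> \<nu> s] by (auto simp: Prob1_def intro!: integrable_mix dest: ProbD)

locale wild_horizon = wild_kernel B c a f0
  for B :: "'p measure" and c :: "'a::euclidean_space \<Rightarrow> 'a \<Rightarrow> 'p \<Rightarrow> 'a" and a f0 +
  fixes T :: real
  assumes T: "0 < T"
begin

text \<open>\<open>A\<close> bounds the weighted mass \<open>1 + m\<^sub>1\<close> of the solution and of the Euler iterates up to time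
\<open>T\<close>; on measures with this bound, \<open>\<Lambda>\<close> bounds the right-hand side and is a Lipschitz constant
for it.\<close>

definition A :: real where "A = 1 + first_moment f0 * exp (2 * a * T)"
definition \<Lambda> :: real where "\<Lambda> = 2 * (1 + a) * A + 1"

definition error_constant :: real where
  "error_constant = (1 + \<Lambda>) * (T * \<Lambda>\<^sup>2 * exp (\<Lambda> * T)) + \<Lambda>\<^sup>2"

lemma A_ge_1: "1 \<le> A"
  by (simp add: A_def first_moment_nonneg)

lemma \<Lambda>_ge_1: "1 \<le> \<Lambda>"
  using A_ge_1 a_nonneg by (simp add: \<Lambda>_def)

lemma derivative_F:
  assumes "\<psi> \<in> dominated (\<lambda>v. 1 + norm v)" "0 \<le> t"
  shows "((\<lambda>s. \<integral>x. \<psi> x \<partial>F s) has_real_derivative rate \<psi> (F t)) (at t within {0..})"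
  unfolding rate_def by (rule wild_sum_derivative[OF assms])

text \<open>Gronwall's inequality: \<open>m\<^sub>1' \<le> 2a m\<^sub>1\<close>, since a collision outcome has norm at most \<open>a(|v| + |w|)\<close>.\<close>

lemma F_moment:
  assumes t: "0 \<le> t" "t \<le> T"
  shows "1 + first_moment (F t) \<le> A"
proof -
  let ?y = "\<lambda>s. \<integral>x. norm x \<partial>F s"
  let ?g = "\<lambda>s. ?y s * exp (- (2 * a * s))"
  have der: "(?g has_real_derivative rate norm (F s) * exp (- (2 * a * s))
      + (exp (- (2 * a * s)) * (- (2 * a))) * ?y s) (at s within {0..})" if "0 \<le> s" for s
    by (rule DERIV_mult[OF derivative_F[OF norm_dominated that]])
       (auto intro!: derivative_eq_intros)
  have "?g t \<le> ?g 0"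
  proof (rule DERIV_nonpos_imp_decreasing_open[OF t(1)])
    fix s assume s: "0 < s" "s < t"
    have "rate norm (F s) \<le> 2 * a * ?y s"
    proof -
      have "(\<integral>x. norm x \<partial>bigain c B (F s) (F s)) \<le> a * (?y s + ?y s)"
        using first_moment_bigain[OF wild_sum_Prob1 wild_sum_Prob1, of s s] s by (simp add: first_moment_def)
      moreover have "a * (?y s + ?y s) = 2 * a * ?y s" by simp
      moreover have "0 \<le> ?y s" by simp
      ultimately show ?thesis unfolding rate_def by linarith
    qed
    then have "rate norm (F s) * exp (- (2 * a * s)) \<le> (2 * a * ?y s) * exp (- (2 * a * s))"
      by (intro mult_right_mono) auto
    moreover have "(?g has_real_derivative rate norm (F s) * exp (- (2 * a * s))
      + (exp (- (2 * a * s)) * (- (2 * a))) * ?y s) (at s)"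
      using der[of s] s at_within_interior[of s "{0..}"] by simp
    ultimately show "\<exists>y. (?g has_real_derivative y) (at s) \<and> y \<le> 0"
      by (intro exI conjI) (assumption, simp add: mult_ac)
  next
    have "continuous_on {0..} ?g"
      using der by (auto simp: continuous_on_eq_continuous_within intro: DERIV_continuous)
    then show "continuous_on {0..t} ?g" by (rule continuous_on_subset) auto
  qed
  then have "?y t * exp (- (2 * a * t)) * exp (2 * a * t) \<le> first_moment f0 * exp (2 * a * t)"
    by (intro mult_right_mono) (auto simp: wild_sum_0 first_moment_def)
  then have "?y t \<le> first_moment f0 * exp (2 * a * t)"
    by (simp add: mult.assoc flip: exp_add)
  also have "\<dots> \<le> first_moment f0 * exp (2 * a * T)"
    using t a_nonneg by (intro mult_left_mono first_moment_nonneg) (auto intro: mult_left_mono)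
  finally show ?thesis by (simp add: A_def first_moment_def)
qed

lemma F_lipschitz_test:
  assumes \<psi>: "\<psi> \<in> dominated (\<lambda>v. 1 + norm v)" and st: "s \<in> {0..T}" "t \<in> {0..T}"
  shows "\<bar>(\<integral>x. \<psi> x \<partial>F s) - (\<integral>x. \<psi> x \<partial>F t)\<bar> \<le> \<Lambda> * \<bar>s - t\<bar>"
proof -
  have "norm ((\<integral>x. \<psi> x \<partial>F s) - (\<integral>x. \<psi> x \<partial>F t)) \<le> \<Lambda> * norm (s - t)"
  proof (rule field_differentiable_bound[of "{0..T}" _ "\<lambda>s. rate \<psi> (F s)"])
    show "((\<lambda>s. \<integral>x. \<psi> x \<partial>F s) has_real_derivative rate \<psi> (F z)) (at z within {0..T})" if "z \<in> {0..T}" for z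
      using that by (intro has_field_derivative_subset[OF derivative_F[OF \<psi>]]) auto
    show "norm (rate \<psi> (F z)) \<le> \<Lambda>" if "z \<in> {0..T}" for z
      unfolding \<Lambda>_def real_norm_def using that by (intro rate_bound[OF \<psi>] wild_sum_Prob1 F_moment) auto
  qed (use st in auto)
  then show ?thesis by simp
qed

lemma F_lipschitz:
  "s \<in> {0..T} \<Longrightarrow> t \<in> {0..T} \<Longrightarrow> tv_le (\<lambda>v. 1 + norm v) (F s) (F t) (\<Lambda> * \<bar>s - t\<bar>)"
  using F_lipschitz_test by (simp add: tv_le_def)

text \<open>Along the solution the right-hand side is Lipschitz in time with constant \<open>\<Lambda>\<^sup>2\<close>: once \<open>\<Lambda>\<close> for the
speed of the solution, once \<open>\<Lambda>\<close> for the dependence of the right-hand side on the measure. This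
takes the place of a bound for the second derivative.\<close>

lemma F_taylor:
  assumes \<psi>: "\<psi> \<in> dominated (\<lambda>v. 1 + norm v)" and t: "0 \<le> t" "0 \<le> \<tau>" "t + \<tau> \<le> T"
  shows "\<bar>(\<integral>x. \<psi> x \<partial>F (t + \<tau>)) - (\<integral>x. \<psi> x \<partial>F t) - \<tau> * rate \<psi> (F t)\<bar> \<le> \<Lambda>\<^sup>2 * \<tau>\<^sup>2"
proof -
  let ?u = "\<lambda>s. (\<integral>x. \<psi> x \<partial>F s) - s * rate \<psi> (F t)"
  have "norm (?u (t + \<tau>) - ?u t) \<le> (\<Lambda> * (\<Lambda> * \<tau>)) * norm (t + \<tau> - t)"
  proof (rule field_differentiable_bound[of "{t..t + \<tau>}" _ "\<lambda>s. rate \<psi> (F s) - rate \<psi> (F t)"])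
    fix z assume z: "z \<in> {t..t + \<tau>}"
    then have "((\<lambda>s. \<integral>x. \<psi> x \<partial>F s) has_real_derivative rate \<psi> (F z)) (at z within {t..t + \<tau>})"
      using t by (intro has_field_derivative_subset[OF derivative_F[OF \<psi>]]) auto
    then show "(?u has_real_derivative rate \<psi> (F z) - rate \<psi> (F t)) (at z within {t..t + \<tau>})"
      by (auto intro!: derivative_eq_intros)
    have "\<bar>rate \<psi> (F z) - rate \<psi> (F t)\<bar> \<le> \<Lambda> * (\<Lambda> * \<bar>z - t\<bar>)"
      unfolding \<Lambda>_def[of] using z t
      by (intro rate_stability[OF \<psi>] wild_sum_Prob1 F_moment F_lipschitz[unfolded \<Lambda>_def]) auto
    also have "\<dots> \<le> \<Lambda> * (\<Lambda> * \<tau>)"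
      using z \<Lambda>_ge_1 by (intro mult_left_mono) auto
    finally show "norm (rate \<psi> (F z) - rate \<psi> (F t)) \<le> \<Lambda> * (\<Lambda> * \<tau>)" by simp
  qed (use t in auto)
  then show ?thesis
    using t by (simp add: algebra_simps power2_eq_square)
qed

end

text \<open>The iteration in terms of the bilinear gain term. Its interpolant on a grid cell is described by the
cell number \<open>n\<close> and the relative position \<open>s\<close> in the cell.\<close>

locale euler_scheme = wild_horizon B c a f0 T
  for B :: "'p measure" and c :: "'a::euclidean_space \<Rightarrow> 'a \<Rightarrow> 'p \<Rightarrow> 'a" and a f0 T +
  fixes \<mu> :: "nat \<Rightarrow> 'a measure" and h :: real
  assumes \<mu>_0: "\<mu> 0 = f0" and \<mu>_Suc: "\<And>n. \<mu> (Suc n) = mix h (\<mu> n) (bigain c B (\<mu> n) (\<mu> n))"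
    and h: "0 < h" "h < 1"
begin

lemma \<mu>_Prob1: "\<mu> n \<in> Prob1"
  by (induction n) (use h in \<open>auto simp: \<mu>_0 \<mu>_Suc f0 intro!: mix_Prob1 bigain_Prob1\<close>)

lemma \<mu>_moment:
  assumes "real n * h \<le> T"
  shows "1 + first_moment (\<mu> n) \<le> A"
proof -
  have "first_moment (\<mu> n) \<le> first_moment f0 * exp (2 * a * h) ^ n"
  proof (induction n)
    case (Suc n)
    have "first_moment (\<mu> (Suc n)) = (1 - h) * first_moment (\<mu> n) + h * first_moment (bigain c B (\<mu> n) (\<mu> n))"
      using h unfolding \<mu>_Suc by (intro first_moment_mix \<mu>_Prob1 bigain_Prob1) auto
    also have "\<dots> \<le> 1 * first_moment (\<mu> n) + h * (a * (first_moment (\<mu> n) + first_moment (\<mu> n)))"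
      using h by (intro add_mono mult_right_mono mult_left_mono first_moment_bigain \<mu>_Prob1 first_moment_nonneg) auto
    also have "\<dots> = (1 + 2 * a * h) * first_moment (\<mu> n)"
      by (simp add: algebra_simps)
    also have "\<dots> \<le> exp (2 * a * h) * (first_moment f0 * exp (2 * a * h) ^ n)"
      using Suc h a_nonneg by (intro mult_mono exp_ge_add_one_self first_moment_nonneg) auto
    finally show ?case by (simp add: mult_ac)
  qed (simp add: \<mu>_0)
  also have "exp (2 * a * h) ^ n = exp (2 * a * (real n * h))"
    by (simp add: exp_of_nat_mult[symmetric] mult_ac)
  also have "first_moment f0 * exp (2 * a * (real n * h)) \<le> first_moment f0 * exp (2 * a * T)"
    using assms a_nonneg by (intro mult_left_mono first_moment_nonneg) (auto intro: mult_left_mono)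
  finally show ?thesis by (simp add: A_def)
qed

definition interp :: "nat \<Rightarrow> real \<Rightarrow> 'a measure" where
  "interp n s = mix s (\<mu> n) (\<mu> (Suc n))"

lemma interp_Prob1: "0 \<le> s \<Longrightarrow> s \<le> 1 \<Longrightarrow> interp n s \<in> Prob1"
  unfolding interp_def by (intro mix_Prob1 \<mu>_Prob1)

lemma integral_interp:
  assumes \<psi>: "\<psi> \<in> dominated (\<lambda>v. 1 + norm v)" and s: "0 \<le> s" "s \<le> 1"
  shows "(\<integral>x. \<psi> x \<partial>interp n s) = (\<integral>x. \<psi> x \<partial>\<mu> n) + s * h * rate \<psi> (\<mu> n)"
proof -
  have int: "integrable \<nu> \<psi>" if "\<nu> \<in> Prob1" for \<nu>
    using dominated_integrable[OF \<psi>] that by (simp add: Prob1_eq)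
  have sets: "sets \<nu> = sets borel" if "\<nu> \<in> Prob1" for \<nu> :: "'a measure"
    using that ProbD(2) by (auto simp: Prob1_def)
  note G = bigain_Prob1[OF \<mu>_Prob1 \<mu>_Prob1, of n n]
  have "(\<integral>x. \<psi> x \<partial>\<mu> (Suc n)) = (1 - h) * (\<integral>x. \<psi> x \<partial>\<mu> n) + h * (\<integral>x. \<psi> x \<partial>bigain c B (\<mu> n) (\<mu> n))"
    unfolding \<mu>_Suc using h by (intro integral_mix sets int G \<mu>_Prob1) auto
  moreover have "(\<integral>x. \<psi> x \<partial>interp n s) = (1 - s) * (\<integral>x. \<psi> x \<partial>\<mu> n) + s * (\<integral>x. \<psi> x \<partial>\<mu> (Suc n))"
    unfolding interp_def using s by (intro integral_mix sets int \<mu>_Prob1) auto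
  ultimately have "(\<integral>x. \<psi> x \<partial>interp n s) = (1 - s) * (\<integral>x. \<psi> x \<partial>\<mu> n)
      + s * ((1 - h) * (\<integral>x. \<psi> x \<partial>\<mu> n) + h * (\<integral>x. \<psi> x \<partial>bigain c B (\<mu> n) (\<mu> n)))"
    by (simp only:)
  then show ?thesis by (simp add: rate_def algebra_simps)
qed

text \<open>The new error consists of the old one, the change of the right-hand side that the old error causes
during time \<open>s h\<close>, and the Taylor remainder.\<close>

lemma local_error:
  assumes e: "tv_le (\<lambda>v. 1 + norm v) (\<mu> n) (F (real n * h)) e"
    and s: "0 \<le> s" "s \<le> 1" "real n * h + s * h \<le> T"
  shows "tv_le (\<lambda>v. 1 + norm v) (interp n s) (F (real n * h + s * h)) ((1 + \<Lambda> * (s * h)) * e + \<Lambda>\<^sup>2 * (s * h)\<^sup>2)"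
  unfolding tv_le_def
proof
  fix \<psi> :: "'a \<Rightarrow> real" assume \<psi>: "\<psi> \<in> dominated (\<lambda>v. 1 + norm v)"
  let ?t = "real n * h" and ?\<tau> = "s * h"
  have t: "0 \<le> ?t" "0 \<le> ?\<tau>" "?t \<le> T" using h s by (auto intro: add_le_imp_le_left order_trans[rotated])
  have 1: "\<bar>(\<integral>x. \<psi> x \<partial>\<mu> n) - (\<integral>x. \<psi> x \<partial>F ?t)\<bar> \<le> e"
    by (rule tv_leD[OF e \<psi>])
  have "\<bar>rate \<psi> (\<mu> n) - rate \<psi> (F ?t)\<bar> \<le> \<Lambda> * e"
    unfolding \<Lambda>_def using t by (intro rate_stability[OF \<psi>] \<mu>_Prob1 wild_sum_Prob1 \<mu>_moment F_moment e)
  then have "\<bar>?\<tau>\<bar> * \<bar>rate \<psi> (\<mu> n) - rate \<psi> (F ?t)\<bar> \<le> ?\<tau> * (\<Lambda> * e)"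
    using t by (intro mult_mono) auto
  then have 2: "\<bar>?\<tau> * rate \<psi> (\<mu> n) - ?\<tau> * rate \<psi> (F ?t)\<bar> \<le> \<Lambda> * ?\<tau> * e"
    by (simp only: abs_mult[symmetric] right_diff_distrib mult_ac)
  have 3: "\<bar>(\<integral>x. \<psi> x \<partial>F (?t + ?\<tau>)) - (\<integral>x. \<psi> x \<partial>F ?t) - ?\<tau> * rate \<psi> (F ?t)\<bar> \<le> \<Lambda>\<^sup>2 * ?\<tau>\<^sup>2"
    using t s by (intro F_taylor[OF \<psi>]) auto
  show "\<bar>(\<integral>x. \<psi> x \<partial>interp n s) - (\<integral>x. \<psi> x \<partial>F (?t + ?\<tau>))\<bar> \<le> (1 + \<Lambda> * ?\<tau>) * e + \<Lambda>\<^sup>2 * ?\<tau>\<^sup>2"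
    unfolding integral_interp[OF \<psi> s(1,2)] distrib_right mult_1_left using 1 2 3 by linarith
qed

lemma interp_1: "\<psi> \<in> dominated (\<lambda>v. 1 + norm v) \<Longrightarrow> (\<integral>x. \<psi> x \<partial>interp n 1) = (\<integral>x. \<psi> x \<partial>\<mu> (Suc n))"
  unfolding interp_def using \<mu>_Prob1
  by (subst integral_mix) (auto intro: dominated_integrable simp: Prob1_eq Prob_weighted_def ProbD)

lemma global_error:
  assumes "real n * h \<le> T"
  shows "tv_le (\<lambda>v. 1 + norm v) (\<mu> n) (F (real n * h)) (real n * (\<Lambda>\<^sup>2 * h\<^sup>2) * (1 + \<Lambda> * h) ^ n)"
  using assms
proof (induction n)
  case 0
  then show ?case by (simp add: tv_le_def \<mu>_0 wild_sum_0)
next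
  case (Suc n)
  let ?e = "real n * (\<Lambda>\<^sup>2 * h\<^sup>2) * (1 + \<Lambda> * h) ^ n"
  have nh: "real n * h + 1 * h \<le> T" "real n * h + 1 * h = real (Suc n) * h"
    using Suc.prems by (auto simp: algebra_simps)
  then have "real n * h \<le> T" using h by linarith
  from local_error[OF Suc.IH[OF this], of 1] nh
  have "tv_le (\<lambda>v. 1 + norm v) (interp n 1) (F (real (Suc n) * h)) ((1 + \<Lambda> * h) * ?e + \<Lambda>\<^sup>2 * h\<^sup>2)"
    by simp
  moreover have "(1 + \<Lambda> * h) * ?e + \<Lambda>\<^sup>2 * h\<^sup>2 \<le> real (Suc n) * (\<Lambda>\<^sup>2 * h\<^sup>2) * (1 + \<Lambda> * h) ^ Suc n"
  proof -
    have "1 \<le> (1 + \<Lambda> * h) ^ Suc n"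
      using \<Lambda>_ge_1 h by (intro one_le_power) auto
    then have "\<Lambda>\<^sup>2 * h\<^sup>2 * 1 \<le> \<Lambda>\<^sup>2 * h\<^sup>2 * (1 + \<Lambda> * h) ^ Suc n"
      by (intro mult_left_mono) auto
    then show ?thesis by (simp add: algebra_simps)
  qed
  ultimately show ?case
    by (auto simp: tv_le_def interp_1 intro: order_trans)
qed

theorem interp_error:
  assumes s: "0 \<le> s" "s \<le> 1" "real n * h + s * h \<le> T"
  shows "tv_le (\<lambda>v. 1 + norm v) (interp n s) (F (real n * h + s * h)) (error_constant * h)"
proof -
  let ?e = "real n * (\<Lambda>\<^sup>2 * h\<^sup>2) * (1 + \<Lambda> * h) ^ n"
  have nh: "real n * h \<le> T" using s h by (meson add_increasing2 mult_nonneg_nonneg less_imp_le order_trans order_refl)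
  have L: "1 \<le> \<Lambda>" by (rule \<Lambda>_ge_1)
  have "(1 + \<Lambda> * h) ^ n \<le> exp (\<Lambda> * h) ^ n"
    using L h by (intro power_mono exp_ge_add_one_self) auto
  also have "\<dots> = exp (\<Lambda> * (real n * h))"
    by (simp add: exp_of_nat_mult[symmetric] mult_ac)
  also have "\<dots> \<le> exp (\<Lambda> * T)"
    using nh L by simp
  finally have "?e \<le> real n * (\<Lambda>\<^sup>2 * h\<^sup>2) * exp (\<Lambda> * T)"
    by (intro mult_left_mono) auto
  also have "\<dots> = (real n * h) * (\<Lambda>\<^sup>2 * exp (\<Lambda> * T) * h)"
    by (simp add: power2_eq_square mult_ac)
  also have "\<dots> \<le> T * (\<Lambda>\<^sup>2 * exp (\<Lambda> * T) * h)"
    using nh h by (intro mult_right_mono) auto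
  finally have e: "?e \<le> (T * \<Lambda>\<^sup>2 * exp (\<Lambda> * T)) * h" by (simp add: mult_ac)
  have "s * h \<le> 1 * h"
    using s h by (intro mult_right_mono) auto
  then have sh: "s * h \<le> 1" "0 \<le> s * h" "s * h \<le> h"
    using s h by (linarith, simp, linarith)
  have "(1 + \<Lambda> * (s * h)) * ?e \<le> (1 + \<Lambda> * 1) * ((T * \<Lambda>\<^sup>2 * exp (\<Lambda> * T)) * h)"
    using L h by (intro mult_mono[OF _ e] add_left_mono mult_left_mono sh(1)) auto
  moreover have "\<Lambda>\<^sup>2 * (s * h)\<^sup>2 \<le> \<Lambda>\<^sup>2 * h"
  proof -
    have "(s * h)\<^sup>2 \<le> h * 1"
      unfolding power2_eq_square using sh(2) h by (intro mult_mono sh(1,3)) auto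
    then show ?thesis by (intro mult_left_mono) auto
  qed
  ultimately have "(1 + \<Lambda> * (s * h)) * ?e + \<Lambda>\<^sup>2 * (s * h)\<^sup>2 \<le> error_constant * h"
    by (simp add: error_constant_def algebra_simps)
  with local_error[OF global_error[OF nh] s] show ?thesis
    by (auto simp: tv_le_def intro: order_trans)
qed

definition euler_path :: "real \<Rightarrow> 'a measure" where
  "euler_path t = (let n = nat \<lfloor>t / h\<rfloor> in interp n ((t - real n * h) / h))"

lemma grid:
  assumes "0 \<le> t"
  defines "n \<equiv> nat \<lfloor>t / h\<rfloor>"
  shows "0 \<le> (t - real n * h) / h" "(t - real n * h) / h \<le> 1" "real n * h \<le> t" "t < real (Suc n) * h"
    "real n * h + (t - real n * h) / h * h = t" "(t - real n * h) / h * h = t - real n * h"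
proof -
  have "0 \<le> t / h" using assms h by simp
  then have n: "real n \<le> t / h" "t / h < real n + 1" unfolding n_def by linarith+
  then show 1: "real n * h \<le> t" "t < real (Suc n) * h" using h by (auto simp: field_simps)
  then show "0 \<le> (t - real n * h) / h" "(t - real n * h) / h \<le> 1" using h by (auto simp: field_simps)
  show "real n * h + (t - real n * h) / h * h = t" "(t - real n * h) / h * h = t - real n * h" using h by auto
qed

lemma euler_path_Prob1: "0 \<le> t \<Longrightarrow> euler_path t \<in> Prob1"
  unfolding euler_path_def Let_def by (intro interp_Prob1 grid)

lemma euler_path_error:
  assumes "t \<in> {0..T}"
  shows "tv_le (\<lambda>v. 1 + norm v) (euler_path t) (F t) (error_constant * h)"
proof -
  let ?n = "nat \<lfloor>t / h\<rfloor>"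
  have t: "0 \<le> t" "t \<le> T" using assms by auto
  note g = grid[OF t(1)]
  show ?thesis
    using interp_error[OF g(1,2), of ?n] t(2) unfolding g(5) by (simp add: euler_path_def Let_def)
qed

text \<open>The piecewise linear interpolant as a sum over grid cells: cell \<open>k\<close> contributes its slope times
the time spent in it, which is a 1-Lipschitz function of \<open>t\<close>. In this form Lipschitz continuity
requires no distinction of whether two times share a cell.\<close>

lemma integral_euler_path:
  assumes \<psi>: "\<psi> \<in> dominated (\<lambda>v. 1 + norm v)" and t: "0 \<le> t" "t < real N * h"
  shows "(\<integral>x. \<psi> x \<partial>euler_path t) = (\<integral>x. \<psi> x \<partial>f0) +
    (\<Sum>k<N. min h (max 0 (t - real k * h)) * rate \<psi> (\<mu> k))"
proof -
  define n where "n = nat \<lfloor>t / h\<rfloor>"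
  note g = grid[OF t(1), folded n_def]
  have "real n * h < real N * h" using g(3) t(2) by linarith
  then have nN: "n < N" using h by simp
  have \<mu>_n: "(\<integral>x. \<psi> x \<partial>\<mu> n) = (\<integral>x. \<psi> x \<partial>f0) + (\<Sum>k<n. h * rate \<psi> (\<mu> k))" for n
  proof (induction n)
    case (Suc n)
    then show ?case
      using interp_1[OF \<psi>, of n] integral_interp[OF \<psi>, of 1 n] by simp
  qed (simp add: \<mu>_0)
  have le: "real k * h + h \<le> real n * h" if "k < n" for k
  proof -
    have "real (Suc k) * h \<le> real n * h" using that h by (intro mult_right_mono) auto
    then show ?thesis by (simp add: algebra_simps)
  qed
  have ge: "t \<le> real k * h" if "n < k" for k
  proof -
    have "real (Suc n) * h \<le> real k * h" using that h by (intro mult_right_mono) auto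
    then show ?thesis using g(4) by simp
  qed
  have "(\<Sum>k<N. min h (max 0 (t - real k * h)) * rate \<psi> (\<mu> k))
      = (\<Sum>k<Suc n. min h (max 0 (t - real k * h)) * rate \<psi> (\<mu> k))"
  proof (rule sum.mono_neutral_right)
    show "\<forall>k\<in>{..<N} - {..<Suc n}. min h (max 0 (t - real k * h)) * rate \<psi> (\<mu> k) = 0"
    proof
      fix k assume "k \<in> {..<N} - {..<Suc n}"
      then have "t - real k * h \<le> 0" using ge[of k] by simp
      then show "min h (max 0 (t - real k * h)) * rate \<psi> (\<mu> k) = 0" using h by simp
    qed
  qed (use nN in auto)
  also have "\<dots> = (\<Sum>k<n. min h (max 0 (t - real k * h)) * rate \<psi> (\<mu> k))
      + min h (max 0 (t - real n * h)) * rate \<psi> (\<mu> n)" by simp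
  also have "min h (max 0 (t - real n * h)) = t - real n * h"
    using g(3,4) by (simp add: algebra_simps)
  also have "(\<Sum>k<n. min h (max 0 (t - real k * h)) * rate \<psi> (\<mu> k)) = (\<Sum>k<n. h * rate \<psi> (\<mu> k))"
  proof (intro sum.cong refl)
    fix k assume "k \<in> {..<n}"
    then have "h \<le> t - real k * h" using le[of k] g(3) by simp
    then show "min h (max 0 (t - real k * h)) * rate \<psi> (\<mu> k) = h * rate \<psi> (\<mu> k)" using h by simp
  qed
  finally show ?thesis
    using integral_interp[OF \<psi> g(1,2), of n, unfolded g(6)] \<mu>_n[of n]
    by (simp add: euler_path_def Let_def flip: n_def)
qed

lemma euler_path_lipschitz:
  obtains K where "0 \<le> K"
    "\<And>s t. s \<in> {0..T} \<Longrightarrow> t \<in> {0..T} \<Longrightarrow> tv_le (\<lambda>v. 1 + norm v) (euler_path s) (euler_path t) (K * \<bar>s - t\<bar>)"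
proof -
  define N where "N = Suc (nat \<lfloor>T / h\<rfloor>)"
  have N: "T < real N * h" "\<And>k. k < N \<Longrightarrow> real k * h \<le> T"
  proof -
    note g = grid[OF less_imp_le[OF T]]
    show "T < real N * h" using g(4) by (simp add: N_def)
    show "real k * h \<le> T" if "k < N" for k
    proof -
      have "real k * h \<le> real (nat \<lfloor>T / h\<rfloor>) * h" using that h by (intro mult_right_mono) (auto simp: N_def)
      then show ?thesis using g(3) by linarith
    qed
  qed
  have "tv_le (\<lambda>v. 1 + norm v) (euler_path s) (euler_path t) (real N * \<Lambda> * \<bar>s - t\<bar>)"
    if st: "s \<in> {0..T}" "t \<in> {0..T}" for s t
    unfolding tv_le_def
  proof
    fix \<psi> :: "'a \<Rightarrow> real" assume \<psi>: "\<psi> \<in> dominated (\<lambda>v. 1 + norm v)"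
    let ?m = "\<lambda>t k. min h (max 0 (t - real k * h))"
    have diff: "(\<integral>x. \<psi> x \<partial>euler_path s) - (\<integral>x. \<psi> x \<partial>euler_path t) = (\<Sum>k<N. (?m s k - ?m t k) * rate \<psi> (\<mu> k))"
      using st N(1) by (simp add: integral_euler_path[OF \<psi>, of _ N] left_diff_distrib sum_subtractf)
    have "\<bar>(\<integral>x. \<psi> x \<partial>euler_path s) - (\<integral>x. \<psi> x \<partial>euler_path t)\<bar>
        \<le> (\<Sum>k<N. \<bar>(?m s k - ?m t k) * rate \<psi> (\<mu> k)\<bar>)"
      unfolding diff by (rule sum_abs)
    also have "\<dots> \<le> (\<Sum>k<N. \<bar>s - t\<bar> * \<Lambda>)"
    proof (rule sum_mono)
      fix k assume k: "k \<in> {..<N}"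
      have "\<bar>?m s k - ?m t k\<bar> \<le> \<bar>s - t\<bar>"
        using h by (auto simp: min_def max_def)
      moreover have "\<bar>rate \<psi> (\<mu> k)\<bar> \<le> \<Lambda>"
        unfolding \<Lambda>_def using N(2) k by (intro rate_bound[OF \<psi>] \<mu>_Prob1 \<mu>_moment) auto
      ultimately show "\<bar>(?m s k - ?m t k) * rate \<psi> (\<mu> k)\<bar> \<le> \<bar>s - t\<bar> * \<Lambda>"
        unfolding abs_mult by (intro mult_mono) auto
    qed
    also have "\<dots> = real N * \<Lambda> * \<bar>s - t\<bar>" by simp
    finally show "\<bar>(\<integral>x. \<psi> x \<partial>euler_path s) - (\<integral>x. \<psi> x \<partial>euler_path t)\<bar> \<le> real N * \<Lambda> * \<bar>s - t\<bar>" .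
  qed
  moreover have "0 \<le> real N * \<Lambda>" using \<Lambda>_ge_1 by simp
  ultimately show thesis using that by blast
qed

end

section \<open>Uniqueness of weak solutions\<close>

context wild_horizon
begin

text \<open>The bounds \<open>2 (6t)\<^sup>n / n!\<close> are a Picard iteration. If the total variation distance at time \<open>s\<close> is at
most \<open>d\<close>, the right-hand sides differ by at most \<open>2d\<close> (gain) plus \<open>d\<close> (loss) when tested with
\<open>0 \<le> \<phi> \<le> 1\<close>; integration in time gives a bound for test functions, and the passage to total
variation doubles it, whence \<open>6 = 2 \<cdot> 3\<close>. Only the explicit bounds are integrated, not the
distance itself, whose measurability in time is unclear.\<close>

lemma weak_solution_unique:
  assumes g: "\<And>t. t \<in> {0..T} \<Longrightarrow> g t \<in> Prob" and g0: "g 0 = f0"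
    and ac: "\<And>\<phi>. test_function \<phi> \<Longrightarrow> abs_continuous_on {0..T} (\<lambda>t. \<integral>v. \<phi> v \<partial>g t)"
    and der: "\<And>\<phi>. test_function \<phi> \<Longrightarrow> AE t in lborel. t \<in> {0..T} \<longrightarrow>
      ((\<lambda>s. \<integral>v. \<phi> v \<partial>g s) has_real_derivative rate \<phi> (g t)) (at t within {0..T})"
    and t: "t \<in> {0..T}"
  shows "g t = F t"
proof -
  have F: "F t \<in> Prob" if "t \<in> {0..T}" for t using that by (intro wild_sum_Prob) auto
  let ?c = "\<lambda>n t::real. (6 * t) ^ n / fact n"
  have claim: "tv_le (\<lambda>_. 1) (g t) (F t) (2 * ?c n t)" if "t \<in> {0..T}" for n t
    using that
  proof (induction n arbitrary: t)
    case 0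
    show ?case
      unfolding tv_le_def
    proof
      fix \<psi> :: "'a \<Rightarrow> real" assume \<psi>: "\<psi> \<in> dominated (\<lambda>_. 1)"
      have "\<bar>\<integral>v. \<psi> v \<partial>\<nu>\<bar> \<le> 1" if "\<nu> \<in> Prob" for \<nu>
        using dominated_integral_le[OF \<psi>, unfolded Prob_weighted_one, OF that] ProbD(1,3)[OF that]
          prob_space.prob_space[OF ProbD(1)[OF that]] by simp
      from this[OF g[OF 0]] this[OF F[OF 0]]
      show "\<bar>(\<integral>v. \<psi> v \<partial>g t) - (\<integral>v. \<psi> v \<partial>F t)\<bar> \<le> 2 * ((6 * t) ^ 0 / fact 0)" by simp
    qed
  next
    case (Suc n)
    have t: "0 \<le> t" "t \<le> T" using Suc.prems by auto
    show ?case
    proof (rule test_functions_determine_tv[OF g[OF Suc.prems] F[OF Suc.prems]])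
      fix \<phi> :: "'a \<Rightarrow> real"
      assume \<phi>: "test_function \<phi>" "\<And>x. 0 \<le> \<phi> x" "\<And>x. \<phi> x \<le> 1"
      have \<phi>1: "\<phi> \<in> dominated (\<lambda>_. 1)"
        using \<phi> test_function_continuous[OF \<phi>(1)] by (auto simp: dominated_def borel_measurable_continuous_onI)
      have \<phi>w: "\<phi> \<in> dominated (\<lambda>v. 1 + norm v)" by (rule one_dominated_weight[OF \<phi>1])
      have rate3: "\<bar>rate \<phi> (g s) - rate \<phi> (F s)\<bar> \<le> 6 * ?c n s" if s: "s \<in> {0..t}" for s
      proof -
        have s': "s \<in> {0..T}" using s t by auto
        have one: "(\<integral>v. 1 \<partial>\<nu>) \<le> (1::real)" if "\<nu> \<in> Prob" for \<nu> :: "'a measure"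
          using prob_space.prob_space[OF ProbD(1)[OF that]] by simp
        have "tv_le (\<lambda>_. 1) (bigain c B (g s) (g s)) (bigain c B (F s) (F s)) (2 * 1 * 1 * (2 * ?c n s))"
          by (rule U.bigain_stability[unfolded Prob_weighted_one, OF g[OF s'] F[OF s'] one[OF g[OF s']] one[OF F[OF s']] Suc.IH[OF s']])
        from tv_leD[OF this \<phi>1] tv_leD[OF Suc.IH[OF s'] \<phi>1] show ?thesis
          unfolding rate_def by (simp add: abs_le_iff)
      qed
      define C where "C s = ?c (Suc n) s" for s
      have C_der: "(C has_real_derivative 6 * ?c n s) (at s within S)" for s S
      proof -
        have "(C has_real_derivative real (Suc n) * (6 * s) ^ n * 6 / fact (Suc n)) (at s within S)"
          unfolding C_def by (rule derivative_eq_intros refl | simp)+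
        moreover have "real (Suc n) * (6 * s) ^ n * 6 / fact (Suc n) = 6 * ?c n s"
          by (simp del: of_nat_Suc add: field_simps)
        ultimately show ?thesis by (simp only:)
      qed
      have "(6 * ?c n t)-lipschitz_on {0..t} C"
      proof (rule lipschitz_onI)
        fix x y assume xy: "x \<in> {0..t}" "y \<in> {0..t}"
        have "norm (C x - C y) \<le> 6 * ?c n t * norm (x - y)"
        proof (rule field_differentiable_bound[OF _ C_der _ xy])
          fix z assume "z \<in> {0..t}"
          then have "(6 * z) ^ n \<le> (6 * t) ^ n" "0 \<le> z" by (auto intro: power_mono)
          then show "norm (6 * ?c n z) \<le> 6 * ?c n t"
            by (simp add: divide_right_mono)
        qed simp
        then show "dist (C x) (C y) \<le> 6 * ?c n t * dist x y" by (simp add: dist_norm)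
      qed (use t in simp)
      then have acC: "abs_continuous_on {0..t} C"
        by (rule lipschitz_abs_continuous)
      have acg: "abs_continuous_on {0..t} (\<lambda>s. \<integral>v. \<phi> v \<partial>g s)"
        using t by (intro abs_continuous_on_subset[OF ac[OF \<phi>(1)]]) auto
      have "\<Lambda>-lipschitz_on {0..t} (\<lambda>s. \<integral>v. \<phi> v \<partial>F s)"
      proof (rule lipschitz_onI)
        show "dist (\<integral>v. \<phi> v \<partial>F x) (\<integral>v. \<phi> v \<partial>F y) \<le> \<Lambda> * dist x y" if "x \<in> {0..t}" "y \<in> {0..t}" for x y
          unfolding dist_real_def using that t by (intro F_lipschitz_test[OF \<phi>w]) auto
      qed (use \<Lambda>_ge_1 in simp)
      then have acF: "abs_continuous_on {0..t} (\<lambda>s. \<integral>v. \<phi> v \<partial>F s)"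
        by (rule lipschitz_abs_continuous)
      have derF: "((\<lambda>s. \<integral>v. \<phi> v \<partial>F s) has_real_derivative rate \<phi> (F s)) (at s within {0..t})"
        if "s \<in> {0..t}" for s
        using that by (intro has_field_derivative_subset[OF derivative_F[OF \<phi>w]]) auto
      have derg: "AE s in lborel. s \<in> {0..t} \<longrightarrow>
          ((\<lambda>s. \<integral>v. \<phi> v \<partial>g s) has_real_derivative rate \<phi> (g s)) (at s within {0..t})"
        using der[OF \<phi>(1)]
      proof eventually_elim
        case (elim s)
        show ?case
        proof
          assume "s \<in> {0..t}"
          then show "((\<lambda>s. \<integral>v. \<phi> v \<partial>g s) has_real_derivative rate \<phi> (g s)) (at s within {0..t})"
            using elim t by (intro has_field_derivative_subset[of _ _ _ "{0..T}" "{0..t}"]) auto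
        qed
      qed
      have at0: "(\<integral>v. \<phi> v \<partial>g 0) = (\<integral>v. \<phi> v \<partial>F 0)" "C 0 = 0"
        by (simp_all add: g0 wild_sum_0 C_def)
      let ?X = "\<lambda>s. (\<integral>v. \<phi> v \<partial>g s) + - (\<integral>v. \<phi> v \<partial>F s)"
      have "\<bar>?X t - ?X 0\<bar> \<le> C t - C 0"
      proof (rule abs_continuous_increment_le[OF _ acC t(1)])
        show "abs_continuous_on {0..t} ?X"
          by (intro abs_continuous_on_add abs_continuous_on_uminus acg acF)
        show "AE s in lborel. s \<in> {0..t} \<longrightarrow> (\<exists>D E. (?X has_real_derivative D) (at s within {0..t}) \<and>
            (C has_real_derivative E) (at s within {0..t}) \<and> \<bar>D\<bar> \<le> E)"
          using derg
        proof eventually_elim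
          case (elim s)
          show ?case
          proof
            assume s: "s \<in> {0..t}"
            have "(?X has_real_derivative rate \<phi> (g s) + - rate \<phi> (F s)) (at s within {0..t})"
              using elim s by (intro DERIV_add DERIV_minus derF) auto
            then show "\<exists>D E. (?X has_real_derivative D) (at s within {0..t}) \<and>
                (C has_real_derivative E) (at s within {0..t}) \<and> \<bar>D\<bar> \<le> E"
              using C_der[of s] rate3[OF s] by force
          qed
        qed
      qed
      then have "\<bar>(\<integral>v. \<phi> v \<partial>g t) - (\<integral>v. \<phi> v \<partial>F t)\<bar> \<le> C t"
        using at0 by simp
      then show "\<bar>(\<integral>v. \<phi> v \<partial>g t) - (\<integral>v. \<phi> v \<partial>F t)\<bar> \<le> ?c (Suc n) t" by (simp add: C_def)
    qed
  qed
  have "(\<lambda>n. 2 * ?c n t) \<longlonglongrightarrow> 2 * 0"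
  proof (intro tendsto_mult tendsto_const)
    have "(\<lambda>n. (6 * t) ^ n /\<^sub>R fact n) \<longlonglongrightarrow> 0"
      by (rule summable_LIMSEQ_zero[OF summable_exp_generic])
    then show "(\<lambda>n. ?c n t) \<longlonglongrightarrow> 0" by (simp add: divide_inverse mult.commute)
  qed
  then have lim: "(\<lambda>n. 2 * ?c n t) \<longlonglongrightarrow> 0" by simp
  have "tv_le (\<lambda>_. 1) (g t) (F t) 0"
    unfolding tv_le_def
  proof
    fix \<psi> :: "'a \<Rightarrow> real" assume \<psi>: "\<psi> \<in> dominated (\<lambda>_. 1)"
    show "\<bar>(\<integral>v. \<psi> v \<partial>g t) - (\<integral>v. \<psi> v \<partial>F t)\<bar> \<le> 0"
      by (rule LIMSEQ_le_const[OF lim]) (use tv_leD[OF claim[OF t] \<psi>] in blast)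
  qed
  then show ?thesis by (rule Prob_eqI_tv[OF g[OF t] F[OF t]])
qed

end

section \<open>The collision map of the Cauchy problem\<close>

text \<open>The complement of the support is covered by open null sets, of which countably many suffice.\<close>

lemma AE_supp:
  fixes B :: "'p::{real_normed_vector, second_countable_topology} measure"
  assumes sets: "sets B = sets (restrict_space borel \<Theta>)"
  shows "AE \<theta> in B. \<theta> \<in> supp B"
proof -
  let ?F = "{U. open U \<and> emeasure B (U \<inter> space B) = 0}"
  have sp: "space B = \<Theta>"
    using sets_eq_imp_space_eq[OF sets] by (simp add: space_restrict_space)
  have meas: "U \<inter> space B \<in> sets B" if "open U" for U
  proof -
    have "\<Theta> \<inter> U \<in> (\<inter>) \<Theta> ` sets borel" using that by (intro imageI) simp
    then show ?thesis unfolding sets sp sets_restrict_space Int_commute[of U] .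
  qed
  obtain F' where F': "F' \<subseteq> ?F" "countable F'" "\<Union>F' = \<Union>?F"
  proof (rule Lindelof[of ?F])
    show "open S" if "S \<in> ?F" for S using that by simp
  qed
  have "(\<Union>U\<in>F'. U \<inter> space B) \<in> null_sets B"
  proof (rule null_sets_UN'[OF F'(2)])
    fix U assume "U \<in> F'"
    then have "U \<in> ?F" by (rule subsetD[OF F'(1)])
    then show "U \<inter> space B \<in> null_sets B" using meas[of U] by (simp add: null_setsI)
  qed
  then have "AE \<theta> in B. \<theta> \<notin> (\<Union>U\<in>F'. U \<inter> space B)"
    by (rule AE_not_in)
  then show ?thesis
  proof (rule AE_mp)
    show "AE \<theta> in B. \<theta> \<notin> (\<Union>U\<in>F'. U \<inter> space B) \<longrightarrow> \<theta> \<in> supp B"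
    proof (rule AE_I2, rule impI)
      fix \<theta> assume \<theta>: "\<theta> \<in> space B" "\<theta> \<notin> (\<Union>U\<in>F'. U \<inter> space B)"
      have "emeasure B (U \<inter> space B) > 0" if U: "open U" "\<theta> \<in> U" for U
      proof (rule ccontr)
        assume "\<not> emeasure B (U \<inter> space B) > 0"
        then have "U \<in> ?F" using U by (simp add: not_gr_zero)
        then have "\<theta> \<in> \<Union>F'" unfolding F'(3) using U(2) by (rule UnionI)
        then obtain V where "V \<in> F'" "\<theta> \<in> V" by (rule UnionE)
        then have "\<theta> \<in> (\<Union>U\<in>F'. U \<inter> space B)" using \<theta>(1) by (intro UN_I IntI)
        then show False using \<theta>(2) by (rule notE[rotated])
      qed
      then show "\<theta> \<in> supp B" using \<theta>(1) by (simp add: supp_def)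
    qed
  qed
qed

locale collision_setting =
  fixes \<Omega> :: "'a::euclidean_space set"
    and \<Theta> :: "'p::{real_normed_vector, second_countable_topology} set"
    and C :: "'a \<Rightarrow> 'a \<Rightarrow> 'p \<Rightarrow> 'a" and K :: real
    and B :: "'p measure" and J :: "('p \<times> 'p) measure"
  assumes open_\<Omega>: "open \<Omega>" and collision: "collision_map \<Omega> \<Theta> C" and K: "0 < K"
    and growth: "\<And>v w \<theta>. v \<in> \<Omega> \<Longrightarrow> w \<in> \<Omega> \<Longrightarrow> \<theta> \<in> \<Theta> \<Longrightarrow> norm (C v w \<theta>) \<le> K * (1 + norm \<theta>) * (norm v + norm w)"
    and B: "B \<in> Prob_inf \<Theta>" and J: "joint_law B J"
begin

text \<open>The collision map, extended by 0 to a total function that obeys the growth bound everywhere. Only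
null sets are affected, as the particles stay in \<open>\<Omega>\<close> and almost every parameter satisfies
\<open>|\<theta>| \<le> M\<^sub>\<infinity>(B)\<close>.\<close>

definition c :: "'a \<Rightarrow> 'a \<Rightarrow> 'p \<Rightarrow> 'a" where
  "c v w \<theta> = (if v \<in> \<Omega> \<and> w \<in> \<Omega> \<and> norm \<theta> \<le> M_inf B then C v w \<theta> else 0)"

definition a :: real where "a = K * (1 + M_inf B)"

lemma prob_B: "prob_space B" and sets_B: "sets B = sets (restrict_space borel \<Theta>)"
  and bdd_supp: "bdd_above (norm ` supp B)"
  using B by (auto simp: Prob_inf_def)

lemma space_B: "space B = \<Theta>"
  using sets_eq_imp_space_eq[OF sets_B] by (simp add: space_restrict_space)

lemma AE_norm_le: "AE \<theta> in B. norm \<theta> \<le> M_inf B"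
  using AE_supp[OF sets_B] unfolding M_inf_def
  by eventually_elim (auto intro: cSup_upper bdd_supp)

lemma M_nonneg: "0 \<le> M_inf B"
proof -
  interpret prob_space B by (rule prob_B)
  have "AE \<theta> in B. 0 \<le> M_inf B"
    using AE_norm_le by eventually_elim (rule order_trans[OF norm_ge_zero])
  then show ?thesis by simp
qed

lemma C_measurable:
  assumes "f \<in> borel_measurable M" "g \<in> borel_measurable M" "h \<in> measurable M B"
    and "f \<in> space M \<rightarrow> \<Omega>" "g \<in> space M \<rightarrow> \<Omega>"
  shows "(\<lambda>x. C (f x) (g x) (h x)) \<in> borel_measurable M"
proof -
  have C: "(\<lambda>(v, w, \<theta>). C v w \<theta>) \<in> borel_measurable
      (restrict_space borel \<Omega> \<Otimes>\<^sub>M (restrict_space borel \<Omega> \<Otimes>\<^sub>M restrict_space borel \<Theta>))"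
    using collision by (simp add: collision_map_def)
  have "(\<lambda>x. (f x, g x, h x)) \<in> measurable M
      (restrict_space borel \<Omega> \<Otimes>\<^sub>M (restrict_space borel \<Omega> \<Otimes>\<^sub>M restrict_space borel \<Theta>))"
    using assms(3) unfolding measurable_cong_sets[OF refl sets_B]
    by (intro measurable_Pair[OF measurable_restrict_space2[OF assms(4,1)]
          measurable_Pair[OF measurable_restrict_space2[OF assms(5,2)]]])
  from measurable_compose[OF this C] show ?thesis by simp
qed

sublocale bounded_kernel B c a
proof -
  interpret prob_space B by (rule prob_B)
  have [measurable]: "\<Omega> \<in> sets borel" using open_\<Omega> by simp
  have norm_B [measurable]: "norm \<in> borel_measurable B"
    by (simp add: measurable_cong_sets[OF sets_B refl] measurable_restrict_space1)
  let ?M = "borel \<Otimes>\<^sub>M (borel \<Otimes>\<^sub>M B)"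
  let ?P = "\<lambda>x::'a \<times> 'a \<times> 'p. fst x \<in> \<Omega> \<and> fst (snd x) \<in> \<Omega> \<and> norm (snd (snd x)) \<le> M_inf B"
  have "(\<lambda>x. C (fst x) (fst (snd x)) (snd (snd x))) \<in> borel_measurable (restrict_space ?M {x. ?P x})"
    by (rule C_measurable) (auto intro!: measurable_restrict_space1 simp: space_restrict_space)
  then have "(\<lambda>x. if ?P x then C (fst x) (fst (snd x)) (snd (snd x)) else 0) \<in> borel_measurable ?M"
    by (subst measurable_If_restrict_space_iff) (auto intro!: measurable_restrict_space1)
  then have m: "(\<lambda>(v, w, \<theta>). c v w \<theta>) \<in> borel_measurable ?M"
    by (simp add: c_def case_prod_unfold)
  have "norm (c v w \<theta>) \<le> a * (norm v + norm w)" if "\<theta> \<in> space B" for v w \<theta>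
  proof (cases "v \<in> \<Omega> \<and> w \<in> \<Omega> \<and> norm \<theta> \<le> M_inf B")
    case True
    then have "norm (C v w \<theta>) \<le> K * (1 + norm \<theta>) * (norm v + norm w)"
      using growth that by (simp add: space_B)
    also have "\<dots> \<le> a * (norm v + norm w)"
      unfolding a_def using True K by (intro mult_right_mono mult_left_mono) auto
    finally show ?thesis using True by (simp add: c_def)
  next
    case False
    then have "c v w \<theta> = 0" unfolding c_def by (rule if_not_P)
    then show ?thesis using K M_nonneg by (simp add: a_def)
  qed
  then show "bounded_kernel B c a"
    using m K M_nonneg by unfold_locales (auto simp: a_def)
qed

lemma C_in_\<Omega>: "v \<in> \<Omega> \<Longrightarrow> w \<in> \<Omega> \<Longrightarrow> \<theta> \<in> space B \<Longrightarrow> C v w \<theta> \<in> \<Omega>"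
  using collision by (simp add: collision_map_def space_B)

definition Prob\<Omega> :: "'a measure set" where
  "Prob\<Omega> = {g \<in> Prob. emeasure g \<Omega> = 1}"

lemma Prob\<Omega>D:
  assumes "g \<in> Prob\<Omega>"
  shows "g \<in> Prob" "AE v in g. v \<in> \<Omega>" "prob_space (restrict_space g \<Omega>)"
proof -
  show g: "g \<in> Prob" using assms by (simp add: Prob\<Omega>_def)
  interpret prob_space g by (rule ProbD[OF g])
  have \<Omega>: "\<Omega> \<in> sets g" "emeasure g \<Omega> = 1"
    using assms open_\<Omega> ProbD(2)[OF g] by (auto simp: Prob\<Omega>_def)
  then show "AE v in g. v \<in> \<Omega>"
    using emeasure_eq_measure prob_eq_1 by auto
  show "prob_space (restrict_space g \<Omega>)"
    using \<Omega> by (rule prob_space_restrict_space)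
qed

lemma sets_restrict_\<Omega>: "g \<in> Prob\<Omega> \<Longrightarrow> sets (restrict_space g \<Omega>) = sets (restrict_space borel \<Omega>)"
  by (intro sets_restrict_space_cong ProbD Prob\<Omega>D)

lemma space_restrict_\<Omega>: "g \<in> Prob\<Omega> \<Longrightarrow> space (restrict_space g \<Omega>) = \<Omega>"
  by (simp add: space_restrict_space ProbD Prob\<Omega>D)

lemma nn_integral_restrict_\<Omega>:
  assumes g: "g \<in> Prob\<Omega>"
  shows "(\<integral>\<^sup>+v. f v \<partial>restrict_space g \<Omega>) = (\<integral>\<^sup>+v. f v \<partial>g)"
proof -
  have "(\<integral>\<^sup>+v. f v \<partial>restrict_space g \<Omega>) = (\<integral>\<^sup>+v. f v * indicator \<Omega> v \<partial>g)"
    using open_\<Omega> ProbD(2,3)[OF Prob\<Omega>D(1)[OF g]] by (intro nn_integral_restrict_space) auto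
  also have "\<dots> = (\<integral>\<^sup>+v. f v \<partial>g)"
    using Prob\<Omega>D(2)[OF g] by (intro nn_integral_cong_AE) auto
  finally show ?thesis .
qed

lemma integral_restrict_\<Omega>:
  fixes f :: "'a \<Rightarrow> real"
  assumes g: "g \<in> Prob\<Omega>" and [measurable]: "f \<in> borel_measurable borel"
  shows "(\<integral>v. f v \<partial>restrict_space g \<Omega>) = (\<integral>v. f v \<partial>g)"
proof -
  note [measurable_cong] = ProbD(2)[OF Prob\<Omega>D(1)[OF g]]
  have [measurable]: "\<Omega> \<in> sets borel" using open_\<Omega> by simp
  have "(\<integral>v. f v \<partial>restrict_space g \<Omega>) = (\<integral>v. indicator \<Omega> v *\<^sub>R f v \<partial>g)"
    using open_\<Omega> ProbD(2,3)[OF Prob\<Omega>D(1)[OF g]] by (intro integral_restrict_space) auto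
  also have "\<dots> = (\<integral>v. f v \<partial>g)"
    using Prob\<Omega>D(2)[OF g] open_\<Omega> by (intro integral_cong_AE) auto
  finally show ?thesis .
qed

lemma collision_AE:
  assumes "v \<in> \<Omega>" "w \<in> \<Omega>"
  shows "AE \<theta> in B. c v w \<theta> = C v w \<theta>"
  using AE_norm_le by eventually_elim (use assms in \<open>simp add: c_def\<close>)

lemma nn_integral_restricted_triple:
  assumes g: "g \<in> Prob\<Omega>" and N: "prob_space N"
    and f: "f \<in> borel_measurable (restrict_space g \<Omega> \<Otimes>\<^sub>M (restrict_space g \<Omega> \<Otimes>\<^sub>M N))"
  shows "(\<integral>\<^sup>+z. f z \<partial>(restrict_space g \<Omega> \<Otimes>\<^sub>M (restrict_space g \<Omega> \<Otimes>\<^sub>M N))) =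
     (\<integral>\<^sup>+v. \<integral>\<^sup>+w. \<integral>\<^sup>+x. f (v, w, x) \<partial>N \<partial>restrict_space g \<Omega> \<partial>restrict_space g \<Omega>)"
proof -
  interpret N: prob_space N by (rule N)
  interpret R: prob_space "restrict_space g \<Omega>" by (rule Prob\<Omega>D(3)[OF g])
  interpret RN: pair_prob_space "restrict_space g \<Omega>" N ..
  have "(\<integral>\<^sup>+z. f z \<partial>(restrict_space g \<Omega> \<Otimes>\<^sub>M (restrict_space g \<Omega> \<Otimes>\<^sub>M N))) =
      (\<integral>\<^sup>+v. \<integral>\<^sup>+y. f (v, y) \<partial>(restrict_space g \<Omega> \<Otimes>\<^sub>M N) \<partial>restrict_space g \<Omega>)"
    by (rule RN.nn_integral_fst[OF f, symmetric])
  also have "\<dots> = (\<integral>\<^sup>+v. \<integral>\<^sup>+w. \<integral>\<^sup>+x. f (v, w, x) \<partial>N \<partial>restrict_space g \<Omega> \<partial>restrict_space g \<Omega>)"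
  proof (rule nn_integral_cong)
    fix v assume "v \<in> space (restrict_space g \<Omega>)"
    then show "(\<integral>\<^sup>+y. f (v, y) \<partial>(restrict_space g \<Omega> \<Otimes>\<^sub>M N)) =
        (\<integral>\<^sup>+w. \<integral>\<^sup>+x. f (v, w, x) \<partial>N \<partial>restrict_space g \<Omega>)"
      using N.nn_integral_fst[OF measurable_Pair2[OF f], of v, symmetric] by simp
  qed
  finally show ?thesis .
qed

lemma collision_law_measurable:
  assumes g: "g \<in> Prob\<Omega>" and p: "p \<in> measurable N B"
  shows "(\<lambda>(v, w, x). C v w (p x)) \<in> borel_measurable (restrict_space g \<Omega> \<Otimes>\<^sub>M (restrict_space g \<Omega> \<Otimes>\<^sub>M N))"
    "(\<lambda>(v, w, x). C w v (p x)) \<in> borel_measurable (restrict_space g \<Omega> \<Otimes>\<^sub>M (restrict_space g \<Omega> \<Otimes>\<^sub>M N))"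
proof -
  let ?R = "restrict_space g \<Omega>"
  have id: "(\<lambda>v. v) \<in> borel_measurable ?R"
    by (simp add: measurable_cong_sets[OF sets_restrict_\<Omega>[OF g] refl] measurable_restrict_space1)
  have [measurable]: "fst \<in> borel_measurable (?R \<Otimes>\<^sub>M (?R \<Otimes>\<^sub>M N))"
      "(\<lambda>x. fst (snd x)) \<in> borel_measurable (?R \<Otimes>\<^sub>M (?R \<Otimes>\<^sub>M N))"
    using measurable_compose[OF measurable_fst id] measurable_compose[OF measurable_snd measurable_compose[OF measurable_fst id]]
    by auto
  note [measurable] = p
  show "(\<lambda>(v, w, x). C v w (p x)) \<in> borel_measurable (?R \<Otimes>\<^sub>M (?R \<Otimes>\<^sub>M N))"
    "(\<lambda>(v, w, x). C w v (p x)) \<in> borel_measurable (?R \<Otimes>\<^sub>M (?R \<Otimes>\<^sub>M N))"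
    unfolding case_prod_unfold
    by (intro C_measurable; force simp: space_pair_measure space_restrict_\<Omega>[OF g])+
qed

text \<open>The law of the outcome depends on the source \<open>N\<close> of randomness only through the law \<open>B\<close> of the
parameter \<open>p(x)\<close>. Taking \<open>N = B\<close> gives the gain term; taking for \<open>N\<close> the joint law and for \<open>p\<close>
its two projections shows that both outcomes of a collision have the same law, whatever the
dependence between the parameters.\<close>

lemma collision_law:
  assumes g: "g \<in> Prob\<Omega>" and N: "prob_space N" and p: "p \<in> measurable N B" and law: "distr N B p = B"
  shows "distr (restrict_space g \<Omega> \<Otimes>\<^sub>M (restrict_space g \<Omega> \<Otimes>\<^sub>M N)) borel (\<lambda>(v, w, x). C v w (p x)) = bigain c B g g"
      (is "?L1 = _")
    and "distr (restrict_space g \<Omega> \<Otimes>\<^sub>M (restrict_space g \<Omega> \<Otimes>\<^sub>M N)) borel (\<lambda>(v, w, x). C w v (p x)) = bigain c B g g"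
      (is "?L2 = _")
proof -
  let ?R = "restrict_space g \<Omega>"
  note gP = Prob\<Omega>D(1)[OF g]
  interpret G: prob_space g by (rule ProbD[OF gP])
  interpret GG: pair_prob_space g g ..
  note [measurable_cong] = ProbD(2)[OF gP]
  note meas = collision_law_measurable[OF g p]
  have inner: "(\<integral>\<^sup>+x. indicator A (C v w (p x)) \<partial>N) = (\<integral>\<^sup>+\<theta>. indicator A (c v w \<theta>) \<partial>B)"
    if A: "A \<in> sets borel" and vw: "v \<in> \<Omega>" "w \<in> \<Omega>" for A v w
  proof -
    have "(\<lambda>\<theta>. C v w \<theta>) \<in> borel_measurable B"
      using vw by (intro C_measurable) auto
    then have m: "(\<lambda>\<theta>. indicator A (C v w \<theta>) :: ennreal) \<in> borel_measurable B"
      using A by (rule measurable_compose[OF _ borel_measurable_indicator])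
    have "(\<integral>\<^sup>+x. indicator A (C v w (p x)) \<partial>N) = (\<integral>\<^sup>+\<theta>. indicator A (C v w \<theta>) \<partial>distr N B p)"
      by (rule nn_integral_distr[OF p, symmetric]) (use m in simp)
    also have "\<dots> = (\<integral>\<^sup>+\<theta>. indicator A (c v w \<theta>) \<partial>B)"
      unfolding law using collision_AE[OF vw] by (intro nn_integral_cong_AE) auto
    finally show ?thesis .
  qed
  have law: "distr (?R \<Otimes>\<^sub>M (?R \<Otimes>\<^sub>M N)) borel (\<lambda>(v, w, x). X v w x) = bigain c B g g"
    if m: "(\<lambda>(v, w, x). X v w x) \<in> borel_measurable (?R \<Otimes>\<^sub>M (?R \<Otimes>\<^sub>M N))"
      and int: "\<And>A v w. A \<in> sets borel \<Longrightarrow> v \<in> \<Omega> \<Longrightarrow> w \<in> \<Omega> \<Longrightarrow>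
        (\<integral>\<^sup>+x. indicator A (X v w x) \<partial>N) = Y A v w"
      and Y: "\<And>A. A \<in> sets borel \<Longrightarrow> (\<integral>\<^sup>+v. \<integral>\<^sup>+w. Y A v w \<partial>g \<partial>g) = emeasure (bigain c B g g) A"
    for X and Y :: "'a set \<Rightarrow> 'a \<Rightarrow> 'a \<Rightarrow> ennreal"
  proof (rule measure_eqI)
    let ?L = "distr (?R \<Otimes>\<^sub>M (?R \<Otimes>\<^sub>M N)) borel (\<lambda>(v, w, x). X v w x)"
    fix A assume "A \<in> sets ?L"
    then have A: "A \<in> sets borel" by simp
    have "emeasure ?L A = (\<integral>\<^sup>+z. indicator A z \<partial>?L)" using A by simp
    also have "\<dots> = (\<integral>\<^sup>+z. indicator A (case z of (v, w, x) \<Rightarrow> X v w x) \<partial>(?R \<Otimes>\<^sub>M (?R \<Otimes>\<^sub>M N)))"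
      using m A by (intro nn_integral_distr) auto
    also have "\<dots> = (\<integral>\<^sup>+v. \<integral>\<^sup>+w. \<integral>\<^sup>+x. indicator A (X v w x) \<partial>N \<partial>?R \<partial>?R)"
      using nn_integral_restricted_triple[OF g N measurable_compose[OF m borel_measurable_indicator[OF A]]] by simp
    also have "\<dots> = (\<integral>\<^sup>+v. \<integral>\<^sup>+w. Y A v w \<partial>?R \<partial>?R)"
      by (intro nn_integral_cong int A) (auto simp: space_restrict_\<Omega>[OF g])
    also have "\<dots> = emeasure (bigain c B g g) A"
      by (simp add: nn_integral_restrict_\<Omega>[OF g] Y[OF A])
    finally show "emeasure ?L A = emeasure (bigain c B g g) A" .
  qed simp
  have gain: "(\<integral>\<^sup>+v. \<integral>\<^sup>+w. \<integral>\<^sup>+\<theta>. indicator A (c v w \<theta>) \<partial>B \<partial>g \<partial>g) = emeasure (bigain c B g g) A"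
    if "A \<in> sets borel" for A
    using nn_integral_bigain[OF gP gP, of "indicator A"] that by simp
  show "?L1 = bigain c B g g"
    by (rule law[OF meas(1) inner gain])
  have "(\<integral>\<^sup>+v. \<integral>\<^sup>+w. \<integral>\<^sup>+\<theta>. indicator A (c w v \<theta>) \<partial>B \<partial>g \<partial>g) = emeasure (bigain c B g g) A"
    if [measurable]: "A \<in> sets borel" for A
  proof -
    have "(\<integral>\<^sup>+v. \<integral>\<^sup>+w. \<integral>\<^sup>+\<theta>. indicator A (c w v \<theta>) \<partial>B \<partial>g \<partial>g)
        = (\<integral>\<^sup>+w. \<integral>\<^sup>+v. \<integral>\<^sup>+\<theta>. indicator A (c w v \<theta>) \<partial>B \<partial>g \<partial>g)"
      by (rule GG.Fubini') measurable
    then show ?thesis by (simp add: gain that)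
  qed
  then show "?L2 = bigain c B g g"
    by (intro law[OF meas(2) inner])
qed

lemma gain_eq_bigain: "g \<in> Prob\<Omega> \<Longrightarrow> gain \<Omega> C B g = bigain c B g g"
  using collision_law(1)[of g B "\<lambda>x. x"] prob_B by (simp add: gain_def distr_id)

lemma bigain_Prob\<Omega>:
  assumes g: "g \<in> Prob\<Omega>" and h: "h \<in> Prob\<Omega>"
  shows "bigain c B g h \<in> Prob\<Omega>"
proof -
  note P = Prob\<Omega>D(1)[OF g] Prob\<Omega>D(1)[OF h]
  interpret G: prob_space g by (rule ProbD[OF P(1)])
  interpret H: prob_space h by (rule ProbD[OF P(2)])
  have one: "(\<integral>\<^sup>+\<theta>. indicator \<Omega> (c v w \<theta>) \<partial>B) = 1" if "v \<in> \<Omega>" "w \<in> \<Omega>" for v w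
  proof -
    have "AE \<theta> in B. indicator \<Omega> (c v w \<theta>) = (1::ennreal)"
      using collision_AE[OF that] AE_space
      by eventually_elim (simp add: C_in_\<Omega> that)
    then have "(\<integral>\<^sup>+\<theta>. indicator \<Omega> (c v w \<theta>) \<partial>B) = (\<integral>\<^sup>+\<theta>. 1 \<partial>B)"
      by (rule nn_integral_cong_AE)
    then show ?thesis by (simp add: B.emeasure_space_1)
  qed
  have "emeasure (bigain c B g h) \<Omega> = (\<integral>\<^sup>+v. \<integral>\<^sup>+w. \<integral>\<^sup>+\<theta>. indicator \<Omega> (c v w \<theta>) \<partial>B \<partial>h \<partial>g)"
    using nn_integral_bigain[OF P, of "indicator \<Omega>"] open_\<Omega> by simp
  also have "\<dots> = (\<integral>\<^sup>+v. \<integral>\<^sup>+w. \<integral>\<^sup>+\<theta>. indicator \<Omega> (c v w \<theta>) \<partial>B \<partial>restrict_space h \<Omega> \<partial>restrict_space g \<Omega>)"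
    by (simp add: nn_integral_restrict_\<Omega> g h)
  also have "\<dots> = (\<integral>\<^sup>+v. \<integral>\<^sup>+w. 1 \<partial>restrict_space h \<Omega> \<partial>restrict_space g \<Omega>)"
    by (intro nn_integral_cong one) (auto simp: space_restrict_\<Omega> g h)
  also have "\<dots> = (\<integral>\<^sup>+v. \<integral>\<^sup>+w. 1 \<partial>h \<partial>g)"
    by (simp only: nn_integral_restrict_\<Omega> g h)
  also have "\<dots> = 1" by (simp add: G.emeasure_space_1 H.emeasure_space_1)
  finally show ?thesis using bigain_Prob[OF P] by (simp add: Prob\<Omega>_def)
qed

lemma mix_Prob\<Omega>:
  assumes g: "g \<in> Prob\<Omega>" and h: "h \<in> Prob\<Omega>" and s: "0 \<le> s" "s \<le> 1"
  shows "mix s g h \<in> Prob\<Omega>"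
proof -
  note P = Prob\<Omega>D(1)[OF g] Prob\<Omega>D(1)[OF h]
  have "emeasure (mix s g h) \<Omega> = ennreal (1 - s) + ennreal s"
    using g h open_\<Omega> ProbD(2)[OF P(1)] ProbD(2)[OF P(2)] by (subst emeasure_mix) (simp_all add: Prob\<Omega>_def)
  also have "\<dots> = ennreal (1 - s + s)"
    using s by (intro ennreal_plus[symmetric]) auto
  finally show ?thesis using mix_Prob[OF P s] by (simp add: Prob\<Omega>_def)
qed

text \<open>Each of the two outcomes contributes the gain term, each of the two incoming particles the loss
term; the factor one half accounts for the double count.\<close>

lemma collision_weak_eq_rate:
  assumes g: "g \<in> Prob\<Omega>" and \<phi>: "\<phi> \<in> dominated (\<lambda>_. b)"
  shows "collision_weak \<Omega> C J g \<phi> = rate \<phi> g"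
proof -
  let ?R = "restrict_space g \<Omega>"
  let ?M = "?R \<Otimes>\<^sub>M (?R \<Otimes>\<^sub>M J)"
  have [measurable]: "\<phi> \<in> borel_measurable borel" using \<phi> by (simp add: dominated_def)
  have sets_J: "sets J = sets (B \<Otimes>\<^sub>M B)" and laws: "distr J B fst = B" "distr J B snd = B"
    using J by (auto simp: joint_law_def)
  have p: "fst \<in> measurable J B" "snd \<in> measurable J B"
    by (simp_all add: measurable_cong_sets[OF sets_J refl])
  have J1: "prob_space J"
  proof
    have "emeasure B (space B) = emeasure J (fst -` space B \<inter> space J)"
      using emeasure_distr[OF p(1), of "space B"] laws(1) by simp
    also have "fst -` space B \<inter> space J = space J"
      using measurable_space[OF p(1)] by auto
    finally show "emeasure J (space J) = 1" using B.emeasure_space_1 by simp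
  qed
  interpret J: prob_space J by (rule J1)
  interpret R: prob_space ?R by (rule Prob\<Omega>D(3)[OF g])
  interpret RJ: pair_prob_space ?R J ..
  interpret M: pair_prob_space ?R "?R \<Otimes>\<^sub>M J" ..
  have \<phi>R: "\<phi> \<in> borel_measurable ?R"
    by (simp add: measurable_cong_sets[OF sets_restrict_\<Omega>[OF g] refl] measurable_restrict_space1)
  have bound: "\<bar>\<phi> x\<bar> \<le> b" for x using \<phi> by (simp add: dominated_def)
  have int: "integrable ?M (\<lambda>z. \<phi> (f z))" if "(\<lambda>z. \<phi> (f z)) \<in> borel_measurable ?M" for f
    using that bound by (intro M.P.integrable_const_bound[of _ b]) auto
  note m = collision_law_measurable[OF g p(1)] collision_law_measurable[OF g p(2)]
  have m1: "(\<lambda>z. \<phi> (case z of (v, w, x) \<Rightarrow> C v w (fst x))) \<in> borel_measurable ?M"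
    by (rule measurable_compose[OF m(1)]) simp
  have m2: "(\<lambda>z. \<phi> (case z of (v, w, x) \<Rightarrow> C w v (snd x))) \<in> borel_measurable ?M"
    by (rule measurable_compose[OF m(4)]) simp
  have m3: "(\<lambda>z. \<phi> (fst z)) \<in> borel_measurable ?M"
    by (rule measurable_compose[OF measurable_fst \<phi>R])
  have m4: "(\<lambda>z. \<phi> (fst (snd z))) \<in> borel_measurable ?M"
    by (rule measurable_compose[OF measurable_snd measurable_compose[OF measurable_fst \<phi>R]])
  have 1: "(\<integral>z. \<phi> (case z of (v, w, x) \<Rightarrow> C v w (fst x)) \<partial>?M) = (\<integral>x. \<phi> x \<partial>bigain c B g g)"
    unfolding collision_law(1)[OF g J1 p(1) laws(1), symmetric]
    by (rule integral_distr[OF m(1), symmetric]) simp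
  have 2: "(\<integral>z. \<phi> (case z of (v, w, x) \<Rightarrow> C w v (snd x)) \<partial>?M) = (\<integral>x. \<phi> x \<partial>bigain c B g g)"
    unfolding collision_law(2)[OF g J1 p(2) laws(2), symmetric]
    by (rule integral_distr[OF m(4), symmetric]) simp
  have 3: "(\<integral>z. \<phi> (fst z) \<partial>?M) = (\<integral>v. \<phi> v \<partial>g)"
  proof -
    have "(\<integral>z. \<phi> (fst z) \<partial>?M) = (\<integral>v. \<phi> v \<partial>distr ?M ?R fst)"
      by (rule integral_distr[OF measurable_fst \<phi>R, symmetric])
    also have "distr ?M ?R fst = ?R" by (rule RJ.P.distr_pair_fst)
    finally show ?thesis by (simp add: integral_restrict_\<Omega>[OF g])
  qed
  have 4: "(\<integral>z. \<phi> (fst (snd z)) \<partial>?M) = (\<integral>v. \<phi> v \<partial>g)"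
  proof -
    have "(\<integral>z. \<phi> (fst (snd z)) \<partial>?M) = (\<integral>v. \<integral>y. \<phi> (fst y) \<partial>(?R \<Otimes>\<^sub>M J) \<partial>?R)"
      using M.integral_fst'[OF int[OF m4]] by simp
    also have "\<dots> = (\<integral>y. \<phi> (fst y) \<partial>(?R \<Otimes>\<^sub>M J))" by (simp add: R.prob_space)
    also have "\<dots> = (\<integral>v. \<phi> v \<partial>distr (?R \<Otimes>\<^sub>M J) ?R fst)"
      by (rule integral_distr[OF measurable_fst \<phi>R, symmetric])
    also have "distr (?R \<Otimes>\<^sub>M J) ?R fst = ?R" by (rule J.distr_pair_fst)
    finally show ?thesis by (simp add: integral_restrict_\<Omega>[OF g])
  qed
  have "(\<integral>(v, w, \<theta>, \<eta>). \<phi> (C v w \<theta>) + \<phi> (C w v \<eta>) - \<phi> v - \<phi> w \<partial>?M) =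
      (\<integral>z. \<phi> (case z of (v, w, x) \<Rightarrow> C v w (fst x)) + \<phi> (case z of (v, w, x) \<Rightarrow> C w v (snd x))
        - \<phi> (fst z) - \<phi> (fst (snd z)) \<partial>?M)"
    by (intro Bochner_Integration.integral_cong) (auto simp: case_prod_unfold)
  also have "\<dots> = 2 * rate \<phi> g"
    using int[OF m1] int[OF m2] int[OF m3] int[OF m4] by (simp add: 1 2 3 4 rate_def)
  finally show ?thesis by (simp add: collision_weak_def)
qed

end

section \<open>Convergence of the explicit Euler scheme\<close>

lemma test_function_dominated:
  assumes "test_function \<phi>"
  obtains b where "\<phi> \<in> dominated (\<lambda>_. b)" "0 < b"
proof -
  note cont = test_function_continuous[OF assms]
  have "compact (\<phi> ` closure {x. \<phi> x \<noteq> 0})"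
    using assms[unfolded test_function_def, THEN conjunct2]
    by (intro compact_continuous_image continuous_on_subset[OF cont] subset_UNIV)
  from compact_imp_bounded[OF this]
  obtain b where b: "b > 0" "\<And>y. y \<in> \<phi> ` closure {x. \<phi> x \<noteq> 0} \<Longrightarrow> norm y \<le> b"
    unfolding bounded_pos by blast
  have "\<bar>\<phi> x\<bar> \<le> b" for x
  proof (cases "\<phi> x = 0")
    case False
    then have "x \<in> closure {x. \<phi> x \<noteq> 0}"
      by (intro subsetD[OF closure_subset]) simp
    from b(2)[OF imageI[OF this]] show ?thesis by simp
  qed (use b in simp)
  then have "\<phi> \<in> dominated (\<lambda>_. b)"
    using cont by (simp add: dominated_def borel_measurable_continuous_onI)
  then show thesis using that b(1) by blast
qed

text \<open>Bounded observables are reduced to the weight \<open>1 + norm v\<close> by scaling.\<close>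

lemma (in wild_horizon) bounded_observable:
  assumes \<phi>: "\<phi> \<in> dominated (\<lambda>_. b)" and b: "0 < b"
  shows "t \<in> {0..T} \<Longrightarrow> ((\<lambda>s. \<integral>v. \<phi> v \<partial>F s) has_real_derivative rate \<phi> (F t)) (at t within {0..T})"
    and "(b * \<Lambda>)-lipschitz_on {0..T} (\<lambda>s. \<integral>v. \<phi> v \<partial>F s)"
proof -
  have \<psi>: "(\<lambda>v. \<phi> v / b) \<in> dominated (\<lambda>v. 1 + norm v)"
    using \<phi> b by (intro one_dominated_weight) (auto simp: dominated_def)
  have scale: "(\<integral>v. \<phi> v \<partial>\<nu>) = b * (\<integral>v. \<phi> v / b \<partial>\<nu>)" for \<nu> :: "'a measure"
    using b by simp
  have r: "rate \<phi> \<nu> = b * rate (\<lambda>v. \<phi> v / b) \<nu>" for \<nu>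
    unfolding rate_def right_diff_distrib using scale by metis
  show "((\<lambda>s. \<integral>v. \<phi> v \<partial>F s) has_real_derivative rate \<phi> (F t)) (at t within {0..T})" if "t \<in> {0..T}"
    unfolding r scale[abs_def] using that
    by (intro DERIV_cmult has_field_derivative_subset[OF derivative_F[OF \<psi>]]) auto
  show "(b * \<Lambda>)-lipschitz_on {0..T} (\<lambda>s. \<integral>v. \<phi> v \<partial>F s)"
  proof (rule lipschitz_onI)
    fix x y assume xy: "x \<in> {0..T}" "y \<in> {0..T}"
    have "dist (\<integral>v. \<phi> v \<partial>F x) (\<integral>v. \<phi> v \<partial>F y) = b * \<bar>(\<integral>v. \<phi> v / b \<partial>F x) - (\<integral>v. \<phi> v / b \<partial>F y)\<bar>"
      unfolding scale dist_real_def by (simp only: right_diff_distrib[symmetric] abs_mult abs_of_pos[OF b])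
    also have "\<dots> \<le> b * (\<Lambda> * \<bar>x - y\<bar>)"
      using b by (intro mult_left_mono F_lipschitz_test[OF \<psi>] xy) auto
    finally show "dist (\<integral>v. \<phi> v \<partial>F x) (\<integral>v. \<phi> v \<partial>F y) \<le> b * \<Lambda> * dist x y"
      by (simp add: dist_real_def mult_ac)
  qed (use b \<Lambda>_ge_1 in simp)
qed

locale cauchy_problem = collision_setting \<Omega> \<Theta> C K B J
  for \<Omega> :: "'a::euclidean_space set"
    and \<Theta> :: "'p::{real_normed_vector, second_countable_topology} set"
    and C K B J +
  fixes f0 :: "'a measure" and T :: real
  assumes f0: "f0 \<in> Prob1" and f0\<Omega>: "emeasure f0 \<Omega> = 1" and T: "0 < T"

sublocale cauchy_problem \<subseteq> wild_horizon B c a f0 T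
  by unfold_locales (use f0 T in auto)

context cauchy_problem
begin

lemma f0_Prob\<Omega>: "f0 \<in> Prob\<Omega>"
  using f0 f0\<Omega> by (simp add: Prob\<Omega>_def Prob1_def)

lemma wild_Prob\<Omega>: "Q n \<in> Prob\<Omega>"
proof (induction n rule: less_induct)
  case (less n)
  show ?case
  proof (cases n)
    case 0
    then show ?thesis by (simp add: f0_Prob\<Omega>)
  next
    case (Suc j)
    have IH: "emeasure (bigain c B (Q k) (Q (j - k))) \<Omega> = 1" if "k \<le> j" for k
      using bigain_Prob\<Omega>[OF less[of k] less[of "j - k"]] that Suc by (auto simp: Prob\<Omega>_def)
    have "emeasure (Q (Suc j)) \<Omega> = (\<Sum>k\<le>j. ennreal (1 / real (Suc j)) * emeasure (bigain c B (Q k) (Q (j - k))) \<Omega>)"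
      using nn_integral_wild_Suc[OF wild_Prob, of "indicator \<Omega>" j] open_\<Omega>
      by (simp add: sets_wild del: wild.simps)
    also have "\<dots> = (\<Sum>k\<le>j. ennreal (1 / real (Suc j)))"
      using IH by (intro sum.cong) auto
    also have "\<dots> = ennreal (\<Sum>k\<le>j. 1 / real (Suc j))"
      by (rule sum_ennreal) simp
    also have "\<dots> = 1" by simp
    finally show ?thesis unfolding Suc using wild_Prob by (simp add: Prob\<Omega>_def del: wild.simps)
  qed
qed

lemma F_Prob\<Omega>:
  assumes "0 \<le> t" shows "F t \<in> Prob\<Omega>"
proof -
  have "emeasure (F t) \<Omega> = emeasure (F t) UNIV"
    unfolding wild_sum_def using wild_Prob\<Omega> ProbD(4)[OF wild_Prob] open_\<Omega>
    by (simp add: emeasure_mixture sets_wild Prob\<Omega>_def)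
  then show ?thesis using wild_sum_Prob[OF assms] by (simp add: Prob\<Omega>_def ProbD)
qed

lemma wild_sum_solution: "weak_measure_solution \<Omega> C J T f0 F"
  unfolding weak_measure_solution_def
proof (intro conjI ballI allI impI)
  fix t assume t: "t \<in> {0..T}"
  show "F t \<in> Prob" "emeasure (F t) \<Omega> = 1" using F_Prob\<Omega>[of t] t by (auto simp: Prob\<Omega>_def)
next
  show "narrow_continuous_on {0..T} F"
    unfolding narrow_continuous_on_def
  proof (intro allI impI)
    fix \<phi> :: "'a \<Rightarrow> real" assume \<phi>: "continuous_on UNIV \<phi> \<and> bounded (range \<phi>)"
    then obtain b where b: "b > 0" "\<And>x. norm (\<phi> x) \<le> b"
      by (auto simp: bounded_pos)
    have "\<phi> \<in> dominated (\<lambda>_. b)"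
      using \<phi> b(2) by (auto simp: dominated_def borel_measurable_continuous_onI)
    from bounded_observable(2)[OF this b(1)] show "continuous_on {0..T} (\<lambda>t. \<integral>v. \<phi> v \<partial>F t)"
      by (rule lipschitz_on_continuous_on)
  qed
  show "F 0 = f0" by (rule wild_sum_0)
next
  fix \<phi> :: "'a \<Rightarrow> real" assume \<phi>: "test_function \<phi>"
  obtain b where b: "\<phi> \<in> dominated (\<lambda>_. b)" "0 < b" by (rule test_function_dominated[OF \<phi>])
  show "abs_continuous_on {0..T} (\<lambda>t. \<integral>v. \<phi> v \<partial>F t)"
    by (rule lipschitz_abs_continuous[OF bounded_observable(2)[OF b]])
  show "AE t in lborel. t \<in> {0..T} \<longrightarrow>
      ((\<lambda>s. \<integral>v. \<phi> v \<partial>F s) has_real_derivative collision_weak \<Omega> C J (F t) \<phi>) (at t within {0..T})"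
    using bounded_observable(1)[OF b] collision_weak_eq_rate[OF F_Prob\<Omega> b(1)] by (intro AE_I2) auto
qed

lemma solution_unique:
  assumes sol: "weak_measure_solution \<Omega> C J T f0 g" and t: "t \<in> {0..T}"
  shows "g t = F t"
proof (rule weak_solution_unique[OF _ _ _ _ t])
  have g\<Omega>: "g s \<in> Prob\<Omega>" if "s \<in> {0..T}" for s
    using sol that by (simp add: weak_measure_solution_def Prob\<Omega>_def)
  then show "g s \<in> Prob" if "s \<in> {0..T}" for s using that by (simp add: Prob\<Omega>_def)
  show "g 0 = f0" using sol by (simp add: weak_measure_solution_def)
  fix \<phi> :: "'a \<Rightarrow> real" assume \<phi>: "test_function \<phi>"
  obtain b where b: "\<phi> \<in> dominated (\<lambda>_. b)" "0 < b" by (rule test_function_dominated[OF \<phi>])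
  show "abs_continuous_on {0..T} (\<lambda>t. \<integral>v. \<phi> v \<partial>g t)"
    using sol \<phi> by (simp add: weak_measure_solution_def)
  have "AE t in lborel. t \<in> {0..T} \<longrightarrow>
      ((\<lambda>s. \<integral>v. \<phi> v \<partial>g s) has_real_derivative collision_weak \<Omega> C J (g t) \<phi>) (at t within {0..T})"
    using sol \<phi> by (simp add: weak_measure_solution_def)
  then show "AE t in lborel. t \<in> {0..T} \<longrightarrow>
      ((\<lambda>s. \<integral>v. \<phi> v \<partial>g s) has_real_derivative rate \<phi> (g t)) (at t within {0..T})"
    by eventually_elim (simp add: collision_weak_eq_rate[OF g\<Omega> b(1)])
qed

lemma euler_Prob\<Omega>:
  assumes "h \<in> {0<..<1}"
  shows "euler \<Omega> C B f0 h n \<in> Prob\<Omega>"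
proof (induction n)
  case (Suc n)
  then show ?case
    using assms by (auto simp: gain_eq_bigain intro!: mix_Prob\<Omega> bigain_Prob\<Omega>)
qed (simp add: f0_Prob\<Omega>)

lemma euler_scheme:
  assumes h: "h \<in> {0<..<1}"
  shows "euler_scheme B c a f0 T (euler \<Omega> C B f0 h) h"
  using h by unfold_locales (auto simp: gain_eq_bigain[OF euler_Prob\<Omega>[OF h]])

lemma euler_interp_eq:
  assumes h01: "h \<in> {0<..<1}"
  shows "euler_interp \<Omega> C B f0 h t = euler_scheme.euler_path (euler \<Omega> C B f0 h) h t"
proof -
  interpret euler_scheme B c a f0 T "euler \<Omega> C B f0 h" h by (rule euler_scheme[OF h01])
  show ?thesis by (simp only: euler_interp_def euler_path_def interp_def Let_def)
qed

lemma wild_sum_W1_Lipschitz: "W1_Lipschitz_on {0..T} F"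
  unfolding W1_Lipschitz_on_def
proof (intro conjI ballI exI[of _ \<Lambda>])
  show "F t \<in> Prob1" if "t \<in> {0..T}" for t using that by (intro wild_sum_Prob1) auto
  then show "W1 (F s) (F t) \<le> ennreal (\<Lambda> * \<bar>s - t\<bar>)" if "s \<in> {0..T}" "t \<in> {0..T}" for s t
    using that by (intro W1_le_tv F_lipschitz) (auto simp: Prob1_eq[symmetric])
qed (use \<Lambda>_ge_1 in simp)

lemma euler_interp_continuous:
  assumes h01: "h \<in> {0<..<1}"
  shows "W1_continuous_on {0..T} (euler_interp \<Omega> C B f0 h)"
proof -
  interpret euler_scheme B c a f0 T "euler \<Omega> C B f0 h" h by (rule euler_scheme[OF h01])
  obtain Lip where Lip: "0 \<le> Lip"
    "\<And>s t. s \<in> {0..T} \<Longrightarrow> t \<in> {0..T} \<Longrightarrow> tv_le (\<lambda>v. 1 + norm v) (euler_path s) (euler_path t) (Lip * \<bar>s - t\<bar>)"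
    by (rule euler_path_lipschitz) blast
  have P: "euler_path t \<in> Prob1" if "t \<in> {0..T}" for t using that by (intro euler_path_Prob1) auto
  have W: "W1 (euler_path s) (euler_path t) \<le> ennreal (Lip * \<bar>s - t\<bar>)" if "s \<in> {0..T}" "t \<in> {0..T}" for s t
    using P that by (intro W1_le_tv Lip) (auto simp: Prob1_eq[symmetric])
  have "((\<lambda>s. W1 (euler_path s) (euler_path t)) \<longlongrightarrow> 0) (at t within {0..T})" if t: "t \<in> {0..T}" for t
  proof (rule tendsto_sandwich[OF _ _ tendsto_const])
    have "((\<lambda>s. ennreal (Lip * \<bar>s - t\<bar>)) \<longlongrightarrow> ennreal (Lip * \<bar>t - t\<bar>)) (at t within {0..T})"
      by (intro tendsto_intros)
    then show "((\<lambda>s. ennreal (Lip * \<bar>s - t\<bar>)) \<longlongrightarrow> 0) (at t within {0..T})" by simp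
    show "\<forall>\<^sub>F s in at t within {0..T}. W1 (euler_path s) (euler_path t) \<le> ennreal (Lip * \<bar>s - t\<bar>)"
      using W t by (auto simp: eventually_at_filter)
  qed simp
  then show ?thesis
    using P by (simp add: W1_continuous_on_def euler_interp_eq[OF h01])
qed

lemma euler_interp_error:
  assumes h01: "h \<in> {0<..<1}" and t: "t \<in> {0..T}"
  shows "W1 (euler_interp \<Omega> C B f0 h t) (F t) \<le> ennreal (error_constant * h)"
    "KR_diff (euler_interp \<Omega> C B f0 h t) (F t) \<le> ereal (error_constant * h)"
proof -
  interpret euler_scheme B c a f0 T "euler \<Omega> C B f0 h" h by (rule euler_scheme[OF h01])
  have E: "tv_le (\<lambda>v. 1 + norm v) (euler_path t) (F t) (error_constant * h)"
    by (rule euler_path_error[OF t])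
  have P: "euler_path t \<in> Prob_weighted (\<lambda>v. 1 + norm v)" "F t \<in> Prob_weighted (\<lambda>v. 1 + norm v)"
    using euler_path_Prob1 wild_sum_Prob1 t by (auto simp: Prob1_eq[symmetric])
  show "W1 (euler_interp \<Omega> C B f0 h t) (F t) \<le> ennreal (error_constant * h)"
    "KR_diff (euler_interp \<Omega> C B f0 h t) (F t) \<le> ereal (error_constant * h)"
    unfolding euler_interp_eq[OF h01] by (rule W1_le_tv[OF P E], rule KR_diff_le_tv[OF P E])
qed

lemma euler_interp_tendsto:
  "((\<lambda>h. SUP t\<in>{0..T}. W1 (euler_interp \<Omega> C B f0 h t) (F t)) \<longlongrightarrow> 0) (at_right 0)"
proof (rule tendsto_sandwich[OF _ _ tendsto_const])
  have "((\<lambda>h. ennreal (error_constant * h)) \<longlongrightarrow> ennreal (error_constant * 0)) (at_right 0)"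
    by (intro tendsto_intros)
  then show "((\<lambda>h. ennreal (error_constant * h)) \<longlongrightarrow> 0) (at_right 0)" by simp
  have "\<forall>\<^sub>F h in at_right 0. h \<in> {0<..<1::real}"
    by (rule eventually_at_right_real) simp
  then show "\<forall>\<^sub>F h in at_right 0. (SUP t\<in>{0..T}. W1 (euler_interp \<Omega> C B f0 h t) (F t)) \<le> ennreal (error_constant * h)"
    by eventually_elim (intro SUP_least euler_interp_error)
qed simp

end

text \<open>The constant \<open>error_constant\<close> as a function of the data; the absolute values make it positive for
arbitrary real arguments.\<close>

definition C_FE :: "real \<Rightarrow> real \<Rightarrow> real \<Rightarrow> real \<Rightarrow> real \<Rightarrow> real" where
  "C_FE T L K M m =
     (let a = \<bar>K * (1 + M)\<bar>; \<Lambda> = 2 * (1 + a) * (1 + \<bar>m\<bar> * exp (2 * a * \<bar>T\<bar>)) + 1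
      in (1 + \<Lambda>) * (\<bar>T\<bar> * \<Lambda>\<^sup>2 * exp (\<Lambda> * \<bar>T\<bar>)) + \<Lambda>\<^sup>2)"

lemma C_FE_pos: "0 < C_FE T L K M m"
proof -
  define a where "a = \<bar>K * (1 + M)\<bar>"
  define \<Lambda> where "\<Lambda> = 2 * (1 + a) * (1 + \<bar>m\<bar> * exp (2 * a * \<bar>T\<bar>)) + 1"
  have "0 \<le> a" by (simp add: a_def)
  then have "0 < \<Lambda>"
    unfolding \<Lambda>_def by (intro add_nonneg_pos mult_nonneg_nonneg add_nonneg_nonneg) simp_all
  then have "0 < (1 + \<Lambda>) * (\<bar>T\<bar> * \<Lambda>\<^sup>2 * exp (\<Lambda> * \<bar>T\<bar>)) + \<Lambda>\<^sup>2"
    by (intro add_nonneg_pos) auto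
  then show ?thesis by (simp add: C_FE_def Let_def a_def \<Lambda>_def)
qed

lemma (in cauchy_problem) error_constant_eq: "error_constant = C_FE T L K (M_inf B) (first_moment f0)"
  unfolding error_constant_def \<Lambda>_def A_def C_FE_def Let_def
  using T K M_nonneg first_moment_nonneg[of f0] by (simp add: a_def)

theorem theorem2p4:
  "\<exists>C_FE :: real \<Rightarrow> real \<Rightarrow> real \<Rightarrow> real \<Rightarrow> real \<Rightarrow> real.
     (\<forall>T L K M m. 0 < C_FE T L K M m) \<and>
     (\<forall>(\<Omega> :: 'a::euclidean_space set)
       (\<Theta> :: 'p::{real_normed_vector, second_countable_topology} set)
       (C :: 'a \<Rightarrow> 'a \<Rightarrow> 'p \<Rightarrow> 'a) (L :: real) (K :: real)
       (B :: 'p measure) (J :: ('p \<times> 'p) measure) (f0 :: 'a measure) (T :: real).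
       open \<Omega> \<and> connected \<Omega> \<and>
       collision_map \<Omega> \<Theta> C \<and>
       0 < L \<and> 0 < K \<and>
       (\<forall>v\<in>\<Omega>. \<forall>v'\<in>\<Omega>. \<forall>w\<in>\<Omega>. \<forall>w'\<in>\<Omega>. \<forall>\<theta>\<in>\<Theta>.
          norm (C v v' \<theta> - C w w' \<theta>) \<le> L * (1 + norm \<theta>) * (norm (v - w) + norm (v' - w'))) \<and>
       (\<forall>v\<in>\<Omega>. \<forall>v'\<in>\<Omega>. \<forall>\<theta>\<in>\<Theta>.
          norm (C v v' \<theta>) \<le> K * (1 + norm \<theta>) * (norm v + norm v')) \<and>
       B \<in> Prob_inf \<Theta> \<and> joint_law B J \<and>
       f0 \<in> Prob1 \<and> emeasure f0 \<Omega> = 1 \<and>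
       0 < T \<longrightarrow>
       (\<forall>h\<in>{0<..<1}. W1_continuous_on {0..T} (euler_interp \<Omega> C B f0 h)) \<and>
       (\<exists>f :: real \<Rightarrow> 'a measure.
          W1_Lipschitz_on {0..T} f \<and>
          ((\<lambda>h. SUP t\<in>{0..T}. W1 (euler_interp \<Omega> C B f0 h t) (f t)) \<longlongrightarrow> 0) (at_right 0) \<and>
          weak_measure_solution \<Omega> C J T f0 f \<and>
          (\<forall>g. weak_measure_solution \<Omega> C J T f0 g \<longrightarrow> (\<forall>t\<in>{0..T}. g t = f t)) \<and>
          (\<forall>h\<in>{0<..<1}.
             (SUP t\<in>{0..T}. KR_diff (euler_interp \<Omega> C B f0 h t) (f t))
               \<le> ereal (C_FE T L K (M_inf B) (first_moment f0) * h))))"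
proof (rule exI[of _ C_FE], intro conjI allI impI, goal_cases)
  case (1 T L K M m)
  show ?case by (rule C_FE_pos)
next
  case (2 \<Omega> \<Theta> C L K B J f0 T)
  then interpret cauchy_problem \<Omega> \<Theta> C K B J f0 T
    by unfold_locales auto
  show ?case by (intro ballI euler_interp_continuous)
next
  case (3 \<Omega> \<Theta> C L K B J f0 T)
  then interpret cauchy_problem \<Omega> \<Theta> C K B J f0 T
    by unfold_locales auto
  show ?case
  proof (intro exI[of _ F] conjI ballI allI impI)
    show "(SUP t\<in>{0..T}. KR_diff (euler_interp \<Omega> C B f0 h t) (F t))
        \<le> ereal (C_FE T L K (M_inf B) (first_moment f0) * h)" if "h \<in> {0<..<1}" for h
      unfolding error_constant_eq[of L, symmetric] using that by (intro SUP_least euler_interp_error(2))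
    show "g t = F t" if "weak_measure_solution \<Omega> C J T f0 g" "t \<in> {0..T}" for g t
      using that by (rule solution_unique)
  qed (rule wild_sum_W1_Lipschitz euler_interp_tendsto wild_sum_solution)+
qed

end
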